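(* Let $A,B$ be finite alphabets, let $T$ be a trimmed transducer from $A^*$ to $B^*$, i.e. a trimmed weighted automaton on $A$ with weights in the free monoid $B^*$, and let $k$ be a positive integer. The following assertions are equivalent: (i) $[\![T]\!]$ satisfies the Lipschitz property of order $k$; (ii) $T$ satisfies the branching twinning property of order $k$; (iii) $[\![T]\!]$ is positive $k$-sequential.
   Context: Weighted automata. A weighted automaton on a finite alphabet $A$ over a monoid $\mathbb{M}$ is a tuple $W=(Q,t_{init},t_{final},T)$ with $Q$ a finite set of states, $t_{init},t_{final}\subseteq Q\times\mathbb{M}$ finite, and $T\subseteq Q\times A\times\mathbb{M}\times Q$ a finite set of transitions. A state $q$ is initial (resp. final) if $(q,\alpha)\in t_{init}$ (resp. $t_{final}$) for some $\alpha$. A run $p\xrightarrow{w|\alpha}q$ is a sequence of consecutive transitions from $p$ to $q$ reading $w$, with output $\alpha$ the product of the weights in order; it is accepting if $p$ is initial and $q$ final. $[\![W]\!]=\{(w,\alpha\beta\gamma) : \exists p,q,\ (p,\alpha)\in t_{init},\ p\xrightarrow{w|\beta}q,\ (q,\gamma)\in t_{final}\}$. $W$ is trimmed if every state appears in some accepting run. $W$ is sequential if $|t_{init}|=1$ and for all $p\in Q,a\in A$ there is at most one transition of the form $(p,a,\alpha,q)$; it is $k$-sequential if it is a disjoint union of $k$ sequential weighted automata. A relation $R\subseteq A^*\times B^*$ is positive $k$-sequential if it is computed by a $k$-sequential weighted automaton with weights in $B^*$ (transition weights in $B^*$, initial and final relations in $Q\times B^*$). Let $\mathcal{F}(B)$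 be the free group generated by $B$; $B^*\subseteq\mathcal{F}(B)$. Let $d$ be the Cayley distance on $\mathcal{F}(B)$ with respect to generators $B$ (shortest path length in the undirected right Cayley graph), and $delay(\alpha,\beta)=\alpha^{-1}\beta$. For words, $dist(u,v)=|u|+|v|-2|lcp(u,v)|$, with $lcp$ the longest common prefix. The following two properties are understood by viewing weights in $\mathcal{F}(B)$. Lipschitz property of order $k$: $R\subseteq A^*\times B^*\subseteq A^*\times\mathcal{F}(B)$ satisfies it if there is a natural number $L$ such that for all $(w_0,\alpha_0),\dots,(w_k,\alpha_k)\in R$ there are $0\le i<j\le k$ with $d(\alpha_i,\alpha_j)\le L\,(dist(w_i,w_j)+1)$. Branching twinning property of order $k$: for all states $q_{i,j}$ ($0\le i,j\le k$) with every $q_{0,j}$ initial, all $\gamma_j$ with $(q_{0,j},\gamma_j)\in t_{init}$, and all words $u_{i,j},v_{i,j}$ ($1\le i\le k$, $0\le j\le k$) for which there are runs $q_{i-1,j}\xrightarrow{u_{i,j}|\alpha_{i,j}}q_{i,j}$ and $q_{i,j}\xrightarrow{v_{i,j}|\beta_{i,j}}q_{i,j}$ for all such $i,j$, there are $j\ne j'$ such that for all $i\in\{1,\dots,k\}$: if $u_{i',j}=u_{i',j'}$ and $v_{i',j}=v_{i',j'}$ for every $1\le i'\le i$, then $delay(\gamma_j\alpha_{1,j}\cdots\alpha_{i,j},\ \gamma_{j'}\alpha_{1,j'}\cdots\alpha_{i,j'})=delay(\gamma_j\alpha_{1,j}\cdots\alpha_{i,j}\beta_{i,j},\ \gamma_{j'}\alpha_{1,j'}\cdots\alpha_{i,j'}\beta_{i,j'})$.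 *)

theory Defs
  imports "HOL-Library.Sublist" "HOL-Algebra.Group"
begin

section \<open>Free monoids and free groups\<close>

definition free_monoid :: "'b set \<Rightarrow> 'b list monoid" where
  "free_monoid B = \<lparr>carrier = lists B, mult = (@), one = []\<rparr>"

text \<open>
  Elements of the free group are reduced words over signed letters, where \<open>(b, True)\<close> stands
  for the generator \<open>b\<close> and \<open>(b, False)\<close> for its formal inverse.
\<close>

definition inv_letter :: "'b \<times> bool \<Rightarrow> 'b \<times> bool" where
  "inv_letter x = (fst x, \<not> snd x)"

definition reduced :: "('b \<times> bool) list \<Rightarrow> bool" where
  "reduced xs = successively (\<lambda>x y. y \<noteq> inv_letter x) xs"

fun push :: "'b \<times> bool \<Rightarrow> ('b \<times> bool) list \<Rightarrow> ('b \<times> bool) list" where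
  "push x [] = [x]"
| "push x (y # ys) = (if y = inv_letter x then ys else x # y # ys)"

definition reduce :: "('b \<times> bool) list \<Rightarrow> ('b \<times> bool) list" where
  "reduce xs = foldr push xs []"

definition free_group :: "'b set \<Rightarrow> ('b \<times> bool) list monoid" where
  "free_group B =
     \<lparr>carrier = {xs \<in> lists (B \<times> UNIV). reduced xs},
      mult = (\<lambda>xs ys. reduce (xs @ ys)),
      one = []\<rparr>"

definition embed_word :: "'b list \<Rightarrow> ('b \<times> bool) list" where
  "embed_word w = map (\<lambda>b. (b, True)) w"

definition free_gens :: "'b set \<Rightarrow> ('b \<times> bool) list set" where
  "free_gens B = (\<lambda>b. embed_word [b]) ` B"

lemma inv_letter_invol [simp]: "inv_letter (inv_letter x) = x"
  by (simp add: inv_letter_def)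

lemma inv_letter_neq [simp]: "inv_letter x \<noteq> x" "x \<noteq> inv_letter x"
  by (auto simp: inv_letter_def prod_eq_iff)

lemma reduced_Nil [simp]: "reduced []"
  by (simp add: reduced_def)

lemma reduced_Cons: "reduced (x # xs) \<longleftrightarrow> (xs = [] \<or> hd xs \<noteq> inv_letter x) \<and> reduced xs"
  by (cases xs) (auto simp: reduced_def)

lemma reduced_push: "reduced xs \<Longrightarrow> reduced (push x xs)"
  by (cases xs) (auto simp: reduced_Cons)

lemma push_inv_letter: "reduced xs \<Longrightarrow> push (inv_letter x) (push x xs) = xs"
  by (cases xs; cases "tl xs") (auto simp: reduced_Cons)

lemma reduced_foldr_push: "reduced ys \<Longrightarrow> reduced (foldr push xs ys)"
  by (induction xs) (auto intro: reduced_push)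

lemma reduced_reduce: "reduced (reduce xs)"
  by (simp add: reduce_def reduced_foldr_push)

lemma reduce_reduced: "reduced xs \<Longrightarrow> reduce xs = xs"
proof (induction xs)
  case (Cons x xs)
  then show ?case by (cases xs) (auto simp: reduce_def reduced_Cons)
qed (simp add: reduce_def)

lemma reduce_append: "reduced ys \<Longrightarrow> reduce (xs @ ys) = foldr push xs ys"
  using reduce_reduced[of ys] by (simp add: reduce_def)

lemma foldr_push_push:
  assumes "reduced zs"
  shows "foldr push (push x ys) zs = push x (foldr push ys zs)"
proof (cases ys)
  case (Cons y ys')
  then show ?thesis
    using push_inv_letter[OF reduced_foldr_push[OF assms], of "inv_letter x" ys'] by auto
qed simp

lemma foldr_push_assoc:
  "reduced zs \<Longrightarrow> foldr push (foldr push xs ys) zs = foldr push xs (foldr push ys zs)"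
  by (induction xs) (auto simp: foldr_push_push)

lemma set_push: "set (push x xs) \<subseteq> insert x (set xs)"
  by (cases xs) auto

lemma set_foldr_push: "set (foldr push xs ys) \<subseteq> set xs \<union> set ys"
proof (induction xs)
  case (Cons x xs)
  then show ?case using set_push[of x "foldr push xs ys"] by auto
qed simp

lemma foldr_push_left_inverse:
  "reduced ys \<Longrightarrow> foldr push (rev (map inv_letter xs)) (foldr push xs ys) = ys"
  by (induction xs) (auto simp: push_inv_letter reduced_foldr_push)

lemma group_free_group: "group (free_group B)"
proof (rule groupI)
  fix xs ys
  assume xs: "xs \<in> carrier (free_group B)" and ys: "ys \<in> carrier (free_group B)"
  then show "xs \<otimes>\<^bsub>free_group B\<^esub> ys \<in> carrier (free_group B)"
    using set_foldr_push[of xs ys]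
    by (auto simp: free_group_def in_lists_conv_set reduce_append reduced_foldr_push)
next
  fix xs ys zs
  assume "xs \<in> carrier (free_group B)" "ys \<in> carrier (free_group B)" "zs \<in> carrier (free_group B)"
  then show "xs \<otimes>\<^bsub>free_group B\<^esub> ys \<otimes>\<^bsub>free_group B\<^esub> zs =
             xs \<otimes>\<^bsub>free_group B\<^esub> (ys \<otimes>\<^bsub>free_group B\<^esub> zs)"
    by (simp add: free_group_def reduce_append reduced_foldr_push foldr_push_assoc)
next
  fix xs
  assume xs: "xs \<in> carrier (free_group B)"
  let ?ys = "reduce (rev (map inv_letter xs))"
  have "set ?ys \<subseteq> B \<times> UNIV"
    using xs set_foldr_push[of "rev (map inv_letter xs)" "[]"]
    by (fastforce simp: free_group_def reduce_def inv_letter_def in_lists_conv_set)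
  then have "?ys \<in> carrier (free_group B)"
    by (auto simp: free_group_def reduced_reduce in_lists_conv_set)
  moreover have "?ys \<otimes>\<^bsub>free_group B\<^esub> xs = \<one>\<^bsub>free_group B\<^esub>"
  proof -
    have r: "reduced xs" using xs by (simp add: free_group_def)
    have "reduce (?ys @ xs) = foldr push (rev (map inv_letter xs)) xs"
      using r by (simp add: reduce_append) (simp add: reduce_def foldr_push_assoc)
    also have "\<dots> = []"
      using foldr_push_left_inverse[of "[]" xs] reduce_reduced[OF r] by (simp add: reduce_def)
    finally show ?thesis by (simp add: free_group_def)
  qed
  ultimately show "\<exists>ys\<in>carrier (free_group B). ys \<otimes>\<^bsub>free_group B\<^esub> xs = \<one>\<^bsub>free_group B\<^esub>"
    by blast
qed (auto simp: free_group_def reduce_reduced)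

lemma reduced_embed_word: "reduced (embed_word w)"
  by (induction w) (auto simp: embed_word_def reduced_Cons inv_letter_def hd_map)

lemma embed_word_hom: "embed_word \<in> hom (free_monoid B) (free_group B)"
proof (rule homI)
  fix v w
  show "embed_word (v \<otimes>\<^bsub>free_monoid B\<^esub> w) = embed_word v \<otimes>\<^bsub>free_group B\<^esub> embed_word w"
    using reduce_reduced[OF reduced_embed_word[of "v @ w"]]
    by (simp add: free_monoid_def free_group_def embed_word_def)
next
  fix w
  assume "w \<in> carrier (free_monoid B)"
  then show "embed_word w \<in> carrier (free_group B)"
    using reduced_embed_word[of w]
    by (auto simp: free_monoid_def free_group_def embed_word_def)
qed

lemma inj_embed_word: "inj embed_word"
  by (auto simp: inj_on_def embed_word_def map_eq_conv inj_map_eq_map)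


section \<open>Distances and delays\<close>

definition cayley_edges :: "('g, 'x) monoid_scheme \<Rightarrow> 'g set \<Rightarrow> ('g \<times> 'g) set" where
  "cayley_edges G S =
     {(g, h). g \<in> carrier G \<and> h \<in> carrier G \<and> (\<exists>s\<in>S. h = g \<otimes>\<^bsub>G\<^esub> s \<or> g = h \<otimes>\<^bsub>G\<^esub> s)}"

text \<open>Meaningful only for elements joined by a path, which is automatic if \<open>S\<close> generates \<open>G\<close>.\<close>

definition cayley_dist :: "('g, 'x) monoid_scheme \<Rightarrow> 'g set \<Rightarrow> 'g \<Rightarrow> 'g \<Rightarrow> nat" where
  "cayley_dist G S g h = (LEAST n. (g, h) \<in> cayley_edges G S ^^ n)"

definition delay :: "('g, 'x) monoid_scheme \<Rightarrow> 'g \<Rightarrow> 'g \<Rightarrow> 'g" where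
  "delay G x y = inv\<^bsub>G\<^esub> x \<otimes>\<^bsub>G\<^esub> y"

text \<open>The subtraction never truncates.\<close>

definition word_dist :: "'a list \<Rightarrow> 'a list \<Rightarrow> nat" where
  "word_dist u v = length u + length v - 2 * length (longest_common_prefix u v)"


section \<open>Weighted automata\<close>

record ('q, 'a, 'm) wa =
  states :: "'q set"
  t_init :: "('q \<times> 'm) set"
  t_final :: "('q \<times> 'm) set"
  transitions :: "('q \<times> 'a \<times> 'm \<times> 'q) set"

definition weighted_automaton ::
  "'a set \<Rightarrow> ('m, 'x) monoid_scheme \<Rightarrow> ('q, 'a, 'm) wa \<Rightarrow> bool" where
  "weighted_automaton A M W \<longleftrightarrow>
     finite (states W) \<and>
     finite (t_init W) \<and> t_init W \<subseteq> states W \<times> carrier M \<and>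
     finite (t_final W) \<and> t_final W \<subseteq> states W \<times> carrier M \<and>
     finite (transitions W) \<and> transitions W \<subseteq> states W \<times> A \<times> carrier M \<times> states W"

definition initial :: "('q, 'a, 'm) wa \<Rightarrow> 'q \<Rightarrow> bool" where
  "initial W q \<longleftrightarrow> (\<exists>x. (q, x) \<in> t_init W)"

definition final :: "('q, 'a, 'm) wa \<Rightarrow> 'q \<Rightarrow> bool" where
  "final W q \<longleftrightarrow> (\<exists>x. (q, x) \<in> t_final W)"

fun is_path :: "('q, 'a, 'm) wa \<Rightarrow> 'q \<Rightarrow> ('q \<times> 'a \<times> 'm \<times> 'q) list \<Rightarrow> 'q \<Rightarrow> bool" where
  "is_path W p [] q \<longleftrightarrow> p \<in> states W \<and> q = p"
| "is_path W p ((p', a, x, r) # ts) q \<longleftrightarrow>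
     p' = p \<and> (p, a, x, r) \<in> transitions W \<and> is_path W r ts q"

definition path_states :: "'q \<Rightarrow> ('q \<times> 'a \<times> 'm \<times> 'q) list \<Rightarrow> 'q set" where
  "path_states p ts = insert p ((\<lambda>(_, _, _, r). r) ` set ts)"

definition list_prod :: "('m, 'x) monoid_scheme \<Rightarrow> 'm list \<Rightarrow> 'm" where
  "list_prod M xs = foldr (\<otimes>\<^bsub>M\<^esub>) xs \<one>\<^bsub>M\<^esub>"

definition run ::
  "('m, 'x) monoid_scheme \<Rightarrow> ('q, 'a, 'm) wa \<Rightarrow> 'q \<Rightarrow> 'a list \<Rightarrow> 'm \<Rightarrow> 'q \<Rightarrow> bool" where
  "run M W p w x q \<longleftrightarrow>
     (\<exists>ts. is_path W p ts q \<and>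
           w = map (\<lambda>(_, a, _, _). a) ts \<and>
           x = list_prod M (map (\<lambda>(_, _, y, _). y) ts))"

definition semantics ::
  "('m, 'x) monoid_scheme \<Rightarrow> ('q, 'a, 'm) wa \<Rightarrow> ('a list \<times> 'm) set" where
  "semantics M W =
     {(w, x \<otimes>\<^bsub>M\<^esub> y \<otimes>\<^bsub>M\<^esub> z) | w x y z.
        \<exists>p q. (p, x) \<in> t_init W \<and> run M W p w y q \<and> (q, z) \<in> t_final W}"

definition trimmed :: "('q, 'a, 'm) wa \<Rightarrow> bool" where
  "trimmed W \<longleftrightarrow>
     (\<forall>s\<in>states W. \<exists>p ts q. initial W p \<and> is_path W p ts q \<and> final W q \<and> s \<in> path_states p ts)"

definition sequential :: "('q, 'a, 'm) wa \<Rightarrow> bool" where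
  "sequential W \<longleftrightarrow>
     card (t_init W) = 1 \<and>
     (\<forall>p a x q x' q'. (p, a, x, q) \<in> transitions W \<and> (p, a, x', q') \<in> transitions W
        \<longrightarrow> x = x' \<and> q = q')"

definition k_sequential ::
  "nat \<Rightarrow> 'a set \<Rightarrow> ('m, 'x) monoid_scheme \<Rightarrow> ('q, 'a, 'm) wa \<Rightarrow> bool" where
  "k_sequential k A M W \<longleftrightarrow>
     (\<exists>V :: nat \<Rightarrow> ('q, 'a, 'm) wa.
        (\<forall>i<k. weighted_automaton A M (V i) \<and> sequential (V i)) \<and>
        (\<forall>i<k. \<forall>j<k. i \<noteq> j \<longrightarrow> states (V i) \<inter> states (V j) = {}) \<and>
        states W = (\<Union>i<k. states (V i)) \<and>
        t_init W = (\<Union>i<k. t_init (V i)) \<and>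
        t_final W = (\<Union>i<k. t_final (V i)) \<and>
        transitions W = (\<Union>i<k. transitions (V i)))"

text \<open>
  Automata have finitely many states, so up to renaming of states nothing is lost by taking
  natural numbers as states.
\<close>

definition positive_k_sequential ::
  "nat \<Rightarrow> 'a set \<Rightarrow> 'b set \<Rightarrow> ('a list \<times> 'b list) set \<Rightarrow> bool" where
  "positive_k_sequential k A B R \<longleftrightarrow>
     (\<exists>W :: (nat, 'a, 'b list) wa.
        weighted_automaton A (free_monoid B) W \<and>
        k_sequential k A (free_monoid B) W \<and>
        semantics (free_monoid B) W = R)"

definition map_weights :: "('m \<Rightarrow> 'n) \<Rightarrow> ('q, 'a, 'm) wa \<Rightarrow> ('q, 'a, 'n) wa" where
  "map_weights f W =
     \<lparr>states = states W,
      t_init = map_prod id f ` t_init W,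
      t_final = map_prod id f ` t_final W,
      transitions = (\<lambda>(p, a, x, q). (p, a, f x, q)) ` transitions W\<rparr>"


section \<open>Lipschitz and branching twinning properties\<close>

definition lipschitz_property ::
  "nat \<Rightarrow> ('g, 'x) monoid_scheme \<Rightarrow> 'g set \<Rightarrow> ('a list \<times> 'g) set \<Rightarrow> bool" where
  "lipschitz_property k G S R \<longleftrightarrow>
     (\<exists>L :: nat. \<forall>(w :: nat \<Rightarrow> 'a list) (x :: nat \<Rightarrow> 'g).
        (\<forall>i\<le>k. (w i, x i) \<in> R) \<longrightarrow>
        (\<exists>i j. i < j \<and> j \<le> k \<and>
           cayley_dist G S (x i) (x j) \<le> L * (word_dist (w i) (w j) + 1)))"

text \<open>
  \<open>prefix_output G c x i j\<close> is the product of \<open>c j\<close> with \<open>x 1 j\<close>, \<open>x 2 j\<close>, ..., \<open>x i j\<close>.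
\<close>

definition prefix_output ::
  "('g, 'x) monoid_scheme \<Rightarrow> (nat \<Rightarrow> 'g) \<Rightarrow> (nat \<Rightarrow> nat \<Rightarrow> 'g) \<Rightarrow> nat \<Rightarrow> nat \<Rightarrow> 'g" where
  "prefix_output G c x i j = c j \<otimes>\<^bsub>G\<^esub> list_prod G (map (\<lambda>i'. x i' j) [1..<Suc i])"

definition branching_twinning_property ::
  "nat \<Rightarrow> ('g, 'x) monoid_scheme \<Rightarrow> ('q, 'a, 'g) wa \<Rightarrow> bool" where
  "branching_twinning_property k G W \<longleftrightarrow>
     (\<forall>(q :: nat \<Rightarrow> nat \<Rightarrow> 'q) (c :: nat \<Rightarrow> 'g)
       (u :: nat \<Rightarrow> nat \<Rightarrow> 'a list) (v :: nat \<Rightarrow> nat \<Rightarrow> 'a list)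
       (x :: nat \<Rightarrow> nat \<Rightarrow> 'g) (y :: nat \<Rightarrow> nat \<Rightarrow> 'g).
        (\<forall>j\<le>k. (q 0 j, c j) \<in> t_init W) \<and>
        (\<forall>i\<in>{1..k}. \<forall>j\<le>k.
           run G W (q (i - 1) j) (u i j) (x i j) (q i j) \<and>
           run G W (q i j) (v i j) (y i j) (q i j))
        \<longrightarrow>
        (\<exists>j\<le>k. \<exists>j'\<le>k. j \<noteq> j' \<and>
           (\<forall>i\<in>{1..k}.
              (\<forall>i'\<in>{1..i}. u i' j = u i' j' \<and> v i' j = v i' j') \<longrightarrow>
              delay G (prefix_output G c x i j) (prefix_output G c x i j') =
              delay G (prefix_output G c x i j \<otimes>\<^bsub>G\<^esub> y i j)
                      (prefix_output G c x i j' \<otimes>\<^bsub>G\<^esub> y i j'))))"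

end

theory Submission
  imports Defs "HOL-Library.Nat_Bijection"
begin

text \<open>A configuration is a state with an output produced so far. Call a set of configurations
  \<open>branching n\<close> if \<open>n\<close> runs can be started from it that are pairwise separated, before they read
  different words, by loops on a common word that change their delay; the branching twinning
  property of order \<open>k\<close> says that the initial configurations are not \<open>branching (k + 1)\<close>.

  If \<open>n\<close> separated runs exist, pumping the loops often enough, those near the root most, yields
  \<open>n\<close> pairs of the relation that violate the Lipschitz property.

  Conversely let \<open>m\<close> be the largest number with \<open>branching m S\<close>. A sequential transducer can follow
  all runs from \<open>S\<close> at once, outputting the longest common prefix of their outputs, as long as the
  remaining outputs stay bounded. When two of them drift apart, the current configurations fall
  into two nonempty parts \<open>X\<close> and \<open>Y\<close> that are far from each other. By a pigeonhole argument every
  run into \<open>X\<close> is separated from every run into \<open>Y\<close> by an earlier common loop, so the largest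
  branching numbers of \<open>X\<close> and \<open>Y\<close> add up to at most \<open>m\<close>, and by induction \<open>X\<close> and \<open>Y\<close> are taken
  over by \<open>m\<close> sequential transducers in total. All outputs are common prefixes of words in \<open>B\<^sup>*\<close>,
  hence positive.\<close>

section \<open>Delays of words\<close>

text \<open>The twinning property compares runs arranged in \<open>k\<close> levels, a form that
  does not survive splitting the runs into two groups. The tree form \<open>branching\<close> does:
  a binary tree with \<open>n\<close> leaves has depth at most \<open>n - 1\<close>, so
  \<open>k + 1\<close> leaves fit into \<open>k\<close> levels, and trivial loops fill the remaining
  ones. Two facts make the counting additive. For a fixed loop, not being separated is an
  equivalence relation (\<open>dly_trans\<close>), so a loop that separates one pair cuts all runs
  looping there into two mutually separated classes. And a witness for a union divides into
  witnesses for its parts (\<open>branching_Un\<close>), whatever the cut. The pigeonhole needs one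
  loop common to all chosen runs at once, so their number has to be bounded beforehand;
  \<open>branching_finite_subset\<close> provides this. The threshold for drifting apart depends
  only on the starting set and not on the word read, which leaves only finitely many sets of
  configurations once their common prefix is stripped. Distances and delays are tied together by one
  identity: the length of the delay of two words is both \<open>word_dist\<close> and the Cayley
  distance.\<close>

lemma (in group) mult_inv_cancel:
  assumes "x \<in> carrier G" "y \<in> carrier G"
  shows "x \<otimes> (inv x \<otimes> y) = y" "inv x \<otimes> (x \<otimes> y) = y"
  using assms by (simp_all flip: m_assoc)

text \<open>Taken over all letters, so that no carrier conditions arise;
  \<open>delay_embed_word\<close> transfers the result to \<open>free_group B\<close>.\<close>

definition dly :: "'b list \<Rightarrow> 'b list \<Rightarrow> ('b \<times> bool) list" where
  "dly x y = delay (free_group UNIV) (embed_word x) (embed_word y)"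

lemma embed_word_carrier: "x \<in> lists B \<Longrightarrow> embed_word x \<in> carrier (free_group B)"
  using embed_word_hom[of B] by (auto simp: hom_def free_monoid_def)

lemma embed_word_append: "embed_word (x @ y) = embed_word x \<otimes>\<^bsub>free_group B\<^esub> embed_word y"
  using reduce_reduced[OF reduced_embed_word[of "x @ y"]]
  by (simp add: free_group_def embed_word_def)

text \<open>Multiplication is the same function for every alphabet and only the carrier varies, so
  uniqueness of inverses in the larger group applies.\<close>

lemma inv_free_group:
  assumes "g \<in> carrier (free_group B)"
  shows "inv\<^bsub>free_group B\<^esub> g = inv\<^bsub>free_group UNIV\<^esub> g"
proof -
  interpret G: group "free_group B" by (rule group_free_group)
  interpret U: group "free_group (UNIV :: 'b set)" by (rule group_free_group)
  have sub: "carrier (free_group B) \<subseteq> carrier (free_group UNIV)"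
    by (auto simp: free_group_def)
  have "inv\<^bsub>free_group B\<^esub> g \<otimes>\<^bsub>free_group UNIV\<^esub> g = \<one>\<^bsub>free_group UNIV\<^esub>"
    using G.l_inv[OF assms] by (simp add: free_group_def)
  then show ?thesis
    using U.inv_equality[of "inv\<^bsub>free_group B\<^esub> g" g] sub assms G.inv_closed[OF assms]
    by (metis subsetD)
qed

lemma delay_free_group:
  assumes "g \<in> carrier (free_group B)"
  shows "delay (free_group B) g h = delay (free_group UNIV) g h"
  unfolding delay_def inv_free_group[OF assms] by (simp add: free_group_def)

lemma delay_embed_word:
  "x \<in> lists B \<Longrightarrow> delay (free_group B) (embed_word x) (embed_word y) = dly x y"
  using delay_free_group[OF embed_word_carrier] by (simp add: dly_def)

interpretation FG: group "free_group UNIV" by (rule group_free_group)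

lemma embed_word_UNIV [simp]: "embed_word x \<in> carrier (free_group UNIV)"
  by (simp add: embed_word_carrier)

lemma dly_closed [simp]: "dly x y \<in> carrier (free_group UNIV)"
  by (simp add: dly_def delay_def)

lemma dly_append:
  "dly (x @ a) (y @ b) =
    inv\<^bsub>free_group UNIV\<^esub> embed_word a \<otimes>\<^bsub>free_group UNIV\<^esub> dly x y \<otimes>\<^bsub>free_group UNIV\<^esub> embed_word b"
  by (simp add: dly_def delay_def embed_word_append[where B = UNIV] FG.inv_mult_group FG.m_assoc)

text \<open>Appending fixed suffixes multiplies the delay by fixed group elements on both sides,
  which can be cancelled. Hence a loop that keeps a delay once keeps it under every
  iteration.\<close>

lemma dly_append_eq_iff:
  "dly (x @ a) (y @ b) = dly (x' @ a) (y' @ b) \<longleftrightarrow> dly x y = dly x' y'"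
  by (simp add: dly_append)

lemma dly_append_left [simp]: "dly (h @ x) (h @ y) = dly x y"
  by (simp add: dly_def delay_def embed_word_append[where B = UNIV] FG.inv_mult_group FG.m_assoc
      FG.mult_inv_cancel)

lemma dly_mult: "dly x y \<otimes>\<^bsub>free_group UNIV\<^esub> dly y z = dly x z"
  by (simp add: dly_def delay_def FG.m_assoc FG.mult_inv_cancel)

text \<open>With \<open>dly_sym\<close> this makes keeping the delay under a given loop an
  equivalence between runs.\<close>

lemma dly_trans:
  assumes "dly x y = dly x' y'" and "dly y z = dly y' z'"
  shows "dly x z = dly x' z'"
  using assms dly_mult[of x y z] dly_mult[of x' y' z'] by simp

lemma dly_commute: "dly y x = inv\<^bsub>free_group UNIV\<^esub> dly x y"
  by (simp add: dly_def delay_def FG.inv_mult_group)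

lemma dly_sym: "dly x y = dly x' y' \<Longrightarrow> dly y x = dly y' x'"
  by (simp add: dly_commute[of y x] dly_commute[of y' x'])

lemma reduced_map_False: "reduced (map (\<lambda>b. (b, False)) x)"
  by (induction x) (auto simp: reduced_Cons inv_letter_def hd_map)

lemma inv_embed_word:
  "inv\<^bsub>free_group UNIV\<^esub> embed_word x = rev (map (\<lambda>b. (b, False)) x)"
proof (rule FG.inv_equality)
  have "foldr push (rev (map inv_letter (embed_word x))) (foldr push (embed_word x) []) = []"
    by (rule foldr_push_left_inverse) simp
  moreover have "map inv_letter (embed_word x) = map (\<lambda>b. (b, False)) x"
    by (simp add: embed_word_def inv_letter_def)
  ultimately show "rev (map (\<lambda>b. (b, False)) x) \<otimes>\<^bsub>free_group UNIV\<^esub> embed_word x = \<one>\<^bsub>free_group UNIV\<^esub>"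
    by (simp add: free_group_def reduce_def)
  have "reduced (rev (map (\<lambda>b. (b, False)) x))"
    using reduced_map_False[of "rev x"] by (simp add: rev_map)
  then show "rev (map (\<lambda>b. (b, False)) x) \<in> carrier (free_group UNIV)"
    by (simp add: free_group_def)
qed simp

section \<open>Word distance as the length of the delay\<close>

lemma word_dist_code:
  "word_dist [] y = length y"
  "word_dist x [] = length x"
  "word_dist (a # x) (b # y) = (if a = b then word_dist x y else length x + length y + 2)"
  by (auto simp: word_dist_def)

lemma longest_common_prefix_decomp:
  obtains p r s where "x = p @ r" "y = p @ s" "longest_common_prefix x y = p"
    "r = [] \<or> s = [] \<or> hd r \<noteq> hd s"
proof -
  have "\<exists>p r s. x = p @ r \<and> y = p @ s \<and> longest_common_prefix x y = p \<and>
    (r = [] \<or> s = [] \<or> hd r \<noteq> hd s)"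
  proof (induction x y rule: longest_common_prefix.induct)
    case (1 x xs y ys)
    show ?case
    proof (cases "x = y")
      case True
      then obtain p r s where "xs = p @ r" "ys = p @ s" "longest_common_prefix xs ys = p"
        "r = [] \<or> s = [] \<or> hd r \<noteq> hd s" using 1 by blast
      then show ?thesis using True by (intro exI[of _ "x # p"] exI[of _ r] exI[of _ s]) simp
    qed (use 1 in force)
  qed auto
  then show thesis using that by blast
qed

text \<open>Inside each half all signs are equal, and at the junction the two first letters differ,
  so nothing cancels and the product is already reduced.\<close>

lemma dly_cancelled:
  assumes "r = [] \<or> s = [] \<or> hd r \<noteq> hd s"
  shows "dly r s = rev (map (\<lambda>b. (b, False)) r) @ embed_word s"
proof -
  have "reduced (rev (map (\<lambda>b. (b, False)) r) @ embed_word s)"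
    using assms reduced_embed_word[of s]
  proof (induction r arbitrary: s rule: rev_induct)
    case (snoc b r)
    show ?case
    proof (cases r)
      case Nil
      then show ?thesis using snoc.prems
        by (cases s) (auto simp: reduced_Cons embed_word_def inv_letter_def)
    next
      case (Cons c r')
      then have "reduced (rev (map (\<lambda>b. (b, False)) r) @ embed_word s)"
        using snoc by auto
      then show ?thesis using Cons
        by (cases r' rule: rev_cases) (auto simp: reduced_Cons inv_letter_def)
    qed
  qed simp
  then show ?thesis
    by (simp add: dly_def delay_def inv_embed_word) (simp add: free_group_def reduce_reduced)
qed

lemma length_dly: "length (dly x y) = word_dist x y"
proof -
  obtain p r s where *: "x = p @ r" "y = p @ s" "longest_common_prefix x y = p"
    "r = [] \<or> s = [] \<or> hd r \<noteq> hd s"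
    by (rule longest_common_prefix_decomp)
  then have "length (dly x y) = length r + length s"
    by (simp add: dly_cancelled embed_word_def)
  also have "\<dots> = word_dist x y"
    unfolding word_dist_def * (3) using *(1,2) by simp
  finally show ?thesis .
qed

lemma length_foldr_push: "length (foldr push xs ys) \<le> length xs + length ys"
proof (induction xs)
  case (Cons x xs)
  then show ?case by (cases "foldr push xs ys") auto
qed simp

lemma length_mult_le: "length (g \<otimes>\<^bsub>free_group B\<^esub> h) \<le> length g + length h"
  using length_foldr_push[of "g @ h" "[]"] by (simp add: free_group_def reduce_def)

text \<open>Comes from the group: delays multiply along \<open>x\<close>, \<open>y\<close>,
  \<open>z\<close>, and reduction never lengthens a word. This avoids a case analysis on common
  prefixes.\<close>

lemma word_dist_triangle: "word_dist x z \<le> word_dist x y + word_dist y z"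
  using length_mult_le[of UNIV "dly x y" "dly y z"] by (simp add: dly_mult length_dly)

lemma dly_eq_word_dist: "dly x y = dly x' y' \<Longrightarrow> word_dist x y = word_dist x' y'"
  by (metis length_dly)

lemma word_dist_append_left [simp]: "word_dist (h @ x) (h @ y) = word_dist x y"
  by (metis length_dly dly_append_left)

lemma word_dist_self [simp]: "word_dist x x = 0"
  by (induction x) (auto simp: word_dist_code)

lemma word_dist_commute: "word_dist x y = word_dist y x"
  by (induction x y rule: longest_common_prefix.induct) (auto simp: word_dist_code)

lemma word_dist_append_self [simp]:
  "word_dist x (x @ a) = length a" "word_dist (x @ a) x = length a"
  using word_dist_append_left[of x "[]" a] word_dist_append_left[of x a "[]"]
  by (simp_all add: word_dist_code)

lemma word_dist_append_le: "word_dist (x @ a) (y @ b) \<le> word_dist x y + length a + length b"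
  using word_dist_triangle[of "x @ a" "y @ b" x] word_dist_triangle[of x "y @ b" y] by simp

lemma word_dist_append_ge: "word_dist x y \<le> word_dist (x @ a) (y @ b) + length a + length b"
  using word_dist_triangle[of x y "x @ a"] word_dist_triangle[of "x @ a" y "y @ b"] by simp

lemma word_dist_le_length: "word_dist x y \<le> length x + length y"
  by (simp add: word_dist_def)

text \<open>Deleting letters down to the common prefix and then adding letters gives a path of
  length \<open>word_dist x y\<close>; no path is shorter, since each edge lengthens the delay by at
  most one.\<close>

lemma cayley_dist_embed_word:
  assumes x: "x \<in> lists B" and y: "y \<in> lists B"
  shows "cayley_dist (free_group B) (free_gens B) (embed_word x) (embed_word y) = word_dist x y"
proof -
  let ?E = "cayley_edges (free_group B) (free_gens B)"
  interpret group "free_group B" by (rule group_free_group)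
  have gens: "free_gens B \<subseteq> carrier (free_group B)"
    by (auto simp: free_gens_def intro!: embed_word_carrier)
  have edge: "(embed_word w, embed_word (w @ [b])) \<in> ?E" "(embed_word (w @ [b]), embed_word w) \<in> ?E"
    if "w \<in> lists B" "b \<in> B" for w b
    using that embed_word_carrier[of "w @ [b]" B] embed_word_carrier[of w B]
    by (auto simp: cayley_edges_def free_gens_def embed_word_append[where B = B])
  have up: "(embed_word w, embed_word (w @ r)) \<in> ?E ^^ length r"
    if "w @ r \<in> lists B" for w r
    using that
  proof (induction r rule: rev_induct)
    case (snoc b r)
    then show ?case using edge(1)[of "w @ r" b] by (auto intro: relpow_Suc_I)
  qed simp
  have down: "(embed_word (w @ r), embed_word w) \<in> ?E ^^ length r"
    if "w @ r \<in> lists B" for w r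
    using that
  proof (induction r rule: rev_induct)
    case (snoc b r)
    then show ?case using edge(2)[of "w @ r" b] relpow_Suc_I2[of _ "embed_word (w @ r)" ?E] by auto
  qed simp
  obtain p r s where *: "x = p @ r" "y = p @ s" "longest_common_prefix x y = p"
    by (rule longest_common_prefix_decomp)
  have "(embed_word x, embed_word y) \<in> ?E ^^ (length r + length s)"
    using down[of p r] up[of p s] x y unfolding *(1,2) relpow_add by blast
  moreover have "word_dist x y = length r + length s"
    unfolding word_dist_def *(3) using *(1,2) by simp
  ultimately have path: "(embed_word x, embed_word y) \<in> ?E ^^ word_dist x y" by simp
  \<comment> \<open>The target is generalised to arbitrary group elements, because a shortest path
    may a priori leave the positive words.\<close>
  have lower: "length (delay (free_group B) g h) \<le> n \<and> h \<in> carrier (free_group B)"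
    if "(g, h) \<in> ?E ^^ n" "g \<in> carrier (free_group B)" for g h n
    using that
  proof (induction n arbitrary: h)
    case 0
    then show ?case by (simp add: delay_def) (simp add: free_group_def)
  next
    case (Suc n)
    then obtain h' where h': "(g, h') \<in> ?E ^^ n" "(h', h) \<in> ?E" by auto
    then have IH: "length (delay (free_group B) g h') \<le> n" "h' \<in> carrier (free_group B)"
      using Suc by auto
    have h: "h \<in> carrier (free_group B)" using h' by (auto simp: cayley_edges_def)
    have "length (inv\<^bsub>free_group B\<^esub> h' \<otimes>\<^bsub>free_group B\<^esub> h) \<le> 1"
    proof -
      obtain b where b: "b \<in> B"
        "h = h' \<otimes>\<^bsub>free_group B\<^esub> embed_word [b] \<or> h' = h \<otimes>\<^bsub>free_group B\<^esub> embed_word [b]"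
        using h'(2) by (auto simp: cayley_edges_def free_gens_def)
      then have e: "embed_word [b] \<in> carrier (free_group B)" by (simp add: embed_word_carrier)
      from b(2) show ?thesis
      proof
        assume "h = h' \<otimes>\<^bsub>free_group B\<^esub> embed_word [b]"
        then have "inv\<^bsub>free_group B\<^esub> h' \<otimes>\<^bsub>free_group B\<^esub> h = embed_word [b]"
          using IH(2) e by (simp add: mult_inv_cancel)
        then show ?thesis by (simp add: embed_word_def)
      next
        assume "h' = h \<otimes>\<^bsub>free_group B\<^esub> embed_word [b]"
        then have "inv\<^bsub>free_group B\<^esub> h' \<otimes>\<^bsub>free_group B\<^esub> h = inv\<^bsub>free_group B\<^esub> embed_word [b]"
          using h e by (simp add: inv_mult_group m_assoc)
        also have "\<dots> = [(b, False)]"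
          using inv_free_group[OF e] by (simp add: inv_embed_word)
        finally show ?thesis by simp
      qed
    qed
    moreover have "delay (free_group B) g h =
        delay (free_group B) g h' \<otimes>\<^bsub>free_group B\<^esub> (inv\<^bsub>free_group B\<^esub> h' \<otimes>\<^bsub>free_group B\<^esub> h)"
      using Suc.prems(2) IH(2) h by (simp add: delay_def m_assoc mult_inv_cancel)
    ultimately show ?case
      using length_mult_le[of B "delay (free_group B) g h'" "inv\<^bsub>free_group B\<^esub> h' \<otimes>\<^bsub>free_group B\<^esub> h"]
        IH(1) h by (simp del: One_nat_def)
  qed
  show ?thesis unfolding cayley_dist_def
  proof (rule Least_equality, rule path)
    fix n assume "(embed_word x, embed_word y) \<in> ?E ^^ n"
    from lower[OF this embed_word_carrier[OF x]] show "word_dist x y \<le> n"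
      by (simp add: delay_embed_word[OF x] length_dly)
  qed
qed

section \<open>Branching sets of configurations\<close>

lemma run_Nil: "run M W p [] x q \<longleftrightarrow> p \<in> states W \<and> q = p \<and> x = \<one>\<^bsub>M\<^esub>"
  by (auto simp: run_def list_prod_def)

lemma run_Cons:
  "run M W p (a # w) x q \<longleftrightarrow>
    (\<exists>y r z. (p, a, y, r) \<in> transitions W \<and> run M W r w z q \<and> x = y \<otimes>\<^bsub>M\<^esub> z)"
  (is "?L \<longleftrightarrow> ?R")
proof
  assume ?L
  then obtain ts where ts: "is_path W p ts q" "a # w = map (\<lambda>(_, a, _, _). a) ts"
    "x = list_prod M (map (\<lambda>(_, _, y, _). y) ts)"
    unfolding run_def by (elim exE conjE) (rule that)
  from ts(2) obtain t ts' where "ts = t # ts'" by (cases ts) auto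
  moreover obtain p' a' y r where "t = (p', a', y, r)" by (cases t)
  ultimately have "(p, a, y, r) \<in> transitions W" "is_path W r ts' q"
      "w = map (\<lambda>(_, a, _, _). a) ts'"
      "x = y \<otimes>\<^bsub>M\<^esub> list_prod M (map (\<lambda>(_, _, y, _). y) ts')"
    using ts by (auto simp: list_prod_def)
  then show ?R unfolding run_def by (intro exI conjI) (assumption | rule refl)+
next
  assume ?R
  then obtain y r ts where "(p, a, y, r) \<in> transitions W" "is_path W r ts q"
      "w = map (\<lambda>(_, a, _, _). a) ts"
      "x = y \<otimes>\<^bsub>M\<^esub> list_prod M (map (\<lambda>(_, _, y, _). y) ts)"
    unfolding run_def by (elim exE conjE) (rule that, simp_all)
  then show ?L
    unfolding run_def by (intro exI[of _ "(p, a, y, r) # ts"]) (auto simp: list_prod_def)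
qed

definition shift :: "'b list \<Rightarrow> ('q \<times> 'b list) set \<Rightarrow> ('q \<times> 'b list) set" where
  "shift h S = apsnd ((@) h) ` S"

lemma shift_empty [simp]: "shift h {} = {}"
  by (simp add: shift_def)

lemma shift_shift: "shift h (shift h' S) = shift (h @ h') S"
  by (force simp: shift_def)

lemma mem_shift: "(q, x) \<in> shift h S \<longleftrightarrow> (\<exists>y. x = h @ y \<and> (q, y) \<in> S)"
  by (force simp: shift_def)

locale transducer =
  fixes A :: "'a set" and B :: "'b set" and T :: "('q, 'a, 'b list) wa"
  assumes finite_A: "finite A" and finite_B: "finite B"
    and wa: "weighted_automaton A (free_monoid B) T"
begin

abbreviation "rn \<equiv> run (free_monoid B) T"

lemma transD: "(p, a, y, r) \<in> transitions T \<Longrightarrow> p \<in> states T \<and> a \<in> A \<and> y \<in> lists B \<and> r \<in> states T"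
  using wa by (auto simp: weighted_automaton_def free_monoid_def)

lemma rn_Nil [simp]: "rn p [] x q \<longleftrightarrow> p \<in> states T \<and> q = p \<and> x = []"
  by (simp add: run_Nil free_monoid_def)

lemma rn_Cons: "rn p (a # w) x q \<longleftrightarrow>
    (\<exists>y r z. (p, a, y, r) \<in> transitions T \<and> rn r w z q \<and> x = y @ z)"
  by (simp add: run_Cons free_monoid_def)

lemma rnD: "rn p w x q \<Longrightarrow> p \<in> states T \<and> q \<in> states T \<and> w \<in> lists A \<and> x \<in> lists B"
proof (induction w arbitrary: p x)
  case (Cons a w)
  then show ?case using transD by (fastforce simp: rn_Cons)
qed auto

lemma rn_append:
  "rn p (u @ v) x q \<longleftrightarrow> (\<exists>y r z. rn p u y r \<and> rn r v z q \<and> x = y @ z)"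
proof (induction u arbitrary: p x)
  case Nil
  then show ?case using rnD by auto
next
  case (Cons a u)
  show ?case
  proof
    assume "rn p ((a # u) @ v) x q"
    then obtain y r y' r' z where "(p, a, y, r) \<in> transitions T" "rn r u y' r'" "rn r' v z q"
      "x = y @ y' @ z"
      by (auto simp: rn_Cons Cons)
    then show "\<exists>y r z. rn p (a # u) y r \<and> rn r v z q \<and> x = y @ z"
      by (intro exI[of _ "y @ y'"] exI[of _ r'] exI[of _ z]) (auto simp: rn_Cons)
  next
    assume "\<exists>y r z. rn p (a # u) y r \<and> rn r v z q \<and> x = y @ z"
    then show "rn p ((a # u) @ v) x q" by (fastforce simp: rn_Cons Cons)
  qed
qed

definition post :: "('q \<times> 'b list) set \<Rightarrow> 'a list \<Rightarrow> ('q \<times> 'b list) set" where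
  "post S w = {(p, x @ y) |p x y. \<exists>q. (q, x) \<in> S \<and> rn q w y p}"

lemma mem_post: "c \<in> post S w \<longleftrightarrow> (\<exists>q x y. (q, x) \<in> S \<and> rn q w y (fst c) \<and> snd c = x @ y)"
  by (cases c) (auto simp: post_def)

lemma postI: "(q, x) \<in> S \<Longrightarrow> rn q w y p \<Longrightarrow> (p, x @ y) \<in> post S w"
  unfolding post_def by blast

lemma postE:
  assumes "c \<in> post S w"
  obtains p q x y where "c = (p, x @ y)" "(q, x) \<in> S" "rn q w y p"
  using assms unfolding post_def by blast

lemma post_append: "post S (u @ v) = post (post S u) v"
proof (intro equalityI subsetI)
  fix c assume "c \<in> post S (u @ v)"
  then obtain p q x y where *: "c = (p, x @ y)" "(q, x) \<in> S" "rn q (u @ v) y p" by (rule postE)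
  then obtain y1 r y2 where "rn q u y1 r" "rn r v y2 p" "y = y1 @ y2" by (auto simp: rn_append)
  then show "c \<in> post (post S u) v"
    using postI[OF postI[OF *(2)], of u y1 r v y2 p] *(1) by simp
next
  fix c assume "c \<in> post (post S u) v"
  then obtain p r x z where *: "c = (p, x @ z)" "(r, x) \<in> post S u" "rn r v z p" by (rule postE)
  from *(2) obtain q x' y where "x = x' @ y" "(q, x') \<in> S" "rn q u y r" by (auto elim: postE)
  then show "c \<in> post S (u @ v)"
    using * postI[of q x' S "u @ v" "y @ z" p] by (auto simp: rn_append)
qed

lemma post_mono: "S \<subseteq> S' \<Longrightarrow> post S w \<subseteq> post S' w"
  by (auto elim!: postE intro: postI)

lemma post_Un: "post (S \<union> S') w = post S w \<union> post S' w"
  by (auto elim!: postE intro: postI)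

lemma post_Nil: "S \<subseteq> states T \<times> UNIV \<Longrightarrow> post S [] = S"
  by (auto simp: mem_post)

lemma post_shift: "post (shift h S) w = shift h (post S w)"
proof (intro equalityI subsetI)
  fix c assume "c \<in> post (shift h S) w"
  then obtain p q x y where "c = (p, (h @ x) @ y)" "(q, x) \<in> S" "rn q w y p"
    by (auto elim!: postE simp: mem_shift)
  then show "c \<in> shift h (post S w)" using postI[of q x S w y p] by (auto simp: mem_shift)
next
  fix c assume "c \<in> shift h (post S w)"
  then obtain p q x y where "c = (p, (h @ x) @ y)" "(q, x) \<in> S" "rn q w y p"
    by (auto elim!: postE simp: shift_def)
  moreover from this have "(q, h @ x) \<in> shift h S" by (auto simp: mem_shift)
  ultimately show "c \<in> post (shift h S) w" using postI[of q "h @ x" "shift h S" w y p] by simp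
qed

lemma post_states: "post S w \<subseteq> states T \<times> UNIV"
  by (auto elim!: postE dest: rnD)

lemma post_lists: "S \<subseteq> states T \<times> lists B \<Longrightarrow> post S w \<subseteq> states T \<times> lists B"
  by (fastforce elim!: postE dest: rnD)

lemma post_singleE:
  assumes "c \<in> post S w" obtains d where "d \<in> S" "c \<in> post {d} w"
  using assms by (force simp: mem_post)

text \<open>The leaves of the underlying binary tree are runs, its inner nodes are loops on a common word
  \<open>v\<close>. The sets \<open>X\<close> and \<open>Y\<close> pair a configuration with a loop output, since one configuration may be
  used with several loops.\<close>

inductive branching :: "nat \<Rightarrow> ('q \<times> 'b list) set \<Rightarrow> bool" where
  zero: "branching 0 S"
| one: "c \<in> S \<Longrightarrow> branching 1 S"
| split: "n > 0 \<Longrightarrow> m > 0 \<Longrightarrow>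
    (\<And>c y. (c, y) \<in> X \<union> Y \<Longrightarrow> c \<in> post S u \<and> rn (fst c) v y (fst c)) \<Longrightarrow>
    (\<And>c y d z. (c, y) \<in> X \<Longrightarrow> (d, z) \<in> Y \<Longrightarrow>
      dly (snd c @ y) (snd d @ z) \<noteq> dly (snd c) (snd d)) \<Longrightarrow>
    branching n (fst ` X) \<Longrightarrow> branching m (fst ` Y) \<Longrightarrow> branching (n + m) S"

lemma branching_mono: "branching n S \<Longrightarrow> S \<subseteq> S' \<Longrightarrow> branching n S'"
proof (induction rule: branching.induct)
  case (split n m X Y S u v)
  have "\<And>c y. (c, y) \<in> X \<union> Y \<Longrightarrow> c \<in> post S' u \<and> rn (fst c) v y (fst c)"
    using split.hyps(3) post_mono[OF split.prems] by blast
  then show ?case using branching.split[OF split.hyps(1,2) _ split.hyps(4-6)] by blast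
qed (blast intro: branching.intros)+

text \<open>The word \<open>w\<close> is absorbed into the word \<open>u\<close> that leads to the
  root loop.\<close>

lemma branching_post: "branching n (post S w) \<Longrightarrow> branching n S"
proof (induction "post S w" rule: branching.induct)
  case (one c)
  then obtain d where "d \<in> S" by (rule post_singleE)
  then show ?case by (rule branching.one)
next
  case (split n m X Y u v)
  show ?case
    by (rule branching.split[where u = "w @ u" and v = v, OF split.hyps(1,2) _ split.hyps(4,5,7)])
      (use split.hyps(3) in \<open>auto simp: post_append\<close>)
qed (rule branching.zero)

lemma branching_subset_post: "branching n Z \<Longrightarrow> Z \<subseteq> post S w \<Longrightarrow> branching n S"
  using branching_mono branching_post by blast

text \<open>The rule \<open>split\<close> without its positivity conditions: if one side contributes
  0, the other alone suffices, because it lies in \<open>post S u\<close>.\<close>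

lemma branching_split:
  assumes "\<And>c y. (c, y) \<in> X \<union> Y \<Longrightarrow> c \<in> post S u \<and> rn (fst c) v y (fst c)"
    and "\<And>c y d z. (c, y) \<in> X \<Longrightarrow> (d, z) \<in> Y \<Longrightarrow>
      dly (snd c @ y) (snd d @ z) \<noteq> dly (snd c) (snd d)"
    and "branching n (fst ` X)" "branching m (fst ` Y)"
  shows "branching (n + m) S"
proof -
  have "fst e \<in> post S u" if "e \<in> X \<union> Y" for e
    using assms(1)[of "fst e" "snd e"] that by simp
  then have "fst ` X \<subseteq> post S u" "fst ` Y \<subseteq> post S u" by blast+
  then show ?thesis
    using branching_subset_post[OF assms(3)] branching_subset_post[OF assms(4)]
      branching.split[OF _ _ assms(1-2) assms(3-4)]
    by (cases "n = 0"; cases "m = 0") auto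
qed

lemma branching_le: "branching n S \<Longrightarrow> n' \<le> n \<Longrightarrow> branching n' S"
proof (induction arbitrary: n' rule: branching.induct)
  case (one c S)
  then show ?case
    by (cases n') (auto intro: branching.zero branching.one[OF one.hyps, simplified])
next
  case (split n m X Y S u v)
  have "branching (min n n' + (n' - min n n')) S"
    by (rule branching_split[OF split.hyps(3,4) split.IH]) (use split.prems in auto)
  then show ?case by simp
qed (simp add: branching.zero)

lemma branching_emptyD: "branching n {} \<Longrightarrow> n = 0"
proof (induction n "{} :: ('q \<times> 'b list) set" rule: branching.induct)
  case (split n m X Y u v)
  then have "X = {}" by (auto simp: post_def)
  then show ?case using split by simp
qed auto

text \<open>Restrict the sets at every node to the configurations descending from \<open>S1\<close>,
  respectively from \<open>S2\<close>. Loops and delays are untouched, so both restrictions are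
  again trees, and every leaf survives in one of them. An empty restriction is harmless thanks to
  \<open>branching_split\<close>.\<close>

lemma branching_Un:
  "branching n S \<Longrightarrow> S \<subseteq> S1 \<union> S2 \<Longrightarrow> \<exists>n1 n2. n = n1 + n2 \<and> branching n1 S1 \<and> branching n2 S2"
proof (induction arbitrary: S1 S2 rule: branching.induct)
  case (zero S)
  then show ?case by (auto intro: branching.zero)
next
  case (one c S)
  then have "c \<in> S1 \<or> c \<in> S2" by auto
  then show ?case using branching.one branching.zero by (metis add_0 add.right_neutral)
next
  case (split n m X Y S u v)
  define P where "P i Z = {(c, y) \<in> Z. c \<in> post i u}" for i and Z :: "(('q \<times> 'b list) \<times> 'b list) set"
  have cover: "X \<subseteq> P S1 X \<union> P S2 X" "Y \<subseteq> P S1 Y \<union> P S2 Y"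
    using split.hyps(3) post_mono[OF split.prems, of u] by (auto simp: P_def post_Un)
  from split.IH(1)[of "fst ` P S1 X" "fst ` P S2 X"] cover obtain n1 n2 where
    n: "n = n1 + n2" "branching n1 (fst ` P S1 X)" "branching n2 (fst ` P S2 X)"
    by (metis image_Un image_mono)
  from split.IH(2)[of "fst ` P S1 Y" "fst ` P S2 Y"] cover obtain m1 m2 where
    m: "m = m1 + m2" "branching m1 (fst ` P S1 Y)" "branching m2 (fst ` P S2 Y)"
    by (metis image_Un image_mono)
  have "branching (n1 + m1) S1"
    by (rule branching_split[OF _ _ n(2) m(2)])
      (use split.hyps(3,4) in \<open>auto simp: P_def\<close>)
  moreover have "branching (n2 + m2) S2"
    by (rule branching_split[OF _ _ n(3) m(3)])
      (use split.hyps(3,4) in \<open>auto simp: P_def\<close>)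
  ultimately show ?case using n(1) m(1)
    by (intro exI[of _ "n1 + m1"] exI[of _ "n2 + m2"]) simp
qed

lemma finite_predecessors:
  assumes "finite Z" "Z \<subseteq> post S u"
  obtains S0 where "S0 \<subseteq> S" "finite S0" "card S0 \<le> card Z" "Z \<subseteq> post S0 u"
proof -
  have "\<forall>c\<in>Z. \<exists>d\<in>S. c \<in> post {d} u" using assms(2) by (blast elim: post_singleE)
  then obtain d where d: "\<And>c. c \<in> Z \<Longrightarrow> d c \<in> S \<and> c \<in> post {d c} u" by metis
  have "Z \<subseteq> post (d ` Z) u"
  proof
    fix c assume "c \<in> Z"
    then have "c \<in> post {d c} u" "{d c} \<subseteq> d ` Z" using d by auto
    then show "c \<in> post (d ` Z) u" using post_mono by blast
  qed
  then show ?thesis using that[of "d ` Z"] d assms(1) card_image_le[OF assms(1), of d] by blast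
qed

text \<open>One root configuration per leaf is enough. The bound on the cardinality lets the
  pigeonhole argument fix the number of runs in advance.\<close>

lemma branching_finite_subset:
  "branching n S \<Longrightarrow> \<exists>S0\<subseteq>S. finite S0 \<and> card S0 \<le> n \<and> branching n S0"
proof (induction rule: branching.induct)
  case (one c S)
  then show ?case by (intro exI[of _ "{c}"]) (auto intro: branching.one[simplified])
next
  case (split n m X Y S u v)
  obtain X0 where X0: "X0 \<subseteq> fst ` X" "finite X0" "card X0 \<le> n" "branching n X0"
    using split.IH(1) by blast
  obtain Y0 where Y0: "Y0 \<subseteq> fst ` Y" "finite Y0" "card Y0 \<le> m" "branching m Y0"
    using split.IH(2) by blast
  have "fst e \<in> post S u" if "e \<in> X \<union> Y" for e
    using split.hyps(3)[of "fst e" "snd e"] that by simp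
  then have "X0 \<union> Y0 \<subseteq> post S u" using X0(1) Y0(1) by blast
  with X0(2) Y0(2) obtain S0 where S0: "S0 \<subseteq> S" "finite S0" "card S0 \<le> card (X0 \<union> Y0)"
    "X0 \<union> Y0 \<subseteq> post S0 u"
    using finite_predecessors[of "X0 \<union> Y0"] by blast
  have "branching (n + m) S0"
  proof (rule branching_split[of "{(c, y) \<in> X. c \<in> X0}" "{(c, y) \<in> Y. c \<in> Y0}"])
    have "fst ` {(c, y) \<in> X. c \<in> X0} = X0" using X0(1) by force
    then show "branching n (fst ` {(c, y) \<in> X. c \<in> X0})" using X0(4) by simp
    have "fst ` {(c, y) \<in> Y. c \<in> Y0} = Y0" using Y0(1) by force
    then show "branching m (fst ` {(c, y) \<in> Y. c \<in> Y0})" using Y0(4) by simp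
  qed (use split.hyps(3,4) S0(4) in blast)+
  moreover have "card S0 \<le> n + m"
    using S0(3) X0(3) Y0(3) card_Un_le[of X0 Y0] by linarith
  ultimately show ?case using S0 by blast
qed (auto intro: branching.zero)

text \<open>A common left factor cancels in every delay, so output already written can be
  forgotten.\<close>

lemma branching_shift: "branching n S \<Longrightarrow> branching n (shift h S)"
proof (induction rule: branching.induct)
  case (one c S)
  then have "apsnd ((@) h) c \<in> shift h S" by (simp add: shift_def)
  then show ?case by (rule branching.one)
next
  case (split n m X Y S u v)
  let ?f = "apfst (apsnd ((@) h)) :: ('q \<times> 'b list) \<times> 'b list \<Rightarrow> _"
  have img: "fst ` ?f ` Z = shift h (fst ` Z)" for Z
    by (simp add: shift_def image_image)
  show ?case
  proof (rule branching_split[of "?f ` X" "?f ` Y"])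
    show "c \<in> post (shift h S) u \<and> rn (fst c) v y (fst c)" if "(c, y) \<in> ?f ` X \<union> ?f ` Y" for c y
    proof -
      from that obtain c' where "c = apsnd ((@) h) c'" "(c', y) \<in> X \<union> Y" by auto
      moreover have "apsnd ((@) h) c' \<in> shift h (post S u)"
        using split.hyps(3)[OF calculation(2)] by (simp add: shift_def)
      ultimately show ?thesis using split.hyps(3)[of c' y] by (simp add: post_shift)
    qed
    show "dly (snd c @ y) (snd d @ z) \<noteq> dly (snd c) (snd d)"
      if "(c, y) \<in> ?f ` X" "(d, z) \<in> ?f ` Y" for c y d z
    proof -
      from that obtain c' d' where "c = apsnd ((@) h) c'" "(c', y) \<in> X" "d = apsnd ((@) h) d'" "(d', z) \<in> Y"
        by auto
      then show ?thesis using split.hyps(4)[of c' y d' z] by simp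
    qed
  qed (simp_all only: img split.IH)
qed (rule branching.zero)

end

section \<open>Configurations that drift apart\<close>

lemma dly_self [simp]: "dly x x = []"
  using length_dly[of x x] by simp

text \<open>Only a value of \<open>t\<close> seen for the first time can raise the bound, by
  \<open>c\<close>. At a repeated value \<open>d\<close> is the same as at the earlier index, and
  everything between the two can be skipped.\<close>

lemma growth_bounded_by_values:
  fixes d :: "nat \<Rightarrow> nat"
  assumes "d 0 \<le> a" and step: "\<And>i. i < N \<Longrightarrow> d (Suc i) \<le> d i + c"
    and eq: "\<And>i j. i < j \<Longrightarrow> j \<le> N \<Longrightarrow> t i = t j \<Longrightarrow> d i = d j"
  shows "i \<le> N \<Longrightarrow> d i \<le> a + c * card (t ` {..i})"
proof (induction i rule: less_induct)
  case (less i)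
  show ?case
  proof (cases i)
    case 0
    then show ?thesis using assms(1) by simp
  next
    case (Suc m)
    show ?thesis
    proof (cases "t i \<in> t ` {..m}")
      case True
      then obtain s where s: "s \<le> m" "t s = t i" by auto
      then have "d i = d s" using eq[of s i] less.prems Suc by simp
      also have "\<dots> \<le> a + c * card (t ` {..s})" using less.IH[of s] less.prems s Suc by simp
      also have "\<dots> \<le> a + c * card (t ` {..i})"
        using s Suc by (intro add_left_mono mult_left_mono card_mono) auto
      finally show ?thesis .
    next
      case False
      then have "card (t ` {..i}) = Suc (card (t ` {..m}))"
        using Suc by (simp add: atMost_Suc)
      then show ?thesis
        using less.IH[of m] step[of m] less.prems Suc by simp
    qed
  qed
qed

context transducer
begin

text \<open>The root of the tree is the earliest level at which a loop separates two of the runs. It splits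
  the runs into two classes, to which the induction hypothesis applies from that level on; each
  fibre of \<open>f\<close> is distributed over the two classes by \<open>branching_Un\<close>.\<close>

lemma levels_branching:
  fixes cf :: "nat \<Rightarrow> 'j \<Rightarrow> 'q \<times> 'b list" and pos :: "'l \<Rightarrow> nat" and lp :: "'l \<Rightarrow> 'j \<Rightarrow> 'b list"
    and share :: "nat \<Rightarrow> 'j \<Rightarrow> 'j \<Rightarrow> bool" and f :: "'j \<Rightarrow> 'c"
  defines "sep \<equiv> \<lambda>l j j'. dly (snd (cf (pos l) j) @ lp l j) (snd (cf (pos l) j') @ lp l j') \<noteq>
      dly (snd (cf (pos l) j)) (snd (cf (pos l) j'))"
  assumes "finite J" "finite C"
    and share_le: "\<And>s s' j j'. s \<le> s' \<Longrightarrow> share s' j j' \<Longrightarrow> share s j j'"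
    and reach: "\<And>s s' K. s \<le> s' \<Longrightarrow> s' \<le> N \<Longrightarrow> K \<subseteq> J \<Longrightarrow> \<forall>j\<in>K. \<forall>j'\<in>K. share s' j j' \<Longrightarrow>
      \<exists>u. \<forall>j\<in>K. cf s' j \<in> post {cf s j} u"
    and loop: "\<And>l K. l \<in> \<Lambda> \<Longrightarrow> K \<subseteq> J \<Longrightarrow> \<forall>j\<in>K. \<forall>j'\<in>K. share (pos l) j j' \<Longrightarrow>
      \<exists>v. \<forall>j\<in>K. rn (fst (cf (pos l) j)) v (lp l j) (fst (cf (pos l) j))"
    and fibre_share: "\<And>j j'. j \<in> J \<Longrightarrow> j' \<in> J \<Longrightarrow> f j = f j' \<Longrightarrow> share N j j'"
    and "f ` J \<subseteq> C" "s \<le> N"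
    and "\<And>c. c \<in> C \<Longrightarrow> branching (n c) (cf N ` {j \<in> J. f j = c})"
    and "\<And>j j'. j \<in> J \<Longrightarrow> j' \<in> J \<Longrightarrow> f j \<noteq> f j' \<Longrightarrow>
      \<exists>l\<in>\<Lambda>. s \<le> pos l \<and> pos l \<le> N \<and> share (pos l) j j' \<and> sep l j j'"
  shows "branching (sum n C) (cf s ` J)"
proof -
  \<comment> \<open>The set of runs, the start level and the counts are generalised: both recursive
    calls start at the separating level, with part of the runs and part of each count.\<close>
  have "branching (sum n C) (cf s ` K)"
    if "K \<subseteq> J" "s \<le> N"
      "\<And>c. c \<in> C \<Longrightarrow> branching (n c) (cf N ` {j \<in> K. f j = c})"
      "\<And>j j'. j \<in> K \<Longrightarrow> j' \<in> K \<Longrightarrow> f j \<noteq> f j' \<Longrightarrow>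
        \<exists>l\<in>\<Lambda>. s \<le> pos l \<and> pos l \<le> N \<and> share (pos l) j j' \<and> sep l j j'"
    for K s n
    using that
  proof (induction "card K" arbitrary: K s n rule: less_induct)
    case less
    note K = less.prems(1) and sN = less.prems(2) and br = less.prems(3) and cross = less.prems(4)
    have finK: "finite K" using K \<open>finite J\<close> finite_subset by blast
    show ?case
    proof (cases "\<forall>j\<in>K. \<forall>j'\<in>K. f j = f j'")
      \<comment> \<open>Only one label occurs, so the other fibres are empty and have count 0. By
        \<open>fibre_share\<close> a common word leads from level \<open>s\<close> to level
        \<open>N\<close>, and the witness there is pulled back along it.\<close>
      case True
      show ?thesis
      proof (cases "K = {}")
        case True
        then have "n c = 0" if "c \<in> C" for c using br[OF that] by (simp add: branching_emptyD)
        then show ?thesis by (simp add: zero)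
      next
        case False
        then obtain j0 where j0: "j0 \<in> K" by auto
        then have c0: "f j0 \<in> C" using K \<open>f ` J \<subseteq> C\<close> by auto
        have "n c = 0" if c: "c \<in> C - {f j0}" for c
        proof -
          have "{j \<in> K. f j = c} = {}" using True j0 c by blast
          moreover have "branching (n c) (cf N ` {j \<in> K. f j = c})" using br c by blast
          ultimately show ?thesis by (metis branching_emptyD image_empty)
        qed
        then have "sum n C = n (f j0)"
          using sum.remove[OF \<open>finite C\<close> c0, of n] by simp
        moreover have "{j \<in> K. f j = f j0} = K" using True j0 by blast
        ultimately have "branching (sum n C) (cf N ` K)" using br[OF c0] by simp
        moreover obtain u where "\<forall>j\<in>K. cf N j \<in> post {cf s j} u"
          using reach[OF sN order_refl K] True fibre_share K by blast
        then have "cf N ` K \<subseteq> post (cf s ` K) u"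
          using post_mono[of "{cf s j}" "cf s ` K" u for j] by blast
        ultimately show ?thesis by (rule branching_subset_post)
      qed
    next
      case False
      define P where "P l \<longleftrightarrow> l \<in> \<Lambda> \<and> s \<le> pos l \<and> pos l \<le> N \<and>
        (\<exists>j\<in>K. \<exists>j'\<in>K. share (pos l) j j' \<and> sep l j j')" for l
      have "\<exists>l. P l" unfolding P_def using False cross by meson
      then obtain l where l: "P l" and min: "\<And>l'. P l' \<Longrightarrow> pos l \<le> pos l'"
        using ex_has_least_nat[of P _ pos] by auto
      \<comment> \<open>Minimality of \<open>l\<close> is used here: runs with different labels are
        first separated at level \<open>pos l\<close> or later and share their words until then;
        runs with equal labels share them up to \<open>N\<close>.\<close>
      have share: "share (pos l) j j'" if jj: "j \<in> K" "j' \<in> K" for j j'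
      proof (cases "f j = f j'")
        case True
        then have "share N j j'" using fibre_share jj K by blast
        then show ?thesis using share_le[of "pos l" N] l by (simp add: P_def)
      next
        case False
        then obtain l' where "l' \<in> \<Lambda>" "s \<le> pos l'" "pos l' \<le> N" "share (pos l') j j'" "sep l' j j'"
          using cross[OF jj] by blast
        then show ?thesis using min[of l'] share_le[of "pos l" "pos l'"] jj by (auto simp: P_def)
      qed
      obtain j1 j2 where j12: "j1 \<in> K" "j2 \<in> K" "sep l j1 j2" using l by (auto simp: P_def)
      \<comment> \<open>\<open>Z1\<close> is the class of \<open>j1\<close> for the equivalence of
        not being separated by \<open>l\<close>; so every member of \<open>Z1\<close> is separated
        from every member of \<open>Z2\<close>, not only \<open>j1\<close>. Both are proper subsets
        because of \<open>j1\<close> and \<open>j2\<close>.\<close>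
      define Z1 where "Z1 = {j \<in> K. \<not> sep l j1 j}"
      define Z2 where "Z2 = {j \<in> K. sep l j1 j}"
      have "\<not> sep l j1 j1" by (simp add: sep_def)
      then have Z: "Z1 \<union> Z2 = K" "Z1 \<subset> K" "Z2 \<subset> K"
        using j12 unfolding Z1_def Z2_def by blast+
      have sep: "sep l j j'" if "j \<in> Z1" "j' \<in> Z2" for j j'
        using that dly_trans unfolding Z1_def Z2_def sep_def by (simp, blast)
      have "\<forall>c\<in>C. \<exists>a b. n c = a + b \<and> branching a (cf N ` {j \<in> Z1. f j = c}) \<and>
          branching b (cf N ` {j \<in> Z2. f j = c})"
      proof
        fix c assume "c \<in> C"
        moreover have "cf N ` {j \<in> K. f j = c} \<subseteq> cf N ` {j \<in> Z1. f j = c} \<union> cf N ` {j \<in> Z2. f j = c}"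
          using Z(1) by auto
        ultimately show "\<exists>a b. n c = a + b \<and> branching a (cf N ` {j \<in> Z1. f j = c}) \<and>
          branching b (cf N ` {j \<in> Z2. f j = c})"
          using branching_Un[OF br] by blast
      qed
      from bchoice[OF this] obtain n1 where "\<forall>c\<in>C. \<exists>b. n c = n1 c + b \<and>
          branching (n1 c) (cf N ` {j \<in> Z1. f j = c}) \<and> branching b (cf N ` {j \<in> Z2. f j = c})" ..
      from bchoice[OF this] obtain n2 where n2: "\<forall>c\<in>C. n c = n1 c + n2 c \<and>
          branching (n1 c) (cf N ` {j \<in> Z1. f j = c}) \<and> branching (n2 c) (cf N ` {j \<in> Z2. f j = c})" ..
      then have n12: "\<And>c. c \<in> C \<Longrightarrow> n c = n1 c + n2 c"
        "\<And>c. c \<in> C \<Longrightarrow> branching (n1 c) (cf N ` {j \<in> Z1. f j = c})"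
        "\<And>c. c \<in> C \<Longrightarrow> branching (n2 c) (cf N ` {j \<in> Z2. f j = c})"
        by (blast dest: bspec)+
      have cross': "\<exists>l'\<in>\<Lambda>. pos l \<le> pos l' \<and> pos l' \<le> N \<and> share (pos l') j j' \<and> sep l' j j'"
        if jj: "j \<in> K" "j' \<in> K" "f j \<noteq> f j'" for j j'
      proof -
        obtain l' where l': "l' \<in> \<Lambda>" "s \<le> pos l'" "pos l' \<le> N" "share (pos l') j j'" "sep l' j j'"
          using cross[OF jj] by blast
        then have "pos l \<le> pos l'" using min[of l'] jj by (auto simp: P_def)
        with l' show ?thesis by blast
      qed
      have lN: "pos l \<le> N" "s \<le> pos l" "l \<in> \<Lambda>" using l by (auto simp: P_def)
      have b1: "branching (sum n1 C) (cf (pos l) ` Z1)"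
        by (rule less.hyps) (use Z K lN n12 cross' psubset_card_mono[OF finK] in auto)
      have b2: "branching (sum n2 C) (cf (pos l) ` Z2)"
        by (rule less.hyps) (use Z K lN n12 cross' psubset_card_mono[OF finK] in auto)
      obtain u where u: "\<forall>j\<in>K. cf (pos l) j \<in> post {cf s j} u"
        using reach[OF lN(2) lN(1) K] share by blast
      obtain v where v: "\<forall>j\<in>K. rn (fst (cf (pos l) j)) v (lp l j) (fst (cf (pos l) j))"
        using loop[OF lN(3) K] share by blast
      define E where "E X = (\<lambda>j. (cf (pos l) j, lp l j)) ` X" for X
      have fstE: "fst ` E X = cf (pos l) ` X" for X by (simp add: E_def image_image)
      have "branching (sum n1 C + sum n2 C) (cf s ` K)"
      proof (rule branching_split[of "E Z1" "E Z2" _ u v])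
        fix c y assume "(c, y) \<in> E Z1 \<union> E Z2"
        then obtain j where j: "j \<in> K" "c = cf (pos l) j" "y = lp l j"
          using Z by (auto simp: E_def)
        then have "c \<in> post (cf s ` K) u"
          using u post_mono[of "{cf s j}" "cf s ` K" u] by blast
        then show "c \<in> post (cf s ` K) u \<and> rn (fst c) v y (fst c)" using j v by simp
      next
        fix c y d z assume "(c, y) \<in> E Z1" "(d, z) \<in> E Z2"
        then show "dly (snd c @ y) (snd d @ z) \<noteq> dly (snd c) (snd d)"
          using sep by (auto simp: E_def sep_def)
      qed (simp_all only: fstE b1 b2)
      moreover have "sum n C = sum n1 C + sum n2 C"
        using n12(1) by (simp add: sum.distrib)
      ultimately show ?thesis by simp
    qed
  qed
  then show ?thesis using assms by blast
qed

text \<open>Indexes states and outputs of a run by input position, so that several runs on one word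
  can be compared position by position.\<close>

lemma rn_positions:
  assumes "rn q w y p"
  obtains st out where "st 0 = q" "out 0 = []" "st (length w) = p" "out (length w) = y"
    "\<And>i j. i \<le> j \<Longrightarrow> j \<le> length w \<Longrightarrow>
      \<exists>z. rn (st i) (take (j - i) (drop i w)) z (st j) \<and> out j = out i @ z"
proof -
  have "\<exists>st out. st 0 = q \<and> out 0 = [] \<and> st (length w) = p \<and> out (length w) = y \<and>
    (\<forall>i j. i \<le> j \<longrightarrow> j \<le> length w \<longrightarrow>
      (\<exists>z. rn (st i) (take (j - i) (drop i w)) z (st j) \<and> out j = out i @ z))"
    using assms
  proof (induction w arbitrary: q y)
    case Nil
    then show ?case by (intro exI[of _ "\<lambda>_. q"] exI[of _ "\<lambda>_. []"]) simp
  next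
    case (Cons a w)
    then obtain y1 r y2 where *: "(q, a, y1, r) \<in> transitions T" "rn r w y2 p" "y = y1 @ y2"
      by (auto simp: rn_Cons)
    from Cons.IH[OF *(2)] obtain st out where
      so: "st 0 = r" "out 0 = []" "st (length w) = p" "out (length w) = y2"
      "\<And>i j. i \<le> j \<Longrightarrow> j \<le> length w \<Longrightarrow>
        \<exists>z. rn (st i) (take (j - i) (drop i w)) z (st j) \<and> out j = out i @ z" by blast
    define st' where "st' i = (case i of 0 \<Rightarrow> q | Suc i \<Rightarrow> st i)" for i
    define out' where "out' i = (case i of 0 \<Rightarrow> [] | Suc i \<Rightarrow> y1 @ out i)" for i
    have "\<exists>z. rn (st' i) (take (j - i) (drop i (a # w))) z (st' j) \<and> out' j = out' i @ z"
      if ij: "i \<le> j" "j \<le> length (a # w)" for i j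
    proof (cases i)
      case 0
      show ?thesis
      proof (cases j)
        case 0
        then show ?thesis using \<open>i = 0\<close> transD[OF *(1)] by (simp add: st'_def)
      next
        case (Suc j')
        then obtain z where "rn r (take j' w) z (st j')" "out j' = z"
          using so(5)[of 0 j'] ij so(1,2) Suc by auto
        then show ?thesis using 0 Suc *(1)
          by (intro exI[of _ "y1 @ z"]) (auto simp: st'_def out'_def rn_Cons)
      qed
    next
      case (Suc i')
      then obtain j' where "j = Suc j'" using ij by (cases j) auto
      then show ?thesis using so(5)[of i' j'] ij Suc by (auto simp: st'_def out'_def)
    qed
    then show ?case using so *
      by (intro exI[of _ st'] exI[of _ out']) (simp add: st'_def out'_def)
  qed
  then show ?thesis using that by blast
qed

lemma weight_bound: obtains M where "\<And>p a y q. (p, a, y, q) \<in> transitions T \<Longrightarrow> length y \<le> M"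
proof -
  have "finite ((\<lambda>(p, a, y, q). length y) ` transitions T)"
    using wa by (simp add: weighted_automaton_def)
  then obtain M where "\<forall>m\<in>(\<lambda>(p, a, y, q). length y) ` transitions T. m \<le> M"
    using finite_nat_set_iff_bounded_le by blast
  then show ?thesis using that by force
qed

lemma word_dist_bound:
  fixes S :: "('q \<times> 'b list) set"
  assumes "finite S" obtains D where "\<And>c d. c \<in> S \<Longrightarrow> d \<in> S \<Longrightarrow> word_dist (snd c) (snd d) \<le> D"
proof -
  have "finite ((\<lambda>(c, d). word_dist (snd c) (snd d)) ` (S \<times> S))" using assms by simp
  then obtain D where "\<forall>m\<in>(\<lambda>(c, d). word_dist (snd c) (snd d)) ` (S \<times> S). m \<le> D"
    using finite_nat_set_iff_bounded_le by blast
  then show ?thesis using that by force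
qed

text \<open>If no loop common to all the chosen runs changes the delay of two of them, then their delay
  is a function of the tuple of current states, so it takes boundedly many values and cannot have
  become large.\<close>

lemma far_branching:
  assumes S: "finite S" "S \<subseteq> states T \<times> UNIV"
  obtains g where "\<And>w Z (f :: 'q \<times> 'b list \<Rightarrow> 'c) C n. finite Z \<Longrightarrow> card Z \<le> r \<Longrightarrow> Z \<subseteq> post S w \<Longrightarrow>
    (\<And>z z'. z \<in> Z \<Longrightarrow> z' \<in> Z \<Longrightarrow> f z \<noteq> f z' \<Longrightarrow> g < word_dist (snd z) (snd z')) \<Longrightarrow>
    finite C \<Longrightarrow> f ` Z \<subseteq> C \<Longrightarrow> (\<And>c. c \<in> C \<Longrightarrow> branching (n c) {z \<in> Z. f z = c}) \<Longrightarrow>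
    branching (sum n C) S"
proof -
  obtain M where M: "\<And>p a y q. (p, a, y, q) \<in> transitions T \<Longrightarrow> length y \<le> M"
    using weight_bound by blast
  obtain D where D: "\<And>c d. c \<in> S \<Longrightarrow> d \<in> S \<Longrightarrow> word_dist (snd c) (snd d) \<le> D"
    using word_dist_bound[OF S(1)] by blast
  \<comment> \<open>Initial distance, plus growth \<open>2 * M\<close> (at most \<open>M\<close>
    letters on either side) for each tuple of states of at most \<open>r\<close> runs. The
    \<open>Suc\<close> keeps the base positive, so that the power is monotone in the
    exponent.\<close>
  define g where "g = D + 2 * M * Suc (card (states T)) ^ r"
  have finQ: "finite (states T)" using wa by (simp add: weighted_automaton_def)
  show ?thesis
  proof (rule that[of g])
    fix w Z and f :: "'q \<times> 'b list \<Rightarrow> 'c" and C n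
    assume Z: "finite Z" "card Z \<le> r" "Z \<subseteq> post S w"
      and far: "\<And>z z'. z \<in> Z \<Longrightarrow> z' \<in> Z \<Longrightarrow> f z \<noteq> f z' \<Longrightarrow> g < word_dist (snd z) (snd z')"
      and C: "finite C" "f ` Z \<subseteq> C" "\<And>c. c \<in> C \<Longrightarrow> branching (n c) {z \<in> Z. f z = c}"
    have "\<exists>x st out. (st 0, x) \<in> S \<and> out 0 = [] \<and> z = (st (length w), x @ out (length w)) \<and>
        (\<forall>i j. i \<le> j \<longrightarrow> j \<le> length w \<longrightarrow>
          (\<exists>y. rn (st i) (take (j - i) (drop i w)) y (st j) \<and> out j = out i @ y))"
      if "z \<in> Z" for z
    proof -
      from that Z(3) obtain p q x y where *: "z = (p, x @ y)" "(q, x) \<in> S" "rn q w y p"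
        by (blast elim: postE)
      obtain st out where "st 0 = q" "out 0 = []" "st (length w) = p" "out (length w) = y"
        "\<And>i j. i \<le> j \<Longrightarrow> j \<le> length w \<Longrightarrow>
          \<exists>z. rn (st i) (take (j - i) (drop i w)) z (st j) \<and> out j = out i @ z"
        using rn_positions[OF *(3)] by blast
      then show ?thesis using *(1,2)
        by (intro exI[of _ x] exI[of _ st] exI[of _ out]) simp
    qed
    then obtain x st out where
      start: "\<And>z. z \<in> Z \<Longrightarrow> (st z 0, x z) \<in> S" and out0: "\<And>z. z \<in> Z \<Longrightarrow> out z 0 = []" and
      fin: "\<And>z. z \<in> Z \<Longrightarrow> z = (st z (length w), x z @ out z (length w))" and
      step: "\<And>z i j. z \<in> Z \<Longrightarrow> i \<le> j \<Longrightarrow> j \<le> length w \<Longrightarrow>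
          \<exists>y. rn (st z i) (take (j - i) (drop i w)) y (st z j) \<and> out z j = out z i @ y"
      by metis
    define cf where "cf i z = (st z i, x z @ out z i)" for i z
    \<comment> \<open>A loop is a pair of positions at which all chosen runs revisit their states
      simultaneously; its level is the first position.\<close>
    define \<Lambda> where "\<Lambda> = {(i, j). i < j \<and> j \<le> length w \<and> (\<forall>z\<in>Z. st z i = st z j)}"
    define lp where "lp l z = drop (length (out z (fst l))) (out z (snd l))" for l :: "nat \<times> nat" and z
    have lp: "out z (snd l) = out z (fst l) @ lp l z" if "z \<in> Z" "l \<in> \<Lambda>" for z l
      using step[OF that(1), of "fst l" "snd l"] that(2) by (auto simp: \<Lambda>_def lp_def)
    have "branching (sum n C) (cf 0 ` Z)"
    \<comment> \<open>All runs read the same \<open>w\<close>, so sharing of input is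
      automatic.\<close>
    proof (rule levels_branching[where pos = fst and share = "\<lambda>_ _ _. True" and lp = lp and
          \<Lambda> = \<Lambda> and N = "length w" and f = f])
      show "\<exists>u. \<forall>z\<in>K. cf j z \<in> post {cf i z} u" if ij: "i \<le> j" "j \<le> length w" "K \<subseteq> Z" for i j K
      proof (intro exI ballI)
        fix z assume "z \<in> K"
        then have "z \<in> Z" using ij(3) by auto
        then obtain y where "rn (st z i) (take (j - i) (drop i w)) y (st z j)" "out z j = out z i @ y"
          using step[OF _ ij(1,2)] by blast
        then show "cf j z \<in> post {cf i z} (take (j - i) (drop i w))"
          using postI[of "st z i" "x z @ out z i" "{cf i z}"] by (auto simp: cf_def)
      qed
      show "\<exists>v. \<forall>z\<in>K. rn (fst (cf (fst l) z)) v (lp l z) (fst (cf (fst l) z))"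
        if "l \<in> \<Lambda>" "K \<subseteq> Z" for l K
      proof (intro exI ballI)
        fix z assume "z \<in> K"
        then have "z \<in> Z" using that by auto
        then show "rn (fst (cf (fst l) z)) (take (snd l - fst l) (drop (fst l) w)) (lp l z)
            (fst (cf (fst l) z))"
          using step[of z "fst l" "snd l"] lp[of z l] that(1) by (auto simp: cf_def \<Lambda>_def)
      qed
      have "cf (length w) ` X = X" if "X \<subseteq> Z" for X
        using fin that by (force simp: cf_def)
      then show "branching (n c) (cf (length w) ` {z \<in> Z. f z = c})" if "c \<in> C" for c
        using C(3)[OF that] by simp
      show "\<exists>l\<in>\<Lambda>. 0 \<le> fst l \<and> fst l \<le> length w \<and> True \<and>
          dly (snd (cf (fst l) z) @ lp l z) (snd (cf (fst l) z') @ lp l z')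
          \<noteq> dly (snd (cf (fst l) z)) (snd (cf (fst l) z'))"
        if z: "z \<in> Z" "z' \<in> Z" "f z \<noteq> f z'" for z z'
      proof (rule ccontr)
        assume no: "\<not> ?thesis"
        let ?d = "\<lambda>i. word_dist (x z @ out z i) (x z' @ out z' i)"
        let ?t = "\<lambda>i. restrict (\<lambda>z. st z i) Z"
        have "?d (length w) \<le> D + 2 * M * card (?t ` {..length w})"
        proof (rule growth_bounded_by_values[where N = "length w"])
          show "?d 0 \<le> D" using D[OF start[OF z(1)] start[OF z(2)]] z by (simp add: out0)
          show "?d (Suc i) \<le> ?d i + 2 * M" if i: "i < length w" for i
          proof -
            have one: "\<exists>y. out z (Suc i) = out z i @ y \<and> length y \<le> M" if z: "z \<in> Z" for z
            proof -
              have "take (Suc i - i) (drop i w) = [w ! i]"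
                using i by (simp add: take_Suc_conv_app_nth hd_drop_conv_nth take_Suc)
              then obtain y where "rn (st z i) [w ! i] y (st z (Suc i))" "out z (Suc i) = out z i @ y"
                using step[OF z, of i "Suc i"] i by auto
              then show ?thesis using M by (auto simp: rn_Cons)
            qed
            obtain y y' where "out z (Suc i) = out z i @ y" "length y \<le> M"
              "out z' (Suc i) = out z' i @ y'" "length y' \<le> M"
              using one[OF z(1)] one[OF z(2)] by blast
            then show ?thesis
              using word_dist_append_le[of "x z @ out z i" y "x z' @ out z' i" y'] by simp
          qed
          \<comment> \<open>A repeated tuple is a common loop; by the assumption to be refuted it
            does not separate \<open>z\<close> from \<open>z'\<close>.\<close>
          show "?d i = ?d j" if ij: "i < j" "j \<le> length w" "?t i = ?t j" for i j
          proof -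
            have "st z'' i = st z'' j" if "z'' \<in> Z" for z''
              using fun_cong[OF ij(3), of z''] that by simp
            then have l: "(i, j) \<in> \<Lambda>" using ij by (simp add: \<Lambda>_def)
            then have "dly (x z @ out z j) (x z' @ out z' j) = dly (x z @ out z i) (x z' @ out z' i)"
              using no ij lp[OF z(1) l] lp[OF z(2) l] by (force simp: cf_def)
            then show ?thesis by (rule dly_eq_word_dist[symmetric])
          qed
        qed simp
        also have "\<dots> \<le> g"
        proof -
          have st: "st z i \<in> states T" if "z \<in> Z" "i \<le> length w" for z i
            using step[OF that(1) order_refl that(2)] by auto
          have "?t ` {..length w} \<subseteq> Z \<rightarrow>\<^sub>E states T"
            using st by auto
          then have "card (?t ` {..length w}) \<le> card (Z \<rightarrow>\<^sub>E states T)"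
            using Z(1) finQ by (intro card_mono finite_PiE) auto
          also have "\<dots> = card (states T) ^ card Z" using Z(1) by (simp add: card_PiE)
          also have "\<dots> \<le> Suc (card (states T)) ^ card Z" by (intro power_mono) auto
          also have "\<dots> \<le> Suc (card (states T)) ^ r" using Z(2) by (intro power_increasing) auto
          finally show ?thesis unfolding g_def by (intro add_left_mono mult_left_mono) auto
        qed
        finally show False using far[OF z] fin[OF z(1)] fin[OF z(2)] by (metis leD snd_conv)
      qed
    qed (use Z C in auto)
    moreover have "cf 0 ` Z \<subseteq> S" using start out0 by (auto simp: cf_def)
    ultimately show "branching (sum n C) S" by (rule branching_mono)
  qed
qed

text \<open>Given \<open>z\<close> and a far \<open>z'\<close>, consider around \<open>z\<close> \<open>2 * m + 1\<close> annuli of width \<open>g\<close>. An empty annulus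
  separates \<open>X\<close> from \<open>Y\<close>; if none is empty, picking a configuration from every other one gives
  \<open>m + 1\<close> configurations that are pairwise far, contradicting \<open>\<not> branching (Suc m) S\<close>.\<close>

lemma diameter_split:
  assumes S: "finite S" "S \<subseteq> states T \<times> UNIV" and m: "\<not> branching (Suc m) S"
  obtains D where "\<And>w z z'. z \<in> post S w \<Longrightarrow> z' \<in> post S w \<Longrightarrow> D < word_dist (snd z) (snd z') \<Longrightarrow>
    \<exists>X Y. post S w = X \<union> Y \<and> X \<noteq> {} \<and> Y \<noteq> {} \<and> (\<forall>a b. branching a X \<longrightarrow> branching b Y \<longrightarrow> a + b \<le> m)"
proof -
  \<comment> \<open>Two instances, since the label type must be fixed: \<open>bool\<close> for the
    two sides of a gap, the configurations themselves for pairwise far ones. The bound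
    \<open>2 * m + 1\<close> covers both \<open>m + 1\<close> single configurations and two
    witnesses of at most \<open>m\<close> elements each.\<close>
  obtain g1 where g1: "\<And>w Z (f :: 'q \<times> 'b list \<Rightarrow> bool) C n. finite Z \<Longrightarrow> card Z \<le> 2 * m + 1 \<Longrightarrow> Z \<subseteq> post S w \<Longrightarrow>
    (\<And>z z'. z \<in> Z \<Longrightarrow> z' \<in> Z \<Longrightarrow> f z \<noteq> f z' \<Longrightarrow> g1 < word_dist (snd z) (snd z')) \<Longrightarrow>
    finite C \<Longrightarrow> f ` Z \<subseteq> C \<Longrightarrow> (\<And>c. c \<in> C \<Longrightarrow> branching (n c) {z \<in> Z. f z = c}) \<Longrightarrow>
    branching (sum n C) S"
    by (rule far_branching[OF S, where r = "2 * m + 1" and 'c = bool]) blast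
  obtain g2 where g2: "\<And>w Z (f :: 'q \<times> 'b list \<Rightarrow> 'q \<times> 'b list) C n. finite Z \<Longrightarrow> card Z \<le> 2 * m + 1 \<Longrightarrow> Z \<subseteq> post S w \<Longrightarrow>
    (\<And>z z'. z \<in> Z \<Longrightarrow> z' \<in> Z \<Longrightarrow> f z \<noteq> f z' \<Longrightarrow> g2 < word_dist (snd z) (snd z')) \<Longrightarrow>
    finite C \<Longrightarrow> f ` Z \<subseteq> C \<Longrightarrow> (\<And>c. c \<in> C \<Longrightarrow> branching (n c) {z \<in> Z. f z = c}) \<Longrightarrow>
    branching (sum n C) S"
    by (rule far_branching[OF S, where r = "2 * m + 1" and 'c = "'q \<times> 'b list"]) blast
  define g where "g = max g1 g2"
  have small: "a \<le> m" if "branching a X" "X \<subseteq> post S w" for a X w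
    using branching_subset_post[OF that] branching_le m not_less_eq_eq by blast
  show ?thesis
  \<comment> \<open>The outer radius of the last annulus \<open>R (2 * m)\<close>: beyond it,
    \<open>z'\<close> lies outside whichever annulus is empty.\<close>
  proof (rule that[of "(2 * m + 1) * g"])
    fix w z z' assume z: "z \<in> post S w" "z' \<in> post S w" "(2 * m + 1) * g < word_dist (snd z) (snd z')"
    let ?d = "\<lambda>c. word_dist (snd z) (snd c)"
    define R where "R j = {c \<in> post S w. j * g < ?d c \<and> ?d c \<le> Suc j * g}" for j
    have "\<exists>j\<le>2 * m. R j = {}"
    proof (rule ccontr)
      assume "\<not> ?thesis"
      then have "\<forall>j. \<exists>c. j \<le> 2 * m \<longrightarrow> c \<in> R j" by auto
      then obtain c where c: "\<And>j. j \<le> 2 * m \<Longrightarrow> c j \<in> R j" by metis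
      define e where "e i = c (2 * i)" for i
      have e: "e i \<in> R (2 * i)" if "i \<le> m" for i using c[of "2 * i"] that by (simp add: e_def)
      have far: "g < word_dist (snd (e i)) (snd (e i'))" if "i < i'" "i' \<le> m" for i i'
      proof -
        have "Suc (2 * i) * g + g \<le> (2 * i') * g"
          using that by (metis Suc_leI add.commute mult_Suc mult_le_mono1 mult_Suc_right add_2_eq_Suc' mult_le_mono2)
        moreover have "(2 * i') * g < ?d (e i')" "?d (e i) \<le> Suc (2 * i) * g"
          using e[of i] e[of i'] that by (auto simp: R_def)
        moreover have "?d (e i') \<le> ?d (e i) + word_dist (snd (e i)) (snd (e i'))"
          by (rule word_dist_triangle)
        ultimately show ?thesis by linarith
      qed
      have far': "g < word_dist (snd (e i)) (snd (e i'))" if "i \<noteq> i'" "i \<le> m" "i' \<le> m" for i i'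
        using far[of i i'] far[of i' i] that word_dist_commute[of "snd (e i)"] by (cases "i < i'") auto
      have inj: "inj_on e {..m}"
        using far' by (intro inj_onI) (metis atMost_iff not_less_zero word_dist_self)
      \<comment> \<open>Each configuration is a fibre of its own with count 1, so the total is
        \<open>m + 1\<close>.\<close>
      have "branching (\<Sum>c\<in>e ` {..m}. 1) S"
      proof (rule g2[where f = "\<lambda>x. x" and Z = "e ` {..m}" and w = w])
        show "card (e ` {..m}) \<le> 2 * m + 1" using inj by (simp add: card_image)
        show "e ` {..m} \<subseteq> post S w" using e by (auto simp: R_def)
        show "g2 < word_dist (snd x) (snd y)" if "x \<in> e ` {..m}" "y \<in> e ` {..m}" "x \<noteq> y" for x y
        proof -
          from that obtain i i' where "i \<le> m" "i' \<le> m" "x = e i" "y = e i'" by auto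
          then show ?thesis using far'[of i i'] that(3) by (auto simp: g_def)
        qed
        show "branching 1 {y \<in> e ` {..m}. y = x}" if "x \<in> e ` {..m}" for x
          by (rule one[of x]) (use that in simp)
      qed auto
      then show False using m inj by (simp add: card_image)
    qed
    then obtain j where j: "j \<le> 2 * m" "R j = {}" by blast
    define X where "X = {c \<in> post S w. ?d c \<le> j * g}"
    define Y where "Y = {c \<in> post S w. Suc j * g < ?d c}"
    have "?d c \<le> j * g \<or> Suc j * g < ?d c" if "c \<in> post S w" for c
      using j(2) that unfolding R_def by (metis (mono_tags, lifting) empty_iff mem_Collect_eq not_le)
    then have XY: "post S w = X \<union> Y" unfolding X_def Y_def by blast
    have "z \<in> X" using z by (simp add: X_def)
    moreover have "z' \<in> Y"
    proof -
      have "Suc j * g \<le> (2 * m + 1) * g" using j(1) by (intro mult_le_mono1) simp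
      then have "Suc j * g < ?d z'" using z(3) by (rule le_less_trans)
      then show ?thesis using z(2) unfolding Y_def by blast
    qed
    moreover have "a + b \<le> m" if ab: "branching a X" "branching b Y" for a b
    proof -
      obtain X0 where X0: "X0 \<subseteq> X" "finite X0" "card X0 \<le> a" "branching a X0"
        using branching_finite_subset[OF ab(1)] by blast
      obtain Y0 where Y0: "Y0 \<subseteq> Y" "finite Y0" "card Y0 \<le> b" "branching b Y0"
        using branching_finite_subset[OF ab(2)] by blast
      have far: "g < word_dist (snd x) (snd y)" if "x \<in> X" "y \<in> Y" for x y
        using that word_dist_triangle[of "snd z" "snd y" "snd x"] by (simp add: X_def Y_def)
      have disj: "x \<notin> Y" if "x \<in> X" for x using far[OF that, of x] by auto
      \<comment> \<open>Distances inside \<open>X\<close> or inside \<open>Y\<close> do not matter: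
        only pairs with different labels have to be far, and these lie on opposite sides of the
        gap.\<close>
      have "branching (\<Sum>c\<in>{True, False}. if c then a else b) S"
      proof (rule g1[where f = "\<lambda>c. c \<in> X" and Z = "X0 \<union> Y0" and w = w])
        show "card (X0 \<union> Y0) \<le> 2 * m + 1"
          using card_Un_le[of X0 Y0] X0(3) Y0(3) small[OF ab(1)] small[OF ab(2)] XY by fastforce
        show "X0 \<union> Y0 \<subseteq> post S w" using X0 Y0 XY by blast
        show "g1 < word_dist (snd x) (snd y)"
          if "x \<in> X0 \<union> Y0" "y \<in> X0 \<union> Y0" "(x \<in> X) \<noteq> (y \<in> X)" for x y
        proof -
          have "x \<in> X \<and> y \<in> Y \<or> y \<in> X \<and> x \<in> Y" using that X0 Y0 by blast
          then have "g < word_dist (snd x) (snd y)"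
            using far word_dist_commute by metis
          then show ?thesis by (simp add: g_def)
        qed
        show "branching (if c then a else b) {x \<in> X0 \<union> Y0. (x \<in> X) = c}" for c
        proof -
          have "{x \<in> X0 \<union> Y0. (x \<in> X) = c} = (if c then X0 else Y0)"
            using X0(1) Y0(1) disj by (auto split: if_splits)
          then show ?thesis using X0(4) Y0(4) by simp
        qed
      qed (use X0 Y0 in auto)
      then have "branching (a + b) S" by simp
      then show ?thesis using branching_le[of "a + b" S "Suc m"] m by (meson not_less_eq_eq)
    qed
    ultimately show "\<exists>X Y. post S w = X \<union> Y \<and> X \<noteq> {} \<and> Y \<noteq> {} \<and>
      (\<forall>a b. branching a X \<longrightarrow> branching b Y \<longrightarrow> a + b \<le> m)"
      using XY by blast
  qed
qed

lemma finite_post: "finite S \<Longrightarrow> finite (post S w)"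
proof (induction w arbitrary: S)
  case Nil
  have "post S [] \<subseteq> S" by (auto elim!: postE)
  then show ?case using Nil finite_subset by blast
next
  case (Cons a w)
  have "post S [a] \<subseteq> (\<lambda>((q, x), (p, b, y, r)). (r, x @ y)) ` (S \<times> transitions T)"
    by (force elim!: postE simp: rn_Cons)
  moreover have "finite (S \<times> transitions T)"
    using Cons.prems wa by (simp add: weighted_automaton_def)
  ultimately have "finite (post S [a])" by (metis finite_surj)
  then show ?case using Cons.IH post_append[of S "[a]" w] by simp
qed

section \<open>Construction of the sequential components\<close>

definition rel :: "('q \<times> 'b list) set \<Rightarrow> 'a list \<Rightarrow> 'b list set" where
  "rel S w = {x @ z |p x z. (p, x) \<in> post S w \<and> (p, z) \<in> t_final T}"

lemma rel_append: "rel S (u @ w) = rel (post S u) w"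
  by (simp add: rel_def post_append)

lemma rel_Un: "rel (S \<union> S') w = rel S w \<union> rel S' w"
  unfolding rel_def post_Un by blast

lemma rel_shift: "rel (shift h S) w = (@) h ` rel S w"
proof (intro equalityI subsetI)
  fix y assume "y \<in> rel (shift h S) w"
  then obtain p x z where "y = h @ x @ z" "(p, x) \<in> post S w" "(p, z) \<in> t_final T"
    unfolding rel_def post_shift mem_shift by auto
  then show "y \<in> (@) h ` rel S w" unfolding rel_def by blast
next
  fix y assume "y \<in> (@) h ` rel S w"
  then obtain p x z where "y = (h @ x) @ z" "(p, x) \<in> post S w" "(p, z) \<in> t_final T"
    unfolding rel_def by auto
  then show "y \<in> rel (shift h S) w" unfolding rel_def post_shift mem_shift by blast
qed

lemma rel_Nil:
  assumes "finite S" "S \<subseteq> states T \<times> lists B"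
  shows "finite (rel S [])" "rel S [] \<subseteq> lists B"
proof -
  have "rel S [] \<subseteq> (\<lambda>(c, d). snd c @ snd d) ` (post S [] \<times> t_final T)"
    by (force simp: rel_def)
  moreover have fin: "finite (t_final T)" "t_final T \<subseteq> states T \<times> lists B"
    using wa by (auto simp: weighted_automaton_def free_monoid_def)
  ultimately show "finite (rel S [])"
    using finite_post[OF assms(1), of "[]"] by (metis finite_SigmaI finite_surj)
  show "rel S [] \<subseteq> lists B"
  proof
    fix y assume "y \<in> rel S []"
    then obtain p x z where *: "y = x @ z" "(p, x) \<in> post S []" "(p, z) \<in> t_final T"
      by (auto simp: rel_def)
    then have "x \<in> lists B" "z \<in> lists B"
      using post_lists[OF assms(2), of "[]"] fin(2) by blast+
    then show "y \<in> lists B" using *(1) by simp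
  qed
qed

text \<open>Sequential transducers without states: the states are the residuals of the computed function,
  up to a left factor that has already been output.\<close>

definition residual_closed :: "('a list \<Rightarrow> 'b list set) set \<Rightarrow> bool" where
  "residual_closed F \<longleftrightarrow> (\<forall>f\<in>F. finite (f []) \<and> f [] \<subseteq> lists B \<and>
    (\<forall>a\<in>A. \<exists>h\<in>lists B. \<exists>g\<in>F. \<forall>w\<in>lists A. f (a # w) = (@) h ` g w))"

text \<open>\<open>F\<close> is the state set, \<open>g\<close> the initial state and
  \<open>h\<close> the initial output; the final outputs of a state are its values at the empty
  word.\<close>

definition seq_fun :: "('a list \<Rightarrow> 'b list set) \<Rightarrow> bool" where
  "seq_fun f \<longleftrightarrow> (\<exists>F h g. finite F \<and> residual_closed F \<and> h \<in> lists B \<and> g \<in> F \<and>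
    (\<forall>w\<in>lists A. f w = (@) h ` g w))"

definition multi_seq :: "nat \<Rightarrow> ('a list \<Rightarrow> 'b list set) \<Rightarrow> bool" where
  "multi_seq m f \<longleftrightarrow> (\<exists>F. (\<forall>i<m. seq_fun (F i)) \<and> (\<forall>w\<in>lists A. f w = (\<Union>i<m. F i w)))"

lemma image_append: "(@) g ` (@) h ` X = (@) (g @ h) ` X"
  by (auto simp: image_image)

lemma seq_fun_shift:
  assumes "seq_fun f" "h \<in> lists B" shows "seq_fun (\<lambda>w. (@) h ` f w)"
proof -
  obtain F h' g where "finite F" "residual_closed F" "h' \<in> lists B" "g \<in> F"
    "\<forall>w\<in>lists A. f w = (@) h' ` g w"
    using assms(1) unfolding seq_fun_def by blast
  then show ?thesis unfolding seq_fun_def using assms(2)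
    by (intro exI[of _ F] exI[of _ "h @ h'"] exI[of _ g]) (simp add: image_append)
qed

lemma seq_fun_empty: "seq_fun (\<lambda>_. {})"
  unfolding seq_fun_def residual_closed_def
  by (rule exI[of _ "{\<lambda>_. {}}"]) (auto intro: exI[of _ "[]"])

lemma multi_seq_shift:
  assumes "multi_seq m f" "h \<in> lists B" shows "multi_seq m (\<lambda>w. (@) h ` f w)"
proof -
  obtain F where "\<forall>i<m. seq_fun (F i)" "\<forall>w\<in>lists A. f w = (\<Union>i<m. F i w)"
    using assms(1) unfolding multi_seq_def by blast
  then show ?thesis unfolding multi_seq_def
    by (intro exI[of _ "\<lambda>i w. (@) h ` F i w"]) (auto simp: seq_fun_shift assms(2))
qed

text \<open>Components left over when \<open>a + b < m\<close> are filled with the empty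
  function.\<close>

lemma multi_seq_Un:
  assumes "multi_seq a f" "multi_seq b g" "a + b \<le> m"
  shows "multi_seq m (\<lambda>w. f w \<union> g w)"
proof -
  obtain F where F: "\<forall>i<a. seq_fun (F i)" "\<forall>w\<in>lists A. f w = (\<Union>i<a. F i w)"
    using assms(1) unfolding multi_seq_def by blast
  obtain G where G: "\<forall>i<b. seq_fun (G i)" "\<forall>w\<in>lists A. g w = (\<Union>i<b. G i w)"
    using assms(2) unfolding multi_seq_def by blast
  define H where "H i = (if i < a then F i else if i < a + b then G (i - a) else (\<lambda>_. {}))" for i
  have "f w \<union> g w = (\<Union>i<m. H i w)" if w: "w \<in> lists A" for w
  proof -
    have "{..<m} = {..<a} \<union> (+) a ` {..<b} \<union> {a + b..<m}"
      using assms(3) by (auto simp: lessThan_atLeast0)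
    moreover have "(\<Union>i<a. H i w) = f w" using bspec[OF F(2) w] by (simp add: H_def)
    moreover have "(\<Union>i\<in>(+) a ` {..<b}. H i w) = g w" using bspec[OF G(2) w] by (simp add: H_def)
    moreover have "(\<Union>i\<in>{a + b..<m}. H i w) = {}" by (simp add: H_def)
    ultimately show ?thesis by (simp add: UN_Un)
  qed
  moreover have "seq_fun (H i)" if "i < m" for i
    using F(1) G(1) seq_fun_empty by (simp add: H_def)
  ultimately have "(\<forall>i<m. seq_fun (H i)) \<and> (\<forall>w\<in>lists A. f w \<union> g w = (\<Union>i<m. H i w))" by simp
  then show ?thesis unfolding multi_seq_def by (rule exI[of _ H])
qed

lemma multi_seq_empty: "multi_seq m (\<lambda>_. {})"
  unfolding multi_seq_def by (rule exI[of _ "\<lambda>_ _. {}"]) (simp add: seq_fun_empty)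

text \<open>\<open>U\<close> holds the residuals that one deterministic machine can track. Run
  \<open>m\<close> copies of that machine; when a letter leads out of \<open>U\<close>, copy
  \<open>i\<close> continues as the \<open>i\<close>-th of the \<open>m\<close> components of the
  remaining function. Before that the copies agree, so their union is the machine itself.\<close>

lemma multi_seq_glue:
  assumes "finite U" "m > 0"
    and Nil: "\<And>f. f \<in> U \<Longrightarrow> finite (f []) \<and> f [] \<subseteq> lists B"
    and Cons: "\<And>f a. f \<in> U \<Longrightarrow> a \<in> A \<Longrightarrow>
      (\<exists>h\<in>lists B. \<exists>g\<in>U. \<forall>w\<in>lists A. f (a # w) = (@) h ` g w) \<or> multi_seq m (\<lambda>w. f (a # w))"
    and "f \<in> U"
  shows "multi_seq m f"
proof -
  define leave where "leave f a \<longleftrightarrow>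
    \<not> (\<exists>h\<in>lists B. \<exists>g\<in>U. \<forall>w\<in>lists A. f (a # w) = (@) h ` g w)" for f a
  have "\<forall>f a. \<exists>h g. \<not> leave f a \<longrightarrow>
    h \<in> lists B \<and> g \<in> U \<and> (\<forall>w\<in>lists A. f (a # w) = (@) h ` g w)"
    unfolding leave_def by blast
  then obtain hh nn where stay: "\<And>f a. \<not> leave f a \<Longrightarrow>
    hh f a \<in> lists B \<and> nn f a \<in> U \<and> (\<forall>w\<in>lists A. f (a # w) = (@) (hh f a) ` nn f a w)"
    by metis
  have "\<exists>E. (\<forall>i<m. seq_fun (E i)) \<and> (\<forall>w\<in>lists A. f (a # w) = (\<Union>i<m. E i w))"
    if "f \<in> U" "a \<in> A" "leave f a" for f a
  proof -
    have "multi_seq m (\<lambda>w. f (a # w))"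
      using Cons[OF that(1,2)]
      by (rule disjE) (rule notE[OF that(3)[unfolded leave_def]], assumption+)
    then show ?thesis unfolding multi_seq_def .
  qed
  then have "\<forall>f a. \<exists>E. f \<in> U \<and> a \<in> A \<and> leave f a \<longrightarrow>
    (\<forall>i<m. seq_fun (E i)) \<and> (\<forall>w\<in>lists A. f (a # w) = (\<Union>i<m. E i w))"
    by simp
  then obtain E where E: "\<forall>f a. f \<in> U \<and> a \<in> A \<and> leave f a \<longrightarrow>
    (\<forall>i<m. seq_fun (E f a i)) \<and> (\<forall>w\<in>lists A. f (a # w) = (\<Union>i<m. E f a i w))"
    unfolding choice_iff by (elim exE)
  have "\<forall>f a i. \<exists>F h g. f \<in> U \<and> a \<in> A \<and> leave f a \<and> i < m \<longrightarrow>
    finite F \<and> residual_closed F \<and> h \<in> lists B \<and> g \<in> F \<and> (\<forall>w\<in>lists A. E f a i w = (@) h ` g w)"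
    using E unfolding seq_fun_def by simp
  then obtain F hE gE where F': "\<forall>f a i. f \<in> U \<and> a \<in> A \<and> leave f a \<and> i < m \<longrightarrow>
    finite (F f a i) \<and> residual_closed (F f a i) \<and> hE f a i \<in> lists B \<and> gE f a i \<in> F f a i \<and>
    (\<forall>w\<in>lists A. E f a i w = (@) (hE f a i) ` gE f a i w)"
    unfolding choice_iff by (elim exE)
  have F: "finite (F f a i)" "residual_closed (F f a i)" "hE f a i \<in> lists B"
    "gE f a i \<in> F f a i" "\<forall>w\<in>lists A. E f a i w = (@) (hE f a i) ` gE f a i w"
    if "f \<in> U" "a \<in> A" "leave f a" "i < m" for f a i
    using that F' by simp_all
  \<comment> \<open>\<open>G i f\<close> is the behaviour of copy \<open>i\<close> in state
    \<open>f\<close>. The recursion yields a function of the state because the state changes with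
    every letter.\<close>
  define G where "G i f w = rec_list (\<lambda>f. f [])
    (\<lambda>a w r f. if leave f a then E f a i w else (@) (hh f a) ` r (nn f a)) w f" for i f w
  have G_Nil: "G i f [] = f []" for i f by (simp add: G_def)
  have G_Cons: "G i f (a # w) =
      (if leave f a then E f a i w else (@) (hh f a) ` G i (nn f a) w)" for i f a w
    by (simp add: G_def)
  \<comment> \<open>At the empty word all copies give \<open>g []\<close>, and \<open>m > 0\<close>
    ensures that there is at least one copy.\<close>
  have union: "g w = (\<Union>i<m. G i g w)" if "g \<in> U" "w \<in> lists A" for g w
    using that
  proof (induction w arbitrary: g)
    case Nil
    then show ?case using \<open>m > 0\<close> by (auto simp: G_Nil)
  next
    case (Cons a w)
    then have aw: "a \<in> A" "w \<in> lists A" by auto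
    show ?case
    proof (cases "leave g a")
      case True
      then show ?thesis using E Cons.prems(1) aw True by (simp add: G_Cons)
    next
      case False
      then have "g (a # w) = (@) (hh g a) ` nn g a w" "nn g a \<in> U" using stay aw by auto
      then show ?thesis using Cons.IH[of "nn g a"] aw False by (simp add: G_Cons image_UN)
    qed
  qed
  have "seq_fun (G i f)" if i: "i < m" for i
  proof -
    \<comment> \<open>The residuals of copy \<open>i\<close>: one per state in \<open>U\<close>, and
      those of the component entered at each of the finitely many exits
      \<open>(g, a)\<close>.\<close>
    define Fam where "Fam = G i ` U \<union> (\<Union>(g, a)\<in>{(g, a) \<in> U \<times> A. leave g a}. F g a i)"
    have "residual_closed Fam"
      unfolding residual_closed_def
    proof
      fix e assume "e \<in> Fam"
      then consider g where "g \<in> U" "e = G i g"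
        | g a where "g \<in> U" "a \<in> A" "leave g a" "e \<in> F g a i"
        by (auto simp: Fam_def)
      then show "finite (e []) \<and> e [] \<subseteq> lists B \<and>
        (\<forall>a\<in>A. \<exists>h\<in>lists B. \<exists>e'\<in>Fam. \<forall>w\<in>lists A. e (a # w) = (@) h ` e' w)"
      proof cases
        case 1
        have "\<exists>h\<in>lists B. \<exists>e'\<in>Fam. \<forall>w\<in>lists A. e (a # w) = (@) h ` e' w" if a: "a \<in> A" for a
        proof (cases "leave g a")
          case True
          have "F g a i \<subseteq> Fam" using 1(1) a True unfolding Fam_def by blast
          then show ?thesis using F[OF 1(1) a True i] 1(2) True
            by (intro bexI[of _ "hE g a i"] bexI[of _ "gE g a i"]) (auto simp: G_Cons)
        next
          case False
          then show ?thesis using stay[OF False] 1(2)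
            by (intro bexI[of _ "hh g a"] bexI[of _ "G i (nn g a)"]) (auto simp: G_Cons Fam_def)
        qed
        then show ?thesis using Nil[OF 1(1)] 1(2) by (simp add: G_Nil)
      next
        case 2
        have sub: "F g a i \<subseteq> Fam" using 2 unfolding Fam_def by blast
        have e: "finite (e []) \<and> e [] \<subseteq> lists B \<and>
            (\<forall>a'\<in>A. \<exists>h\<in>lists B. \<exists>e'\<in>F g a i. \<forall>w\<in>lists A. e (a' # w) = (@) h ` e' w)"
          using F(2)[OF 2(1-3) i, unfolded residual_closed_def] 2(4) by (rule bspec)
        show ?thesis
        proof (intro conjI ballI)
          fix a' assume "a' \<in> A"
          then obtain h e' where "h \<in> lists B" "e' \<in> F g a i" "\<forall>w\<in>lists A. e (a' # w) = (@) h ` e' w"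
            using e by meson
          then show "\<exists>h\<in>lists B. \<exists>e'\<in>Fam. \<forall>w\<in>lists A. e (a' # w) = (@) h ` e' w"
            using sub by (intro bexI[of _ h] bexI[of _ e']) auto
        qed (use e in simp_all)
      qed
    qed
    moreover have "finite Fam"
    proof -
      have "finite {(g, a) \<in> U \<times> A. leave g a}"
        using \<open>finite U\<close> finite_A by (auto intro: finite_subset[of _ "U \<times> A"])
      then show ?thesis unfolding Fam_def using \<open>finite U\<close> F i by (intro finite_UnI finite_imageI finite_UN_I) auto
    qed
    moreover have "G i f \<in> Fam" using \<open>f \<in> U\<close> by (simp add: Fam_def)
    ultimately show ?thesis unfolding seq_fun_def
      by (intro exI[of _ Fam] exI[of _ "[]"] exI[of _ "G i f"]) simp
  qed
  then have "\<forall>i<m. seq_fun (G i f)" by simp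
  moreover have "\<forall>w\<in>lists A. f w = (\<Union>i<m. G i f w)"
    by (rule ballI) (rule union[OF \<open>f \<in> U\<close>])
  ultimately have "(\<forall>i<m. seq_fun (G i f)) \<and> (\<forall>w\<in>lists A. f w = (\<Union>i<m. G i f w))" ..
  then show ?thesis unfolding multi_seq_def by (rule exI[of _ "\<lambda>i. G i f"])
qed

end

section \<open>Normalised sets of configurations and the main induction\<close>

lemma image_restrict:
  assumes "X \<subseteq> f ` P" shows "f ` {c \<in> P. f c \<in> X} = X"
  using assms by blast

context transducer
begin

text \<open>\<open>h\<close> is the longest common prefix of all outputs. If a remainder starts with
  \<open>b\<close>, maximality gives another output that does not continue \<open>h\<close> by
  \<open>b\<close>; its distance is then at least the length of that remainder, which is therefore
  at most \<open>D\<close>.\<close>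

lemma normalise:
  assumes "\<And>c d. c \<in> C \<Longrightarrow> d \<in> C \<Longrightarrow> word_dist (snd c) (snd d) \<le> D"
    and C: "C \<subseteq> states T \<times> lists B"
  obtains h C' where "h \<in> lists B" "C' \<subseteq> states T \<times> {y \<in> lists B. length y \<le> D}" "C = shift h C'"
proof (cases "C = {}")
  case True
  then show ?thesis using that[of "[]" "{}"] by simp
next
  case False
  then obtain c0 where c0: "c0 \<in> C" by auto
  define P where "P h \<longleftrightarrow> (\<forall>c\<in>C. prefix h (snd c))" for h
  have "\<forall>h. P h \<longrightarrow> length h < Suc (length (snd c0))"
    using c0 by (auto simp: P_def less_Suc_eq_le prefix_length_le)
  moreover have "P []" by (simp add: P_def)
  ultimately have "\<exists>h. P h \<and> (\<forall>h'. P h' \<longrightarrow> length h' \<le> length h)"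
    by (intro ex_has_greatest_nat)
  then obtain h where h: "P h" and max: "\<And>h'. P h' \<Longrightarrow> length h' \<le> length h"
    by (elim exE conjE) simp
  define C' where "C' = (\<lambda>(q, x). (q, drop (length h) x)) ` C"
  have "C = shift h C'"
  proof -
    have "(q, h @ drop (length h) x) = (q, x)" if "(q, x) \<in> C" for q x
      using h that unfolding P_def prefix_def by force
    then show ?thesis unfolding shift_def C'_def image_image by (force simp: image_iff)
  qed
  moreover have "h \<in> lists B"
    using h c0 C set_mono_prefix unfolding P_def by fastforce
  moreover have "C' \<subseteq> states T \<times> {y \<in> lists B. length y \<le> D}"
  proof
    fix e assume "e \<in> C'"
    then obtain q x where e: "(q, x) \<in> C" "e = (q, drop (length h) x)" by (auto simp: C'_def)
    have "length (drop (length h) x) \<le> D"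
    proof (cases "drop (length h) x")
      case (Cons b y)
      have "\<not> P (h @ [b])" using max[of "h @ [b]"] by auto
      then obtain d where d: "d \<in> C" "\<not> prefix (h @ [b]) (snd d)" by (auto simp: P_def)
      obtain z where z: "snd d = h @ z" using h d(1) by (auto simp: P_def prefix_def)
      have x: "x = h @ b # y" using h e(1) Cons unfolding P_def prefix_def by force
      have "word_dist x (snd d) = word_dist (b # y) z" by (simp add: x z)
      also have "\<dots> \<ge> length (b # y)"
        using d(2) z by (cases z) (auto simp: word_dist_code)
      finally show ?thesis using assms(1)[OF e(1) d(1)] Cons by simp
    qed simp
    moreover have "x \<in> lists B" "q \<in> states T" using e(1) C by auto
    then have "drop (length h) x \<in> lists B" by (auto dest: in_set_dropD)
    ultimately show "e \<in> states T \<times> {y \<in> lists B. length y \<le> D}"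
      using e(2) \<open>q \<in> states T\<close> by simp
  qed
  ultimately show ?thesis by (rule that[rotated -1])
qed

lemma greatest_branching:
  assumes "\<And>a. branching a S \<Longrightarrow> a \<le> m"
  shows "\<exists>a. branching a S \<and> (\<forall>b. branching b S \<longrightarrow> b \<le> a)"
  by (rule Nat.ex_has_greatest_nat[of _ 0 m]) (use assms zero in auto)

text \<open>The induction descends because both parts of a split are nonempty: each has branching
  number at least 1, and as the two add up to at most \<open>m\<close>, both are smaller than
  \<open>m\<close>.\<close>

lemma multi_seq_rel:
  "finite S \<Longrightarrow> S \<subseteq> states T \<times> lists B \<Longrightarrow> \<not> branching (Suc m) S \<Longrightarrow> multi_seq m (rel S)"
proof (induction m arbitrary: S rule: less_induct)
  case (less m)
  note S = less.prems
  have S': "S \<subseteq> states T \<times> UNIV" using S(2) by auto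
  show ?case
  proof (cases "S = {}")
    case True
    then show ?thesis using multi_seq_empty by (simp add: rel_def[abs_def] post_def)
  next
    case False
    then obtain c0 where "c0 \<in> S" by auto
    then have "branching 1 S" by (rule one)
    then have "m > 0" using S(3) by (cases m) auto
    obtain D1 where D1: "\<And>w z z'. z \<in> post S w \<Longrightarrow> z' \<in> post S w \<Longrightarrow>
      D1 < word_dist (snd z) (snd z') \<Longrightarrow>
      \<exists>X Y. post S w = X \<union> Y \<and> X \<noteq> {} \<and> Y \<noteq> {} \<and>
        (\<forall>a b. branching a X \<longrightarrow> branching b Y \<longrightarrow> a + b \<le> m)"
      using diameter_split[OF S(1) S' S(3)] by blast
    obtain D2 where D2: "\<And>c d. c \<in> S \<Longrightarrow> d \<in> S \<Longrightarrow> word_dist (snd c) (snd d) \<le> D2"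
      using word_dist_bound[OF S(1)] by blast
    \<comment> \<open>\<open>D1\<close> is the threshold above which a split exists;
      \<open>D2\<close> allows \<open>S\<close> itself to be normalised, giving the initial
      state.\<close>
    define D where "D = max D1 D2"
    define Q where "Q = states T \<times> {y \<in> lists B. length y \<le> D}"
    \<comment> \<open>The states of the deterministic machine. Each remembers that it stems from
      \<open>S\<close> by some word, because \<open>D1\<close> speaks only of sets
      \<open>post S w\<close>.\<close>
    define V where "V = {C. C \<subseteq> Q \<and> (\<exists>w\<in>lists A. \<exists>h. post S w = shift h C)}"
    have finQ: "finite Q"
    proof -
      have "{y \<in> lists B. length y \<le> D} = {y. set y \<subseteq> B \<and> length y \<le> D}" by auto
      then show ?thesis
        using wa finite_lists_length_le[OF finite_B, of D] by (simp add: Q_def weighted_automaton_def)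
    qed
    have Q: "Q \<subseteq> states T \<times> lists B" by (auto simp: Q_def)
    have finV: "finite V"
      unfolding V_def using finQ by (auto intro: finite_subset[of _ "Pow Q"])
    have step: "(\<exists>h\<in>lists B. \<exists>C'\<in>V. post C [a] = shift h C') \<or> multi_seq m (rel (post C [a]))"
      if C: "C \<in> V" and a: "a \<in> A" for C a
    proof -
      obtain w h where w: "w \<in> lists A" "post S w = shift h C" and CQ: "C \<subseteq> Q"
        using C by (auto simp: V_def)
      define P where "P = post C [a]"
      have P: "post S (w @ [a]) = shift h P" using w(2) by (simp add: post_append post_shift P_def)
      have PB: "P \<subseteq> states T \<times> lists B" using CQ Q post_lists unfolding P_def by blast
      have finP: "finite P" unfolding P_def using CQ finQ finite_post finite_subset by blast
      show ?thesis
      proof (cases "\<forall>c\<in>P. \<forall>d\<in>P. word_dist (snd c) (snd d) \<le> D")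
        case True
        then have le: "word_dist (snd c) (snd d) \<le> D" if "c \<in> P" "d \<in> P" for c d
          using that by blast
        obtain h' C' where h': "h' \<in> lists B"
          "C' \<subseteq> states T \<times> {y \<in> lists B. length y \<le> D}" "P = shift h' C'"
          by (rule normalise[OF le PB])
        then have "post S (w @ [a]) = shift (h @ h') C'" using P by (simp add: shift_shift)
        moreover have "w @ [a] \<in> lists A" using w(1) a by simp
        ultimately have "C' \<in> V" using h'(2) unfolding V_def Q_def by blast
        then show ?thesis using h' unfolding P_def by blast
      next
        case False
        then obtain c d where cd: "c \<in> P" "d \<in> P" "D < word_dist (snd c) (snd d)"
          by (auto simp: not_le)
        \<comment> \<open>\<open>P\<close> is this set with the factor \<open>h\<close> stripped, so
          distances agree. The split is made here and pulled back to \<open>P\<close>;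
          \<open>branching_shift\<close> carries the branching numbers over.\<close>
        have "\<exists>X Y. post S (w @ [a]) = X \<union> Y \<and> X \<noteq> {} \<and> Y \<noteq> {} \<and>
          (\<forall>a b. branching a X \<longrightarrow> branching b Y \<longrightarrow> a + b \<le> m)"
        proof (rule D1)
          show "apsnd ((@) h) c \<in> post S (w @ [a])" "apsnd ((@) h) d \<in> post S (w @ [a])"
            using cd by (auto simp: P shift_def)
          show "D1 < word_dist (snd (apsnd ((@) h) c)) (snd (apsnd ((@) h) d))"
            using cd(3) by (simp add: D_def)
        qed
        then obtain X Y where XY: "shift h P = X \<union> Y" "X \<noteq> {}" "Y \<noteq> {}"
          "\<And>a b. branching a X \<Longrightarrow> branching b Y \<Longrightarrow> a + b \<le> m"
          unfolding P by blast
        define X' where "X' = {c \<in> P. apsnd ((@) h) c \<in> X}"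
        define Y' where "Y' = {c \<in> P. apsnd ((@) h) c \<in> Y}"
        have sX: "shift h X' = X" and sY: "shift h Y' = Y"
          using XY(1) unfolding X'_def Y'_def shift_def by (simp_all add: image_restrict)
        have P': "P = X' \<union> Y'"
        proof -
          have "apsnd ((@) h) c \<in> X \<union> Y" if "c \<in> P" for c
            using that unfolding XY(1)[symmetric] shift_def by (rule imageI)
          then show ?thesis unfolding X'_def Y'_def by blast
        qed
        have sum: "a + b \<le> m" if "branching a X'" "branching b Y'" for a b
          using XY(4)[of a b] branching_shift[OF that(1), of h] branching_shift[OF that(2), of h]
          by (simp add: sX sY)
        have X1: "branching 1 X'" "branching 1 Y'"
          using XY(2,3) sX sY one[of _ X'] one[of _ Y'] by (metis shift_empty ex_in_conv)+
        have "a \<le> m" if "branching a X'" for a using sum[OF that X1(2)] by simp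
        then obtain a where a: "branching a X'" "\<forall>b. branching b X' \<longrightarrow> b \<le> a"
          using greatest_branching by metis
        have "b \<le> m" if "branching b Y'" for b using sum[OF X1(1) that] by simp
        then obtain b where b: "branching b Y'" "\<forall>a. branching a Y' \<longrightarrow> a \<le> b"
          using greatest_branching by metis
        have ab: "a + b \<le> m" "1 \<le> a" "1 \<le> b" using sum a b X1 by auto
        have "multi_seq a (rel X')"
          by (rule less.IH) (use ab spec[OF a(2), of "Suc a"] P' finP PB in auto)
        moreover have "multi_seq b (rel Y')"
          by (rule less.IH) (use ab spec[OF b(2), of "Suc b"] P' finP PB in auto)
        ultimately have "multi_seq m (\<lambda>w. rel X' w \<union> rel Y' w)"
          using ab(1) by (rule multi_seq_Un)
        then show ?thesis using P' by (simp add: P_def rel_Un[abs_def])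
      qed
    qed
    have "multi_seq m f" if "f \<in> rel ` V" for f
    proof (rule multi_seq_glue[OF _ \<open>m > 0\<close> _ _ that])
      show "finite (rel ` V)" using finV by simp
      show "finite (f []) \<and> f [] \<subseteq> lists B" if "f \<in> rel ` V" for f
      proof -
        from that obtain C where "C \<subseteq> Q" "f = rel C" by (auto simp: V_def)
        then show ?thesis using rel_Nil[of C] finQ finite_subset[of C Q] Q by auto
      qed
      show "(\<exists>h\<in>lists B. \<exists>g\<in>rel ` V. \<forall>w\<in>lists A. f (a # w) = (@) h ` g w) \<or>
          multi_seq m (\<lambda>w. f (a # w))" if f: "f \<in> rel ` V" and a: "a \<in> A" for f a
      proof -
        obtain C where C: "C \<in> V" "f = rel C" using f by auto
        have fa: "f (a # w) = rel (post C [a]) w" for w using rel_append[of C "[a]" w] C by simp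
        from step[OF C(1) a] show ?thesis
        proof
          assume "\<exists>h\<in>lists B. \<exists>C'\<in>V. post C [a] = shift h C'"
          then obtain h C' where "h \<in> lists B" "C' \<in> V" "post C [a] = shift h C'" by blast
          then show ?thesis
            by (intro disjI1 bexI[of _ h] bexI[of _ "rel C'"] ballI) (simp_all add: fa rel_shift)
        qed (simp add: fa)
      qed
    qed
    moreover have le: "word_dist (snd c) (snd d) \<le> D" if "c \<in> S" "d \<in> S" for c d
      using D2[OF that] by (simp add: D_def)
    obtain h C where hC: "h \<in> lists B" "C \<subseteq> states T \<times> {y \<in> lists B. length y \<le> D}"
      "S = shift h C"
      by (rule normalise[OF le S(2)])
    have "[] \<in> lists A" "post S [] = shift h C" using post_Nil[OF S'] hC(3) by simp_all
    then have "C \<in> V" using hC(2) unfolding V_def Q_def by blast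
    ultimately have "multi_seq m (\<lambda>w. (@) h ` rel C w)"
      using multi_seq_shift hC(1) by blast
    then show ?thesis using hC(3) by (simp add: rel_shift[abs_def])
  qed
qed

end

section \<open>Pumping\<close>

abbreviation rep :: "nat \<Rightarrow> 'x list \<Rightarrow> 'x list" where
  "rep n x \<equiv> concat (replicate n x)"

lemma length_le_word_dist: "length x \<le> length y + word_dist x y"
proof -
  obtain p r s where *: "x = p @ r" "y = p @ s" "longest_common_prefix x y = p"
    by (rule longest_common_prefix_decomp)
  show ?thesis unfolding word_dist_def *(3) using *(1,2) by simp
qed

lemma rep_Suc_right: "rep (Suc n) x = rep n x @ x"
  by (induction n) auto

lemma length_rep: "length (rep n x) = n * length x"
  by (induction n) auto

lemma dly_rep:
  assumes "dly (x @ b) (y @ c) = dly x y"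
  shows "dly (x @ rep n b) (y @ rep n c) = dly x y"
proof (induction n)
  case (Suc n)
  have "dly (x @ rep (Suc n) b) (y @ rep (Suc n) c) = dly ((x @ rep n b) @ b) ((y @ rep n c) @ c)"
    by (simp add: rep_Suc_right del: replicate_Suc)
  also have "\<dots> = dly (x @ b) (y @ c)" using Suc by (simp only: dly_append_eq_iff)
  finally show ?case using assms by simp
qed simp

text \<open>If the pumped words agreed on \<open>length y + length b\<close> letters, then
  \<open>y = x @ t\<close> with \<open>t @ c = b @ t\<close>, and the loop would keep the delay. So
  the common prefix stays short while the words grow.\<close>

lemma word_dist_rep_same_length:
  assumes "dly (x @ b) (y @ c) \<noteq> dly x y" and len: "length b = length c" "length x \<le> length y"
    and N: "N > K + length y + 2"
  shows "word_dist (x @ rep N b) (y @ rep N c) > K"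
proof -
  obtain N' where N': "N = Suc N'" using N by (cases N) auto
  have "b \<noteq> []" using assms(1) len by auto
  then have pos: "length b > 0" by simp
  obtain p r s where *: "x @ rep N b = p @ r" "y @ rep N c = p @ s"
      "longest_common_prefix (x @ rep N b) (y @ rep N c) = p"
    by (rule longest_common_prefix_decomp)
  have "length p < length y + length b"
  proof (rule ccontr)
    assume "\<not> ?thesis"
    then have "take (length y + length b) (x @ rep N b) = take (length y + length b) (y @ rep N c)"
      unfolding *(1,2) by simp
    also have "\<dots> = y @ c" using len by (simp add: N')
    finally have yc: "x @ take (length y - length x + length b) (rep N b) = y @ c"
      using len by simp
    define t where "t = drop (length x) y"
    have xt: "y = x @ t" using yc len(2) unfolding t_def
      by (metis append_eq_append_conv_if append_take_drop_id)
    have tc: "take (length t + length b) (rep N b) = t @ c"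
      using yc by (simp add: xt)
    have short: "length t \<le> length (rep N' b)"
    proof -
      have "length t \<le> N' * 1" using N by (simp add: N' xt)
      also have "\<dots> \<le> N' * length b" using pos by (intro mult_le_mono2) (simp only: Suc_le_eq One_nat_def)
      finally show ?thesis by (simp only: length_rep)
    qed
    have "t = take (length t) (take (length t + length b) (rep N b))" by (simp add: tc)
    also have "\<dots> = take (length t) (rep N b)" by (simp add: min_def)
    also have "\<dots> = take (length t) (rep N' b)"
      using short unfolding N' rep_Suc_right by simp
    finally have "take (length t) (rep N' b) = t" by simp
    moreover have "take (length t + length b) (rep N b) = b @ take (length t) (rep N' b)"
      by (simp add: N')
    ultimately have "t @ c = b @ t" using tc by simp
    \<comment> \<open>Uses \<open>y @ c = x @ t @ c = x @ b @ t\<close>; both delays reduce to the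
      delay of the empty word and \<open>t\<close>.\<close>
    then have "dly (x @ b) (y @ c) = dly ((x @ b) @ []) ((x @ b) @ t)" by (simp add: xt)
    also have "\<dots> = dly (x @ []) (x @ t)" by (simp only: dly_append_left)
    finally show False using assms(1) by (simp add: xt)
  qed
  moreover have "length x + N * length b = length p + length r"
    "length y + N * length c = length p + length s"
    using arg_cong[OF *(1), of length] arg_cong[OF *(2), of length] by (simp_all add: length_rep)
  moreover have "word_dist (x @ rep N b) (y @ rep N c) = length r + length s"
    unfolding word_dist_def *(3) unfolding *(1,2) by simp
  moreover have "N * length b \<ge> (N - 1) + length b"
    using pos N by (cases "length b"; cases N) auto
  ultimately show ?thesis using N len by linarith
qed

text \<open>Loop outputs of different lengths already make the total lengths drift apart by at least
  one letter per iteration; the difficulty lies in equal lengths.\<close>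

lemma word_dist_rep:
  assumes "dly (x @ b) (y @ c) \<noteq> dly x y" and N: "N > K + length x + length y + 2"
  shows "word_dist (x @ rep N b) (y @ rep N c) > K"
proof (cases "length b" "length c" rule: linorder_cases)
  case less
  then have "N * length b + N \<le> N * length c"
    by (metis Suc_leI add.commute mult_Suc_right mult_le_mono2)
  moreover have "length (y @ rep N c) \<le> length (x @ rep N b) + word_dist (x @ rep N b) (y @ rep N c)"
    by (subst word_dist_commute) (rule length_le_word_dist)
  ultimately show ?thesis using N by (simp add: length_rep)
next
  case greater
  then have "N * length c + N \<le> N * length b"
    by (metis Suc_leI add.commute mult_Suc_right mult_le_mono2)
  moreover have "length (x @ rep N b) \<le> length (y @ rep N c) + word_dist (x @ rep N b) (y @ rep N c)"
    by (rule length_le_word_dist)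
  ultimately show ?thesis using N by (simp add: length_rep)
next
  case equal
  show ?thesis
  proof (cases "length x \<le> length y")
    case True
    then show ?thesis using word_dist_rep_same_length[OF assms(1) equal True, of K N] N by simp
  next
    case False
    have "dly (y @ c) (x @ b) \<noteq> dly y x" using assms(1) dly_sym by blast
    then show ?thesis
      using word_dist_rep_same_length[of y c x b K N] equal False N
      by (subst word_dist_commute) simp
  qed
qed

text \<open>The inputs share the pumped part, so their distance is constant in \<open>N\<close>. A
  separating loop drives the outputs arbitrarily far apart; any other loop leaves their distance
  unchanged, so a violation present without it persists.\<close>

lemma pump_violates:
  assumes "dly (x @ b) (y @ c) \<noteq> dly x y \<or> L * (word_dist w w' + 1) < word_dist (x @ s) (y @ t)"
  shows "\<exists>N0. \<forall>N\<ge>N0. L * (word_dist (h @ rep N v @ w) (h @ rep N v @ w') + 1) <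
    word_dist (x @ rep N b @ s) (y @ rep N c @ t)"
proof -
  have words: "word_dist (h @ rep N v @ w) (h @ rep N v @ w') = word_dist w w'" for N by simp
  show ?thesis
  proof (cases "dly (x @ b) (y @ c) = dly x y")
    case True
    have "word_dist (x @ rep N b @ s) (y @ rep N c @ t) = word_dist (x @ s) (y @ t)" for N
    proof -
      have "dly ((x @ rep N b) @ s) ((y @ rep N c) @ t) = dly (x @ s) (y @ t)"
        using dly_rep[OF True, of N] by (simp only: dly_append_eq_iff)
      then show ?thesis using dly_eq_word_dist by fastforce
    qed
    then show ?thesis using assms True words by auto
  next
    case False
    define K where "K = L * (word_dist w w' + 1) + length s + length t"
    have "L * (word_dist w w' + 1) < word_dist (x @ rep N b @ s) (y @ rep N c @ t)"
      if "N \<ge> K + length x + length y + 3" for N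
    proof -
      have "K < word_dist (x @ rep N b) (y @ rep N c)"
        using word_dist_rep[OF False, of K N] that by simp
      then show ?thesis
        using word_dist_append_ge[of "x @ rep N b" "y @ rep N c" s t] by (simp add: K_def)
    qed
    then show ?thesis unfolding words by blast
  qed
qed

section \<open>Accepting completions and violations of the Lipschitz property\<close>

lemma path_suffix:
  "is_path W p ts q \<Longrightarrow> s \<in> path_states p ts \<Longrightarrow> \<exists>ts'. is_path W s ts' q"
proof (induction ts arbitrary: p)
  case Nil
  then show ?case by (auto simp: path_states_def intro: exI[of _ "[]"])
next
  case (Cons t ts)
  obtain p' a x r where t: "t = (p', a, x, r)" by (cases t)
  show ?case
  proof (cases "s = p")
    case True
    then show ?thesis using Cons.prems(1) by blast
  next
    case False
    then have "s \<in> path_states r ts" using Cons.prems(2) by (auto simp: path_states_def t)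
    then show ?thesis using Cons.IH[of r] Cons.prems(1) by (simp add: t)
  qed
qed

text \<open>Trimming enters here: the leaves of a branching tree can be completed to elements of the
  relation.\<close>

lemma trimmed_coaccessible:
  assumes "trimmed W" "s \<in> states W"
  obtains w x q z where "run M W s w x q" "(q, z) \<in> t_final W"
proof -
  obtain p ts q where "is_path W p ts q" "final W q" "s \<in> path_states p ts"
    using assms unfolding trimmed_def by blast
  then obtain ts' z where "is_path W s ts' q" "(q, z) \<in> t_final W"
    using path_suffix unfolding final_def by meson
  then show ?thesis by (intro that) (auto simp: run_def)
qed

lemma mult_free_monoid: "x \<otimes>\<^bsub>free_monoid B\<^esub> y = x @ y"
  by (simp add: free_monoid_def)

lemma mem_semantics:
  "(w, y) \<in> semantics (free_monoid B) W \<longleftrightarrow> (\<exists>p x x' q z. (p, x) \<in> t_init W \<and>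
    run (free_monoid B) W p w x' q \<and> (q, z) \<in> t_final W \<and> y = (x @ x') @ z)"
  unfolding semantics_def mult_free_monoid mem_Collect_eq prod.inject by (rule iffI; elim exE conjE; blast)

context transducer
begin

lemma rel_t_init: "y \<in> rel (t_init T) w \<longleftrightarrow> (w, y) \<in> semantics (free_monoid B) T"
proof
  assume "y \<in> rel (t_init T) w"
  then obtain p x z where "y = x @ z" "(p, x) \<in> post (t_init T) w" "(p, z) \<in> t_final T"
    by (auto simp: rel_def)
  moreover from this(2) obtain q x' x'' where "(q, x') \<in> t_init T" "rn q w x'' p" "x = x' @ x''"
    by (auto elim: postE)
  ultimately show "(w, y) \<in> semantics (free_monoid B) T"
    unfolding mem_semantics by blast
next
  assume "(w, y) \<in> semantics (free_monoid B) T"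
  then obtain q x' x'' p z where "(q, x') \<in> t_init T" "rn q w x'' p" "(p, z) \<in> t_final T"
    "y = (x' @ x'') @ z"
    unfolding mem_semantics by blast
  then show "y \<in> rel (t_init T) w" unfolding rel_def by (blast intro: postI)
qed

lemma t_init_subset: "t_init T \<subseteq> states T \<times> lists B" "finite (t_init T)"
  using wa by (auto simp: weighted_automaton_def free_monoid_def)

lemma rn_rep: "rn p v y p \<Longrightarrow> rn p (rep n v) (rep n y) p"
proof (induction n)
  case 0
  then show ?case using rnD by auto
next
  case (Suc n)
  then show ?case by (auto simp: rn_append)
qed

text \<open>At a node, pairs taken across \<open>X\<close> and \<open>Y\<close> are separated by the
  loop at that node, while pairs inside one side violate the bound by induction. Either way
  \<open>pump_violates\<close> applies, with one exponent for all pairs.\<close>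

lemma branching_violates_lipschitz:
  assumes "trimmed T"
  shows "branching n S \<Longrightarrow> S \<subseteq> states T \<times> UNIV \<Longrightarrow>
    \<exists>es. length es = n \<and> (\<forall>e\<in>set es. snd e \<in> rel S (fst e)) \<and>
      sorted_wrt (\<lambda>e e'. L * (word_dist (fst e) (fst e') + 1) < word_dist (snd e) (snd e')) es"
proof (induction rule: branching.induct)
  case (one c S)
  then have "fst c \<in> states T" by auto
  then obtain w x q z where wx: "rn (fst c) w x q" "(q, z) \<in> t_final T"
    by (rule trimmed_coaccessible[OF assms])
  then have "(q, snd c @ x) \<in> post S w" using one.hyps postI[of "fst c" "snd c" S w x q] by simp
  then have "(snd c @ x) @ z \<in> rel S w" using wx(2) unfolding rel_def by blast
  then show ?case by (intro exI[of _ "[(w, (snd c @ x) @ z)]"]) simp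
next
  case (split n m X Y S u v)
  let ?V = "\<lambda>e e'. L * (word_dist (fst e) (fst e') + 1) < word_dist (snd e) (snd e')"
  \<comment> \<open>The induction hypothesis yields only a word and an output. To insert the loop,
    the configuration \<open>c\<close>, its loop output \<open>b\<close> and the output
    \<open>s\<close> after \<open>c\<close> have to be recovered.\<close>
  let ?item = "\<lambda>Z (w, c, b, s). (c, b) \<in> Z \<and> (\<exists>x q z. rn (fst c) w x q \<and> (q, z) \<in> t_final T \<and> s = x @ z)"
  let ?ev = "\<lambda>(w :: 'a list, c :: 'q \<times> 'b list, b :: 'b list, s :: 'b list). (w, snd c @ s)"
  have items: "\<exists>is1. map ?ev is1 = es \<and> (\<forall>i\<in>set is1. ?item Z i)"
    if "\<forall>e\<in>set es. snd e \<in> rel (fst ` Z) (fst e)" for es and Z :: "(('q \<times> 'b list) \<times> 'b list) set"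
  proof -
    have "\<exists>i. ?ev i = e \<and> ?item Z i" if e: "e \<in> set es" for e
    proof -
      have "snd e \<in> rel (fst ` Z) (fst e)" using that \<open>\<forall>e\<in>set es. _ e\<close> by blast
      then obtain p x z where *: "snd e = x @ z" "(p, x) \<in> post (fst ` Z) (fst e)" "(p, z) \<in> t_final T"
        by (auto simp: rel_def)
      from *(2) obtain c x' where **: "c \<in> fst ` Z" "rn (fst c) (fst e) x' p" "x = snd c @ x'"
        unfolding mem_post fst_conv snd_conv by (metis fst_conv snd_conv)
      then obtain b where "(c, b) \<in> Z" by auto
      then show ?thesis using * **
        by (intro exI[of _ "(fst e, c, b, x' @ z)"]) (auto simp: prod_eq_iff)
    qed
    then have "\<forall>e\<in>set es. \<exists>i. ?ev i = e \<and> ?item Z i" by (rule ballI)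
    from bchoice[OF this] obtain f where f: "\<forall>e\<in>set es. ?ev (f e) = e \<and> ?item Z (f e)" ..
    then have "map ?ev (map f es) = es" by (simp add: map_idI)
    moreover have "\<forall>i\<in>set (map f es). ?item Z i" using f by simp
    ultimately show ?thesis by (intro exI[of _ "map f es"] conjI)
  qed
  have "fst e \<in> states T \<times> UNIV" if "e \<in> X \<union> Y" for e
    using split.hyps(3)[of "fst e" "snd e"] that post_states by auto
  then have sub: "fst ` X \<subseteq> states T \<times> UNIV" "fst ` Y \<subseteq> states T \<times> UNIV" by blast+
  obtain xs where xs: "length xs = n" "\<forall>e\<in>set xs. snd e \<in> rel (fst ` X) (fst e)" "sorted_wrt ?V xs"
    using split.IH(1)[OF sub(1)] by blast
  obtain ys where ys: "length ys = m" "\<forall>e\<in>set ys. snd e \<in> rel (fst ` Y) (fst e)" "sorted_wrt ?V ys"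
    using split.IH(2)[OF sub(2)] by blast
  obtain is1 where is1: "map ?ev is1 = xs" "\<forall>i\<in>set is1. ?item X i" using items[OF xs(2)] by blast
  obtain js1 where js1: "map ?ev js1 = ys" "\<forall>i\<in>set js1. ?item Y i" using items[OF ys(2)] by blast
  define alt where "alt = (\<lambda>(w :: 'a list, c :: 'q \<times> 'b list, b, s :: 'b list)
    (w' :: 'a list, d :: 'q \<times> 'b list, b', s' :: 'b list). dly (snd c @ b) (snd d @ b') \<noteq> dly (snd c) (snd d))"
  let ?g = "\<lambda>N (w, c, b, s). (u @ rep N v @ w, snd c @ rep N b @ s)"
  have sorted: "sorted_wrt (\<lambda>i j. alt i j \<or> ?V (?ev i) (?ev j)) (is1 @ js1)"
    unfolding sorted_wrt_append
  proof (intro conjI ballI)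
    have "sorted_wrt (\<lambda>i j. ?V (?ev i) (?ev j)) is1"
      using xs(3) unfolding is1(1)[symmetric] sorted_wrt_map .
    then show "sorted_wrt (\<lambda>i j. alt i j \<or> ?V (?ev i) (?ev j)) is1"
      by (rule sorted_wrt_mono_rel[rotated]) (rule disjI2)
    have "sorted_wrt (\<lambda>i j. ?V (?ev i) (?ev j)) js1"
      using ys(3) unfolding js1(1)[symmetric] sorted_wrt_map .
    then show "sorted_wrt (\<lambda>i j. alt i j \<or> ?V (?ev i) (?ev j)) js1"
      by (rule sorted_wrt_mono_rel[rotated]) (rule disjI2)
    fix i j assume "i \<in> set is1" "j \<in> set js1"
    then have "alt i j" using is1(2) js1(2) split.hyps(4) unfolding alt_def by fastforce
    then show "alt i j \<or> ?V (?ev i) (?ev j)" ..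
  qed
  have ev: "\<exists>N0. \<forall>N\<ge>N0. ?V (?g N i) (?g N j)" if "alt i j \<or> ?V (?ev i) (?ev j)" for i j
    using that pump_violates[where h = u and v = v] unfolding alt_def
    by (cases i; cases j) simp
  \<comment> \<open>Each of the finitely many pairs has its own threshold, so some \<open>N\<close>
    exceeds all of them.\<close>
  have "\<forall>\<^sub>F N in sequentially. \<forall>i\<in>set (is1 @ js1). \<forall>j\<in>set (is1 @ js1).
    (alt i j \<or> ?V (?ev i) (?ev j)) \<longrightarrow> ?V (?g N i) (?g N j)"
  proof (intro eventually_ball_finite ballI finite_set)
    fix i j
    show "\<forall>\<^sub>F N in sequentially. (alt i j \<or> ?V (?ev i) (?ev j)) \<longrightarrow> ?V (?g N i) (?g N j)"
      using ev[of i j] unfolding eventually_sequentially by blast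
  qed
  then obtain N where N: "\<forall>i\<in>set (is1 @ js1). \<forall>j\<in>set (is1 @ js1).
    (alt i j \<or> ?V (?ev i) (?ev j)) \<longrightarrow> ?V (?g N i) (?g N j)"
    unfolding eventually_sequentially by blast
  show ?case
  proof (intro exI[of _ "map (?g N) (is1 @ js1)"] conjI ballI)
    have "length is1 = n" "length js1 = m" using xs(1) ys(1) is1(1) js1(1) by auto
    then show "length (map (?g N) (is1 @ js1)) = n + m" by simp
    show "sorted_wrt ?V (map (?g N) (is1 @ js1))"
      unfolding sorted_wrt_map by (rule sorted_wrt_mono_rel[OF _ sorted]) (use N in blast)
    fix e assume "e \<in> set (map (?g N) (is1 @ js1))"
    then have "e \<in> ?g N ` (set is1 \<union> set js1)" by (simp only: set_map set_append)
    then obtain i where "e = ?g N i" "i \<in> set is1 \<union> set js1" by (rule imageE)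
    then have i: "i \<in> set is1 \<or> i \<in> set js1" "e = ?g N i" by (simp_all only: Un_iff)
    obtain w c b s where icb: "i = (w, c, b, s)" by (cases i)
    have "(c, b) \<in> X \<union> Y" "\<exists>x q z. rn (fst c) w x q \<and> (q, z) \<in> t_final T \<and> s = x @ z"
      using i(1) is1(2) js1(2) unfolding icb by fastforce+
    then obtain x q z where *: "c \<in> post S u" "rn (fst c) v b (fst c)" "rn (fst c) w x q"
      "(q, z) \<in> t_final T" "s = x @ z"
      using split.hyps(3) by blast
    have "rn (fst c) (rep N v @ w) (rep N b @ x) q"
      using rn_rep[OF *(2), of N] *(3) by (auto simp: rn_append)
    then have "(q, snd c @ (rep N b @ x)) \<in> post (post S u) (rep N v @ w)"
      using *(1) postI[of "fst c" "snd c"] by simp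
    then have "(snd c @ (rep N b @ x)) @ z \<in> rel S (u @ rep N v @ w)"
      using *(4) unfolding rel_def post_append by blast
    then show "snd e \<in> rel S (fst e)" unfolding i(2) icb by (simp add: *(5))
  qed
qed simp

section \<open>Branching trees and the twinning property\<close>

lemma run_map_weights:
  "run (free_group B) (map_weights embed_word T) p w X q \<longleftrightarrow> (\<exists>x. X = embed_word x \<and> rn p w x q)"
proof (induction w arbitrary: p X)
  case Nil
  have "embed_word [] = \<one>\<^bsub>free_group B\<^esub>" by (simp add: embed_word_def free_group_def)
  then show ?case unfolding run_Nil[of "free_group B"] by (auto simp: map_weights_def)
next
  case (Cons a w)
  have tr: "(p, a, Y, r) \<in> transitions (map_weights embed_word T) \<longleftrightarrow>
      (\<exists>y. Y = embed_word y \<and> (p, a, y, r) \<in> transitions T)" for Y r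
    by (force simp: map_weights_def)
  show ?case
  proof
    assume "run (free_group B) (map_weights embed_word T) p (a # w) X q"
    then obtain y r z where *: "(p, a, y, r) \<in> transitions T" "rn r w z q"
      "X = embed_word y \<otimes>\<^bsub>free_group B\<^esub> embed_word z"
      unfolding run_Cons tr Cons.IH by blast
    then have "rn p (a # w) (y @ z) q" unfolding rn_Cons by blast
    then show "\<exists>x. X = embed_word x \<and> rn p (a # w) x q"
      using *(3) embed_word_append[of y z B, symmetric] by (intro exI[of _ "y @ z"]) simp
  next
    assume "\<exists>x. X = embed_word x \<and> rn p (a # w) x q"
    then obtain y r z where *: "(p, a, y, r) \<in> transitions T" "rn r w z q" "X = embed_word (y @ z)"
      unfolding rn_Cons by blast
    then show "run (free_group B) (map_weights embed_word T) p (a # w) X q"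
      unfolding run_Cons tr Cons.IH embed_word_append[where B = B] by blast
  qed
qed

lemma t_init_map_weights:
  "(p, X) \<in> t_init (map_weights embed_word T) \<longleftrightarrow> (\<exists>x. X = embed_word x \<and> (p, x) \<in> t_init T)"
  by (force simp: map_weights_def)

lemma list_prod_embed_word:
  "list_prod (free_group B) (map embed_word xs) = embed_word (concat xs)"
proof (induction xs)
  case Nil
  show ?case by (simp add: list_prod_def embed_word_def free_group_def)
next
  case (Cons x xs)
  then show ?case by (simp add: list_prod_def embed_word_append[where B = B])
qed

lemma prefix_output_embed_word:
  assumes "c j = embed_word c'" "\<And>i'. 1 \<le> i' \<Longrightarrow> i' \<le> i \<Longrightarrow> x i' j = embed_word (x' i')"
  shows "prefix_output (free_group B) c x i j = embed_word (c' @ concat (map x' [1..<Suc i]))"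
proof -
  have "map (\<lambda>i'. x i' j) [1..<Suc i] = map embed_word (map x' [1..<Suc i])"
    unfolding map_map o_def by (rule map_cong[OF refl]) (use assms(2) in auto)
  then have "list_prod (free_group B) (map (\<lambda>i'. x i' j) [1..<Suc i]) = embed_word (concat (map x' [1..<Suc i]))"
    by (simp only: list_prod_embed_word)
  then show ?thesis unfolding prefix_output_def assms(1) embed_word_append[where B = B] by simp
qed

text \<open>A failure of twinning gives \<open>k + 1\<close> runs, each two separated at some level
  before their words differ; \<open>levels_branching\<close> arranges these pairwise separations in
  a tree.\<close>

lemma branching_if_not_twinning:
  assumes "\<not> branching_twinning_property k (free_group B) (map_weights embed_word T)"
  shows "branching (Suc k) (t_init T)"
proof -
  let ?W = "map_weights embed_word T"
  obtain q c u v x y where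
    init: "\<forall>j\<le>k. (q 0 j, c j) \<in> t_init ?W" and
    runs: "\<forall>i\<in>{1..k}. \<forall>j\<le>k. run (free_group B) ?W (q (i - 1) j) (u i j) (x i j) (q i j) \<and>
           run (free_group B) ?W (q i j) (v i j) (y i j) (q i j)" and
    no: "\<not> (\<exists>j\<le>k. \<exists>j'\<le>k. j \<noteq> j' \<and>
           (\<forall>i\<in>{1..k}.
              (\<forall>i'\<in>{1..i}. u i' j = u i' j' \<and> v i' j = v i' j') \<longrightarrow>
              delay (free_group B) (prefix_output (free_group B) c x i j) (prefix_output (free_group B) c x i j') =
              delay (free_group B) (prefix_output (free_group B) c x i j \<otimes>\<^bsub>free_group B\<^esub> y i j)
                      (prefix_output (free_group B) c x i j' \<otimes>\<^bsub>free_group B\<^esub> y i j')))"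
    using assms unfolding branching_twinning_property_def not_all not_imp by (elim exE conjE) (rule that)
  have "\<forall>j. \<exists>c'. j \<le> k \<longrightarrow> c j = embed_word c' \<and> (q 0 j, c') \<in> t_init T"
    using init unfolding t_init_map_weights by simp
  then obtain c' where c': "\<forall>j. j \<le> k \<longrightarrow> c j = embed_word (c' j) \<and> (q 0 j, c' j) \<in> t_init T"
    unfolding choice_iff by (elim exE)
  have "\<forall>i j. \<exists>x' y'. 1 \<le> i \<and> i \<le> k \<and> j \<le> k \<longrightarrow> x i j = embed_word x' \<and> y i j = embed_word y' \<and>
      rn (q (i - 1) j) (u i j) x' (q i j) \<and> rn (q i j) (v i j) y' (q i j)"
    using runs unfolding run_map_weights by (metis atLeastAtMost_iff)
  then obtain x' y' where x': "\<forall>i j. 1 \<le> i \<and> i \<le> k \<and> j \<le> k \<longrightarrow>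
      x i j = embed_word (x' i j) \<and> y i j = embed_word (y' i j) \<and>
      rn (q (i - 1) j) (u i j) (x' i j) (q i j) \<and> rn (q i j) (v i j) (y' i j) (q i j)"
    unfolding choice_iff by (elim exE)
  define po where "po i j = c' j @ concat (map (\<lambda>i. x' i j) [1..<Suc i])" for i j
  have po: "prefix_output (free_group B) c x i j = embed_word (po i j)" if "i \<le> k" "j \<le> k" for i j
    unfolding po_def by (rule prefix_output_embed_word) (use c' x' that in auto)
  have po_Suc: "po (Suc i) j = po i j @ x' (Suc i) j" for i j by (simp add: po_def)
  have q_states: "q i j \<in> states T" if "i \<le> k" "j \<le> k" for i j
  proof (cases i)
    case 0
    then show ?thesis using c' that t_init_subset(1) by auto
  next
    case (Suc i')
    then have "1 \<le> i \<and> i \<le> k \<and> j \<le> k" using that by simp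
    then have "rn (q i j) (v i j) (y' i j) (q i j)" using x' by simp
    then show ?thesis using rnD by blast
  qed
  have po_lists: "po i j \<in> lists B" if "i \<le> k" "j \<le> k" for i j
    using that(1)
  proof (induction i)
    case 0
    then show ?case using c' that t_init_subset by (auto simp: po_def)
  next
    case (Suc i)
    have "1 \<le> Suc i \<and> Suc i \<le> k \<and> j \<le> k" using Suc that by simp
    then have "x' (Suc i) j \<in> lists B" using x' rnD by blast
    then show ?case using Suc by (simp add: po_Suc)
  qed
  have run: "\<exists>z. rn (q s j) (concat (map (\<lambda>i. u i j) [Suc s..<Suc s'])) z (q s' j) \<and> po s' j = po s j @ z"
    if "s \<le> s'" "s' \<le> k" "j \<le> k" for s s' j
    using that(1,2)
  proof (induction s' rule: dec_induct)
    case base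
    then show ?case using q_states[of s j] that by simp
  next
    case (step n)
    then obtain z where z: "rn (q s j) (concat (map (\<lambda>i. u i j) [Suc s..<Suc n])) z (q n j)"
      "po n j = po s j @ z" by auto
    have "1 \<le> Suc n \<and> Suc n \<le> k \<and> j \<le> k" using step that by simp
    then have "rn (q n j) (u (Suc n) j) (x' (Suc n) j) (q (Suc n) j)" using x' by fastforce
    then have "rn (q s j) (concat (map (\<lambda>i. u i j) [Suc s..<Suc n]) @ u (Suc n) j)
        (z @ x' (Suc n) j) (q (Suc n) j)"
      using z(1) unfolding rn_append by blast
    moreover have "concat (map (\<lambda>i. u i j) [Suc s..<Suc (Suc n)]) =
        concat (map (\<lambda>i. u i j) [Suc s..<Suc n]) @ u (Suc n) j"
      using step by simp
    ultimately show ?case using z(2) by (intro exI[of _ "z @ x' (Suc n) j"]) (simp add: po_Suc)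
  qed
  define share where "share s j j' \<longleftrightarrow> (\<forall>i'\<in>{1..s}. u i' j = u i' j' \<and> v i' j = v i' j')" for s j j'
  have "branching (sum (\<lambda>_. 1) {..k}) ((\<lambda>j. (q 0 j, po 0 j)) ` {..k})"
  \<comment> \<open>With the identity as labelling every run is a fibre of count 1. Here sharing is
    a real condition: equal words and loop words up to the level.\<close>
  proof (rule levels_branching[where cf = "\<lambda>i j. (q i j, po i j)" and J = "{..k}" and f = "\<lambda>j. j"
        and share = share and N = k and \<Lambda> = "{1..k}" and pos = "\<lambda>i. i" and lp = y'])
    show "\<And>s s' j j'. s \<le> s' \<Longrightarrow> share s' j j' \<Longrightarrow> share s j j'" by (auto simp: share_def)
    show "\<exists>w. \<forall>j\<in>K. (q s' j, po s' j) \<in> post {(q s j, po s j)} w"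
      if s: "s \<le> s'" "s' \<le> k" and K: "K \<subseteq> {..k}" and sh: "\<forall>j\<in>K. \<forall>j'\<in>K. share s' j j'" for s s' K
    proof (cases "K = {}")
      case False
      then obtain j0 where j0: "j0 \<in> K" by auto
      have "(q s' j, po s' j) \<in> post {(q s j, po s j)} (concat (map (\<lambda>i. u i j0) [Suc s..<Suc s']))"
        if jK: "j \<in> K" for j
      proof -
        have jk: "j \<le> k" using jK K by auto
        have eq: "map (\<lambda>i. u i j0) [Suc s..<Suc s'] = map (\<lambda>i. u i j) [Suc s..<Suc s']"
        proof (rule map_cong[OF refl])
          fix i assume "i \<in> set [Suc s..<Suc s']"
          moreover have "share s' j0 j" using sh jK j0 by blast
          ultimately show "u i j0 = u i j" unfolding share_def by auto
        qed
        obtain z where z: "rn (q s j) (concat (map (\<lambda>i. u i j) [Suc s..<Suc s'])) z (q s' j)"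
          "po s' j = po s j @ z"
          using run[OF s jk] by blast
        have "(q s' j, po s j @ z) \<in> post {(q s j, po s j)} (concat (map (\<lambda>i. u i j) [Suc s..<Suc s']))"
          by (rule postI[OF _ z(1)]) simp
        then show ?thesis by (simp only: z(2) eq)
      qed
      then show ?thesis by blast
    qed simp
    show "\<exists>w. \<forall>j\<in>K. rn (fst (q i j, po i j)) w (y' i j) (fst (q i j, po i j))"
      if i: "i \<in> {1..k}" and K: "K \<subseteq> {..k}" and sh: "\<forall>j\<in>K. \<forall>j'\<in>K. share i j j'" for i K
    proof (cases "K = {}")
      case False
      then obtain j0 where j0: "j0 \<in> K" by auto
      have "rn (q i j) (v i j0) (y' i j) (q i j)" if "j \<in> K" for j
      proof -
        have "share i j0 j" using sh that j0 by blast
        then have "v i j0 = v i j" using i unfolding share_def by simp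
        then show ?thesis using x' i that K by auto
      qed
      then show ?thesis by auto
    qed simp
    show "branching 1 ((\<lambda>j. (q k j, po k j)) ` {j \<in> {..k}. j = c})" if "c \<in> {..k}" for c
      by (rule one[of "(q k c, po k c)"]) (use that in auto)
    show "\<exists>i\<in>{1..k}. 0 \<le> i \<and> i \<le> k \<and> share i j j' \<and>
        dly (snd (q i j, po i j) @ y' i j) (snd (q i j', po i j') @ y' i j')
        \<noteq> dly (snd (q i j, po i j)) (snd (q i j', po i j'))"
      if j: "j \<in> {..k}" "j' \<in> {..k}" "j \<noteq> j'" for j j'
    proof -
      from no j obtain i where i: "i \<in> {1..k}" "share i j j'"
        "delay (free_group B) (prefix_output (free_group B) c x i j) (prefix_output (free_group B) c x i j') \<noteq>
              delay (free_group B) (prefix_output (free_group B) c x i j \<otimes>\<^bsub>free_group B\<^esub> y i j)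
                      (prefix_output (free_group B) c x i j' \<otimes>\<^bsub>free_group B\<^esub> y i j')"
        unfolding share_def by blast
      have ij: "i \<le> k" "1 \<le> i \<and> i \<le> k \<and> j \<le> k" "1 \<le> i \<and> i \<le> k \<and> j' \<le> k" using i(1) j by auto
      have y: "y i j = embed_word (y' i j)" "y i j' = embed_word (y' i j')"
        "y' i j \<in> lists B" "y' i j' \<in> lists B"
        using x' ij rnD by blast+
      have "po i j @ y' i j \<in> lists B" using po_lists[of i j] ij y(3) by simp
      then have "dly (po i j) (po i j') \<noteq> dly (po i j @ y' i j) (po i j' @ y' i j')"
        using i(3) po_lists[of i j] ij
        by (simp add: po y(1,2) delay_embed_word flip: embed_word_append[where B = B])
      then show ?thesis using i(1,2) by (intro bexI[of _ i]) auto
    qed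
  qed (auto simp: share_def)
  moreover have "(\<lambda>j. (q 0 j, po 0 j)) ` {..k} \<subseteq> t_init T" using c' by (auto simp: po_def)
  ultimately show ?thesis using branching_mono by simp
qed

text \<open>A trace lists, for each level, the word read, the configuration reached, the loop word and
  the loop output.\<close>

fun trace :: "'q \<times> 'b list \<Rightarrow> ('a list \<times> ('q \<times> 'b list) \<times> 'a list \<times> 'b list) list \<Rightarrow> bool" where
  "trace c [] \<longleftrightarrow> fst c \<in> states T"
| "trace c ((u, d, v, y) # ls) \<longleftrightarrow> d \<in> post {c} u \<and> rn (fst d) v y (fst d) \<and> trace d ls"

text \<open>The failure of the twinning condition for one pair of runs. The words agree up to and
  including the level of the separating loop and are free afterwards.\<close>

definition separated ::
  "('a list \<times> ('q \<times> 'b list) \<times> 'a list \<times> 'b list) list \<Rightarrow> ('a list \<times> ('q \<times> 'b list) \<times> 'a list \<times> 'b list) list \<Rightarrow> bool" where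
  "separated ls ls' \<longleftrightarrow> (\<exists>i. i < length ls \<and> i < length ls' \<and>
    (\<forall>i'\<le>i. fst (ls ! i') = fst (ls' ! i') \<and> fst (snd (snd (ls ! i'))) = fst (snd (snd (ls' ! i')))) \<and>
    (case (ls ! i, ls' ! i) of ((u, c, v, y), (u', d, v', z)) \<Rightarrow>
      dly (snd c @ y) (snd d @ z) \<noteq> dly (snd c) (snd d)))"

lemma separated_here:
  "dly (snd c @ y) (snd d @ z) \<noteq> dly (snd c) (snd d) \<Longrightarrow> separated ((u, c, v, y) # ls) ((u, d, v, z) # ls')"
  unfolding separated_def by (intro exI[of _ 0]) simp

lemma separated_later:
  assumes "separated ls ls'"
  shows "separated ((u, c, v, y) # ls @ rs) ((u, d, v, z) # ls' @ rs')"
proof -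
  obtain i where i: "i < length ls" "i < length ls'"
    "\<forall>i'\<le>i. fst (ls ! i') = fst (ls' ! i') \<and> fst (snd (snd (ls ! i'))) = fst (snd (snd (ls' ! i')))"
    "case (ls ! i, ls' ! i) of ((u, c, v, y), (u', d, v', z)) \<Rightarrow>
      dly (snd c @ y) (snd d @ z) \<noteq> dly (snd c) (snd d)"
    using assms unfolding separated_def by (elim exE conjE) (rule that)
  show ?thesis
    unfolding separated_def
  proof (intro exI[of _ "Suc i"] conjI allI impI)
    fix i' assume "i' \<le> Suc i"
    then show "fst (((u, c, v, y) # ls @ rs) ! i') = fst (((u, d, v, z) # ls' @ rs') ! i')"
      "fst (snd (snd (((u, c, v, y) # ls @ rs) ! i'))) = fst (snd (snd (((u, d, v, z) # ls' @ rs') ! i')))"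
      using i(1-3) by (cases i'; simp add: nth_append)+
  qed (use i in \<open>simp_all add: nth_append\<close>)
qed

text \<open>Stay in the last configuration, reading empty words; this gives all traces the same
  number of levels.\<close>

lemma trace_pad: "trace c ls \<Longrightarrow> \<exists>rs. length rs = n \<and> trace c (ls @ rs)"
proof (induction ls arbitrary: c)
  case Nil
  have "trace c (replicate n ([], c, [], []))"
    using Nil by (induction n) (auto simp: mem_post)
  then show ?case by (intro exI[of _ "replicate n ([], c, [], [])"]) simp
next
  case (Cons e ls)
  obtain u d v y where e: "e = (u, d, v, y)" by (cases e)
  then obtain rs where "length rs = n" "trace d (ls @ rs)"
    using Cons.IH[of d] Cons.prems by auto
  then show ?case using Cons.prems e by (intro exI[of _ rs]) simp
qed

text \<open>The sides of a split have \<open>n - 1\<close> and \<open>m - 1\<close> levels. Putting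
  the common root level in front and padding by \<open>m - 1\<close>, respectively
  \<open>n - 1\<close>, levels gives \<open>n + m - 1\<close> on both.\<close>

lemma branching_traces:
  "branching n S \<Longrightarrow> S \<subseteq> states T \<times> UNIV \<Longrightarrow> n > 0 \<Longrightarrow>
    \<exists>zs. length zs = n \<and> (\<forall>z\<in>set zs. fst z \<in> S \<and> trace (fst z) (snd z) \<and> Suc (length (snd z)) = n) \<and>
      sorted_wrt (\<lambda>z z'. separated (snd z) (snd z')) zs"
proof (induction rule: branching.induct)
  case (one c S)
  then show ?case by (intro exI[of _ "[(c, [])]"]) auto
next
  case (split n m X Y S u v)
  have "fst e \<in> states T \<times> UNIV" if "e \<in> X \<union> Y" for e
    using split.hyps(3)[of "fst e" "snd e"] that post_states by auto
  then have sub: "fst ` X \<subseteq> states T \<times> UNIV" "fst ` Y \<subseteq> states T \<times> UNIV" by blast+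
  let ?P = "\<lambda>Z z z'. fst z' \<in> S \<and> trace (fst z') (snd z') \<and> Suc (length (snd z')) = n + m \<and>
    (\<exists>y rs. (fst z, y) \<in> Z \<and> snd z' = (u, fst z, v, y) # snd z @ rs)"
  have extend: "\<exists>zs'. length zs' = length zs \<and> (\<forall>z'\<in>set zs'. \<exists>z. ?P Z z z') \<and>
      sorted_wrt (\<lambda>z z'. separated (snd z) (snd z')) zs'"
    if zs: "\<forall>z\<in>set zs. fst z \<in> fst ` Z \<and> trace (fst z) (snd z) \<and> Suc (length (snd z)) + l = n + m"
      "sorted_wrt (\<lambda>z z'. separated (snd z) (snd z')) zs" and Z: "Z \<subseteq> X \<union> Y" and l: "l > 0"
    for zs Z l
  proof -
    have "\<exists>z'. ?P Z z z'" if z: "z \<in> set zs" for z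
    proof -
      from z zs(1) obtain y where y: "(fst z, y) \<in> Z" by fastforce
      then have fz: "fst z \<in> post S u" "rn (fst (fst z)) v y (fst (fst z))"
        using split.hyps(3)[of "fst z" y] Z by auto
      obtain c where c: "c \<in> S" "fst z \<in> post {c} u" using post_singleE[OF fz(1)] by blast
      obtain rs where rs: "length rs = l - 1" "trace (fst z) (snd z @ rs)"
        using trace_pad z zs(1) by blast
      have len: "Suc (length (snd z)) + l = n + m" using z zs(1) by blast
      show ?thesis
        by (intro exI[of _ "(c, (u, fst z, v, y) # snd z @ rs)"])
          (use c fz rs y len l in auto)
    qed
    then have "\<forall>z\<in>set zs. \<exists>z'. ?P Z z z'" by (rule ballI)
    from bchoice[OF this] obtain f where f: "\<forall>z\<in>set zs. ?P Z z (f z)" ..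
    have "sorted_wrt (\<lambda>z z'. separated (snd (f z)) (snd (f z'))) zs"
    proof (rule sorted_wrt_mono_rel[OF _ zs(2)])
      fix z z' assume *: "z \<in> set zs" "z' \<in> set zs" "separated (snd z) (snd z')"
      obtain y rs where y: "snd (f z) = (u, fst z, v, y) # snd z @ rs" using f *(1) by blast
      obtain y' rs' where y': "snd (f z') = (u, fst z', v, y') # snd z' @ rs'" using f *(2) by blast
      show "separated (snd (f z)) (snd (f z'))" unfolding y y' by (rule separated_later[OF *(3)])
    qed
    then have "sorted_wrt (\<lambda>z z'. separated (snd z) (snd z')) (map f zs)"
      by (simp add: sorted_wrt_map)
    moreover have "\<forall>z'\<in>set (map f zs). \<exists>z. ?P Z z z'"
    proof
      fix z' assume "z' \<in> set (map f zs)"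
      then obtain z where "z \<in> set zs" "z' = f z" by auto
      then have "?P Z z z'" using f by simp
      then show "\<exists>z. ?P Z z z'" by (rule exI)
    qed
    ultimately show ?thesis by (intro exI[of _ "map f zs"] conjI) simp_all
  qed
  obtain xs where xs: "length xs = n"
    "\<forall>z\<in>set xs. fst z \<in> fst ` X \<and> trace (fst z) (snd z) \<and> Suc (length (snd z)) = n"
    "sorted_wrt (\<lambda>z z'. separated (snd z) (snd z')) xs"
    using split.IH(1)[OF sub(1) split.hyps(1)] by (elim exE conjE) (rule that)
  obtain ys where ys: "length ys = m"
    "\<forall>z\<in>set ys. fst z \<in> fst ` Y \<and> trace (fst z) (snd z) \<and> Suc (length (snd z)) = m"
    "sorted_wrt (\<lambda>z z'. separated (snd z) (snd z')) ys"
    using split.IH(2)[OF sub(2) split.hyps(2)] by (elim exE conjE) (rule that)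
  obtain xs' where xs': "length xs' = length xs" "\<forall>z'\<in>set xs'. \<exists>z. ?P X z z'"
      "sorted_wrt (\<lambda>z z'. separated (snd z) (snd z')) xs'"
    using extend[of xs X m] xs split.hyps(2) by auto
  obtain ys' where ys': "length ys' = length ys" "\<forall>z'\<in>set ys'. \<exists>z. ?P Y z z'"
      "sorted_wrt (\<lambda>z z'. separated (snd z) (snd z')) ys'"
    using extend[of ys Y n] ys split.hyps(1) by auto
  show ?case
  proof (intro exI[of _ "xs' @ ys'"] conjI)
    show "length (xs' @ ys') = n + m" using xs' ys' xs(1) ys(1) by simp
    show "\<forall>z\<in>set (xs' @ ys'). fst z \<in> S \<and> trace (fst z) (snd z) \<and> Suc (length (snd z)) = n + m"
      using xs'(2) ys'(2) by auto
    show "sorted_wrt (\<lambda>z z'. separated (snd z) (snd z')) (xs' @ ys')"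
      unfolding sorted_wrt_append
    proof (intro conjI ballI xs'(3) ys'(3))
      fix z z' assume "z \<in> set xs'" "z' \<in> set ys'"
      then obtain c y rs d y' rs' where *: "(c, y) \<in> X" "snd z = (u, c, v, y) # rs"
        "(d, y') \<in> Y" "snd z' = (u, d, v, y') # rs'"
        using xs'(2) ys'(2) by meson
      show "separated (snd z) (snd z')"
        unfolding *(2,4) by (rule separated_here[OF split.hyps(4)[OF *(1,3)]])
    qed
  qed
qed simp

lemma trace_nth:
  "trace c ls \<Longrightarrow> i < length ls \<Longrightarrow>
    fst (snd (ls ! i)) \<in> post {(c # map (fst \<circ> snd) ls) ! i} (fst (ls ! i)) \<and>
    rn (fst (fst (snd (ls ! i)))) (fst (snd (snd (ls ! i)))) (snd (snd (snd (ls ! i)))) (fst (fst (snd (ls ! i))))"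
proof (induction ls arbitrary: c i)
  case (Cons e ls)
  obtain u d v y where e: "e = (u, d, v, y)" by (cases e)
  show ?case
  proof (cases i)
    case 0
    then show ?thesis using Cons.prems e by simp
  next
    case (Suc i')
    then show ?thesis using Cons.IH[of d i'] Cons.prems e by simp
  qed
qed simp

lemma not_twinning_if_branching:
  assumes "branching (Suc k) (t_init T)"
  shows "\<not> branching_twinning_property k (free_group B) (map_weights embed_word T)"
proof
  assume btp: "branching_twinning_property k (free_group B) (map_weights embed_word T)"
  let ?W = "map_weights embed_word T"
  have "t_init T \<subseteq> states T \<times> UNIV" using t_init_subset by auto
  from branching_traces[OF assms this] obtain zs where zs: "length zs = Suc k"
    "\<forall>z\<in>set zs. fst z \<in> t_init T \<and> trace (fst z) (snd z) \<and> Suc (length (snd z)) = Suc k"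
    "sorted_wrt (\<lambda>z z'. separated (snd z) (snd z')) zs"
    by auto
  \<comment> \<open>Levels of the twinning property count from 1 and list entries from 0:
    \<open>cfg 0 j\<close> is the initial configuration, and level \<open>i\<close> is the entry
    \<open>i - 1\<close>.\<close>
  define cfg where "cfg i j = (fst (zs ! j) # map (fst \<circ> snd) (snd (zs ! j))) ! i" for i j
  define lev where "lev i j = snd (zs ! j) ! (i - 1)" for i j
  define u where "u i j = fst (lev i j)" for i j
  define v where "v i j = fst (snd (snd (lev i j)))" for i j
  define y where "y i j = snd (snd (snd (lev i j)))" for i j
  have z: "fst (zs ! j) \<in> t_init T" "trace (fst (zs ! j)) (snd (zs ! j))" "length (snd (zs ! j)) = k"
    if "j \<le> k" for j using zs(1,2) that by auto
  have cfg_lev: "cfg i j = fst (snd (lev i j))" if "i \<in> {1..k}" "j \<le> k" for i j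
    using that z(3) by (cases i) (auto simp: cfg_def lev_def)
  have step: "cfg i j \<in> post {cfg (i - 1) j} (u i j) \<and> rn (fst (cfg i j)) (v i j) (y i j) (fst (cfg i j))"
    if "i \<in> {1..k}" "j \<le> k" for i j
  proof -
    have "i - 1 < length (snd (zs ! j))" using that z(3)[OF that(2)] by auto
    from trace_nth[OF z(2)[OF that(2)] this] show ?thesis
      unfolding cfg_lev[OF that] by (simp add: cfg_def u_def v_def y_def lev_def)
  qed
  have "\<exists>x. rn (fst (cfg (i - 1) j)) (u i j) x (fst (cfg i j)) \<and> snd (cfg i j) = snd (cfg (i - 1) j) @ x"
    if ij: "i \<in> {1..k}" "j \<le> k" for i j
  proof -
    obtain p r x0 x where *: "cfg i j = (p, x0 @ x)" "(r, x0) \<in> {cfg (i - 1) j}" "rn r (u i j) x p"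
      using step[OF ij] by (blast elim: postE)
    from *(2) have "cfg (i - 1) j = (r, x0)" by simp
    then show ?thesis using *(1,3) by (intro exI[of _ x]) simp
  qed
  then have "\<forall>i j. \<exists>x. i \<in> {1..k} \<and> j \<le> k \<longrightarrow>
    rn (fst (cfg (i - 1) j)) (u i j) x (fst (cfg i j)) \<and> snd (cfg i j) = snd (cfg (i - 1) j) @ x"
    by simp
  then obtain x where x: "\<forall>i j. i \<in> {1..k} \<and> j \<le> k \<longrightarrow>
    rn (fst (cfg (i - 1) j)) (u i j) (x i j) (fst (cfg i j)) \<and> snd (cfg i j) = snd (cfg (i - 1) j) @ x i j"
    unfolding choice_iff by (elim exE)
  have po: "snd (cfg 0 j) @ concat (map (\<lambda>i. x i j) [1..<Suc i]) = snd (cfg i j)" if "i \<le> k" "j \<le> k" for i j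
    using that(1)
  proof (induction i)
    case (Suc i)
    have "Suc i \<in> {1..k}" using Suc by simp
    then have "snd (cfg (Suc i) j) = snd (cfg (Suc i - 1) j) @ x (Suc i) j" using x that(2) by blast
    then show ?case using Suc by simp
  qed simp
  let ?c = "\<lambda>j. embed_word (snd (cfg 0 j))" and ?x = "\<lambda>i j. embed_word (x i j)"
  have pref: "prefix_output (free_group B) ?c ?x i j = embed_word (snd (cfg i j))" if "i \<le> k" "j \<le> k" for i j
    using prefix_output_embed_word[of ?c j "snd (cfg 0 j)" i ?x "\<lambda>i. x i j"] po[OF that] by simp
  have lists: "snd (cfg i j) \<in> lists B" if "i \<le> k" "j \<le> k" for i j
    using that(1)
  proof (induction i)
    case 0
    then show ?case using z(1)[OF that(2)] t_init_subset(1) by (auto simp: cfg_def)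
  next
    case (Suc i)
    have i: "Suc i \<in> {1..k}" using Suc by simp
    then have "rn (fst (cfg i j)) (u (Suc i) j) (x (Suc i) j) (fst (cfg (Suc i) j))"
      "snd (cfg (Suc i) j) = snd (cfg i j) @ x (Suc i) j"
      using x that(2) by fastforce+
    then show ?case using Suc rnD by simp
  qed
  have "\<exists>j\<le>k. \<exists>j'\<le>k. j \<noteq> j' \<and>
     (\<forall>i\<in>{1..k}. (\<forall>i'\<in>{1..i}. u i' j = u i' j' \<and> v i' j = v i' j') \<longrightarrow>
        delay (free_group B) (prefix_output (free_group B) ?c ?x i j) (prefix_output (free_group B) ?c ?x i j') =
        delay (free_group B) (prefix_output (free_group B) ?c ?x i j \<otimes>\<^bsub>free_group B\<^esub> embed_word (y i j))
                (prefix_output (free_group B) ?c ?x i j' \<otimes>\<^bsub>free_group B\<^esub> embed_word (y i j')))"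
  proof (rule btp[unfolded branching_twinning_property_def, rule_format, where q = "\<lambda>i j. fst (cfg i j)"], intro conjI allI impI ballI)
    fix j assume "j \<le> k"
    then show "(fst (cfg 0 j), embed_word (snd (cfg 0 j))) \<in> t_init ?W"
      using z(1) unfolding t_init_map_weights by (auto simp: cfg_def)
  next
    fix i j assume "i \<in> {1..k}" "j \<le> k"
    then show "run (free_group B) ?W (fst (cfg (i - 1) j)) (u i j) (embed_word (x i j)) (fst (cfg i j))"
      "run (free_group B) ?W (fst (cfg i j)) (v i j) (embed_word (y i j)) (fst (cfg i j))"
      using x step unfolding run_map_weights by blast+
  qed
  then obtain j j' where j: "j \<le> k" "j' \<le> k" "j \<noteq> j'" and
    same: "\<forall>i\<in>{1..k}. (\<forall>i'\<in>{1..i}. u i' j = u i' j' \<and> v i' j = v i' j') \<longrightarrow>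
        delay (free_group B) (prefix_output (free_group B) ?c ?x i j) (prefix_output (free_group B) ?c ?x i j') =
        delay (free_group B) (prefix_output (free_group B) ?c ?x i j \<otimes>\<^bsub>free_group B\<^esub> embed_word (y i j))
                (prefix_output (free_group B) ?c ?x i j' \<otimes>\<^bsub>free_group B\<^esub> embed_word (y i j'))"
    by (elim exE conjE) (rule that)
  have same': "dly (snd (cfg i j) @ y i j) (snd (cfg i j') @ y i j') = dly (snd (cfg i j)) (snd (cfg i j'))"
    if i: "i \<in> {1..k}" and w: "\<forall>i'\<in>{1..i}. u i' j = u i' j' \<and> v i' j = v i' j'" for i
  proof -
    have "y i j \<in> lists B" using step[OF i j(1)] rnD by blast
    then have "snd (cfg i j) @ y i j \<in> lists B" using lists[of i j] i j by simp
    then show ?thesis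
      using same[rule_format, OF i w[rule_format]] i j lists[of i j]
      by (simp add: pref delay_embed_word flip: embed_word_append[where B = B])
  qed
  \<comment> \<open>The sorted list separates pairs in increasing order only, so the indices are
    taken in order and \<open>dly_sym\<close> covers the swapped case.\<close>
  have False if jj: "a < b" "b \<le> k" "{a, b} = {j, j'}" for a b
  proof -
    have "separated (snd (zs ! a)) (snd (zs ! b))"
      using zs(1,3) jj by (simp add: sorted_wrt_iff_nth_less)
    then obtain i where i: "i < length (snd (zs ! a))"
      "\<forall>i'\<le>i. fst (snd (zs ! a) ! i') = fst (snd (zs ! b) ! i') \<and>
        fst (snd (snd (snd (zs ! a) ! i'))) = fst (snd (snd (snd (zs ! b) ! i')))"
      "case (snd (zs ! a) ! i, snd (zs ! b) ! i) of ((u, c, v, y), (u', d, v', z)) \<Rightarrow>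
        dly (snd c @ y) (snd d @ z) \<noteq> dly (snd c) (snd d)"
      unfolding separated_def by (elim exE conjE) (rule that)
    have ik: "Suc i \<in> {1..k}" using i(1) z(3) jj by simp
    have "\<forall>i'\<in>{1..Suc i}. u i' a = u i' b \<and> v i' a = v i' b"
    proof
      fix i' assume "i' \<in> {1..Suc i}"
      then have "i' - 1 \<le> i" by auto
      then show "u i' a = u i' b \<and> v i' a = v i' b"
        using i(2) unfolding u_def v_def lev_def by blast
    qed
    moreover have "dly (snd (cfg (Suc i) a) @ y (Suc i) a) (snd (cfg (Suc i) b) @ y (Suc i) b) \<noteq>
        dly (snd (cfg (Suc i) a)) (snd (cfg (Suc i) b))"
      using i(3) jj cfg_lev[OF ik, of a] cfg_lev[OF ik, of b]
      by (simp add: y_def lev_def split_beta)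
    moreover have "a = j \<and> b = j' \<or> a = j' \<and> b = j" using jj(3) by (simp add: doubleton_eq_iff)
    ultimately show False
      using same'[OF ik] dly_sym[OF same'[OF ik]] by (elim disjE) auto
  qed
  from this[of j j'] this[of j' j] j show False by (cases "j < j'") auto
qed

end

section \<open>Unions of sequential automata\<close>

lemma run_mono:
  assumes "states V \<subseteq> states W" "transitions V \<subseteq> transitions W"
  shows "run M V p w x q \<Longrightarrow> run M W p w x q"
  using assms by (induction w arbitrary: p x) (auto simp: run_Nil run_Cons, blast)

text \<open>The ends of a transition lie in one component and the components are disjoint, so a run
  of the union never changes component.\<close>

lemma semantics_disjoint_union:
  assumes V: "\<And>i. i < k \<Longrightarrow> weighted_automaton A (free_monoid B) (V i)"
    and disj: "\<And>i j. i < k \<Longrightarrow> j < k \<Longrightarrow> i \<noteq> j \<Longrightarrow> states (V i) \<inter> states (V j) = {}"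
    and W: "states W = (\<Union>i<k. states (V i))" "t_init W = (\<Union>i<k. t_init (V i))"
      "t_final W = (\<Union>i<k. t_final (V i))" "transitions W = (\<Union>i<k. transitions (V i))"
  shows "semantics (free_monoid B) W = (\<Union>i<k. semantics (free_monoid B) (V i))"
proof -
  have unique: "i = j" if "p \<in> states (V i)" "p \<in> states (V j)" "i < k" "j < k" for p i j
    using disj that by blast
  have tr: "p \<in> states (V i) \<and> r \<in> states (V i)" if "(p, a, y, r) \<in> transitions (V i)" "i < k" for p a y r i
    using V[OF that(2)] that(1) by (auto simp: weighted_automaton_def)
  have run: "run (free_monoid B) (V i) p w x q \<and> q \<in> states (V i)"
    if "run (free_monoid B) W p w x q" "p \<in> states (V i)" "i < k" for p w x q i
    using that(1,2)
  proof (induction w arbitrary: p x)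
    case Nil
    then show ?case by (auto simp: run_Nil)
  next
    case (Cons a w)
    then obtain y r z where *: "(p, a, y, r) \<in> transitions W" "run (free_monoid B) W r w z q"
      "x = y \<otimes>\<^bsub>free_monoid B\<^esub> z"
      unfolding run_Cons by blast
    then obtain j where "j < k" "(p, a, y, r) \<in> transitions (V j)" using W by auto
    moreover from this have "j = i" using tr unique Cons.prems(2) that(3) by blast
    ultimately have "(p, a, y, r) \<in> transitions (V i)" "r \<in> states (V i)" using tr by blast+
    then show ?case using Cons.IH[OF *(2)] *(3) unfolding run_Cons by blast
  qed
  have init: "p \<in> states (V i)" if "(p, x) \<in> t_init (V i)" "i < k" for p x i
    using V[OF that(2)] that(1) by (auto simp: weighted_automaton_def)
  have fin: "p \<in> states (V i)" if "(p, x) \<in> t_final (V i)" "i < k" for p x i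
    using V[OF that(2)] that(1) by (auto simp: weighted_automaton_def)
  have "(w, y) \<in> semantics (free_monoid B) W \<longleftrightarrow> (\<exists>i<k. (w, y) \<in> semantics (free_monoid B) (V i))" for w y
  proof
    assume "(w, y) \<in> semantics (free_monoid B) W"
    then obtain p x q x' z where *: "(p, x) \<in> t_init W" "run (free_monoid B) W p w x' q"
      "(q, z) \<in> t_final W" "y = (x @ x') @ z"
      unfolding mem_semantics by blast
    then obtain i j where ij: "i < k" "(p, x) \<in> t_init (V i)" "j < k" "(q, z) \<in> t_final (V j)"
      using W by auto
    have r: "run (free_monoid B) (V i) p w x' q \<and> q \<in> states (V i)"
      using run[OF *(2) init[OF ij(2,1)] ij(1)] .
    then have "j = i" using unique fin[OF ij(4,3)] ij by blast
    then show "\<exists>i<k. (w, y) \<in> semantics (free_monoid B) (V i)"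
      using ij r *(4) unfolding mem_semantics by blast
  next
    assume "\<exists>i<k. (w, y) \<in> semantics (free_monoid B) (V i)"
    then obtain i p x q x' z where i: "i < k" and *: "(p, x) \<in> t_init (V i)"
      "run (free_monoid B) (V i) p w x' q" "(q, z) \<in> t_final (V i)" "y = (x @ x') @ z"
      unfolding mem_semantics by blast
    have "run (free_monoid B) W p w x' q" by (rule run_mono[OF _ _ *(2)]) (use W i in auto)
    moreover have "(p, x) \<in> t_init W" "(q, z) \<in> t_final W" using W i * by auto
    ultimately show "(w, y) \<in> semantics (free_monoid B) W"
      using *(4) unfolding mem_semantics by blast
  qed
  then show ?thesis by auto
qed

lemma run_deterministic:
  assumes "sequential W"
  shows "run M W p w x q \<Longrightarrow> run M W p w x' q' \<Longrightarrow> x = x' \<and> q = q'"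
proof (induction w arbitrary: p x x')
  case Nil
  then show ?case by (auto simp: run_Nil)
next
  case (Cons a w)
  from Cons.prems(1) obtain y r z where 1: "(p, a, y, r) \<in> transitions W" "run M W r w z q" "x = y \<otimes>\<^bsub>M\<^esub> z"
    unfolding run_Cons by blast
  from Cons.prems(2) obtain y' r' z' where 2: "(p, a, y', r') \<in> transitions W" "run M W r' w z' q'"
    "x' = y' \<otimes>\<^bsub>M\<^esub> z'"
    unfolding run_Cons by blast
  have "y = y' \<and> r = r'" using assms 1(1) 2(1) unfolding sequential_def by blast
  then show ?case using Cons.IH[of r z z'] 1 2 by blast
qed

section \<open>Sequential automata, residual functions and the Lipschitz property\<close>

context transducer
begin

text \<open>On the common prefix of the inputs determinism forces both runs to coincide. After it
  each writes at most \<open>M\<close> letters per input letter and \<open>E\<close> at the end,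
  which gives the constant \<open>M + 2 * E\<close>.\<close>

lemma sequential_lipschitz:
  assumes "sequential T"
  obtains L where "\<And>w y w' y'. (w, y) \<in> semantics (free_monoid B) T \<Longrightarrow>
    (w', y') \<in> semantics (free_monoid B) T \<Longrightarrow> word_dist y y' \<le> L * (word_dist w w' + 1)"
proof -
  obtain M where M: "\<And>p a y q. (p, a, y, q) \<in> transitions T \<Longrightarrow> length y \<le> M"
    using weight_bound by blast
  have len: "length x \<le> M * length w" if "rn p w x q" for p w x q
    using that
  proof (induction w arbitrary: p x)
    case (Cons a w)
    then obtain y r z where "(p, a, y, r) \<in> transitions T" "rn r w z q" "x = y @ z"
      unfolding rn_Cons by blast
    then show ?case using Cons.IH[of r z] M[of p a y r] by simp
  qed simp
  have "finite ((\<lambda>(q, z). length z) ` t_final T)"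
    using wa by (simp add: weighted_automaton_def)
  then obtain E where E: "\<forall>e\<in>(\<lambda>(q, z). length z) ` t_final T. e \<le> E"
    using finite_nat_set_iff_bounded_le by blast
  have "card (t_init T) = 1" using assms by (simp add: sequential_def)
  then obtain i where i: "t_init T = {i}" by (auto simp: card_1_singleton_iff)
  show ?thesis
  proof (rule that[of "M + 2 * E"])
    fix w y w' y'
    assume "(w, y) \<in> semantics (free_monoid B) T" "(w', y') \<in> semantics (free_monoid B) T"
    then obtain q x z q' x' z' where
      1: "rn (fst i) w x q" "(q, z) \<in> t_final T" "y = (snd i @ x) @ z" and
      2: "rn (fst i) w' x' q'" "(q', z') \<in> t_final T" "y' = (snd i @ x') @ z'"
      unfolding mem_semantics i by force
    obtain c r r' where w: "w = c @ r" "w' = c @ r'" "longest_common_prefix w w' = c"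
      by (rule longest_common_prefix_decomp)
    obtain x1 p x2 where x: "rn (fst i) c x1 p" "rn p r x2 q" "x = x1 @ x2"
      using 1(1) unfolding w(1) rn_append by blast
    obtain x1' p' x2' where x': "rn (fst i) c x1' p'" "rn p' r' x2' q'" "x' = x1' @ x2'"
      using 2(1) unfolding w(2) rn_append by blast
    have same: "x1' = x1" using run_deterministic[OF assms x(1) x'(1)] by simp
    have "word_dist y y' = word_dist ((snd i @ x1) @ (x2 @ z)) ((snd i @ x1) @ (x2' @ z'))"
      unfolding 1(3) 2(3) x(3) x'(3) same by simp
    also have "\<dots> = word_dist (x2 @ z) (x2' @ z')" by (simp only: word_dist_append_left)
    also have "\<dots> \<le> length x2 + length z + (length x2' + length z')"
      using word_dist_le_length[of "x2 @ z" "x2' @ z'"] by simp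
    also have "\<dots> \<le> M * length r + E + (M * length r' + E)"
      using len[OF x(2)] len[OF x'(2)] E 1(2) 2(2) by (intro add_mono) force+
    also have "\<dots> = M * (length r + length r') + 2 * E" by (simp add: algebra_simps)
    also have "\<dots> \<le> (M + 2 * E) * (length r + length r' + 1)" by (simp add: algebra_simps)
    also have "length r + length r' = word_dist w w'"
      unfolding word_dist_def w(3) using w(1,2) by simp
    finally show "word_dist y y' \<le> (M + 2 * E) * (word_dist w w' + 1)" .
  qed
qed

lemma semantics_lists: "(w, y) \<in> semantics (free_monoid B) T \<Longrightarrow> w \<in> lists A \<and> y \<in> lists B"
proof -
  assume "(w, y) \<in> semantics (free_monoid B) T"
  then obtain p x q x' z where *: "(p, x) \<in> t_init T" "rn p w x' q"
      "(q, z) \<in> t_final T" "y = (x @ x') @ z"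
    unfolding mem_semantics by blast
  have "x \<in> lists B" "z \<in> lists B"
    using wa *(1,3) by (auto simp: weighted_automaton_def free_monoid_def)
  then show ?thesis using rnD[OF *(2)] *(4) by simp
qed

text \<open>The residuals, coded as numbers, become the states. The injection \<open>c\<close>
  confines the codes to a prescribed range, so that several such automata can be made
  disjoint.\<close>

lemma seq_fun_automaton:
  fixes c :: "nat \<Rightarrow> nat"
  assumes "seq_fun f" "inj c"
  obtains W :: "(nat, 'a, 'b list) wa" where "weighted_automaton A (free_monoid B) W" "sequential W"
    "states W \<subseteq> range c" "semantics (free_monoid B) W = {(w, y). w \<in> lists A \<and> y \<in> f w}"
proof -
  obtain F h g0 where F: "finite F" "residual_closed F" "h \<in> lists B" "g0 \<in> F"
    and f: "\<forall>w\<in>lists A. f w = (@) h ` g0 w"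
    using assms(1) unfolding seq_fun_def by (elim exE conjE) (rule that)
  obtain e :: "_ \<Rightarrow> nat" where e: "inj_on e F"
    using finite_imp_inj_to_nat_seg[OF F(1)] by blast
  define code where "code = c \<circ> e"
  have code: "code g = code g' \<longleftrightarrow> g = g'" if "g \<in> F" "g' \<in> F" for g g'
    using e assms(2) that by (auto simp: code_def inj_on_def)
  have "\<forall>g a. \<exists>h' g'. g \<in> F \<and> a \<in> A \<longrightarrow> h' \<in> lists B \<and> g' \<in> F \<and> (\<forall>w\<in>lists A. g (a # w) = (@) h' ` g' w)"
    using F(2) unfolding residual_closed_def by (metis (no_types, lifting))
  then obtain hh nn where hn: "\<forall>g a. g \<in> F \<and> a \<in> A \<longrightarrow>
      hh g a \<in> lists B \<and> nn g a \<in> F \<and> (\<forall>w\<in>lists A. g (a # w) = (@) (hh g a) ` nn g a w)"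
    unfolding choice_iff by (elim exE)
  define W :: "(nat, 'a, 'b list) wa" where "W = \<lparr>states = code ` F, t_init = {(code g0, h)},
    t_final = (\<Union>g\<in>F. Pair (code g) ` g []),
    transitions = (\<lambda>(g, a). (code g, a, hh g a, code (nn g a))) ` (F \<times> A)\<rparr>"
  have fin: "finite (g [])" "g [] \<subseteq> lists B" if "g \<in> F" for g
    using F(2) that unfolding residual_closed_def by blast+
  have wf: "weighted_automaton A (free_monoid B) W"
  proof -
    have "t_final W \<subseteq> states W \<times> lists B" using fin(2) unfolding W_def wa.simps by blast
    moreover have "transitions W \<subseteq> states W \<times> A \<times> lists B \<times> states W"
    proof
      fix t assume "t \<in> transitions W"
      then obtain g a where *: "g \<in> F" "a \<in> A" "t = (code g, a, hh g a, code (nn g a))"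
        by (auto simp: W_def)
      then have "hh g a \<in> lists B" "nn g a \<in> F" using hn by simp_all
      then show "t \<in> states W \<times> A \<times> lists B \<times> states W" using * by (simp add: W_def)
    qed
    moreover have "t_init W \<subseteq> states W \<times> lists B" using F(3,4) by (simp add: W_def)
    moreover have "finite (states W)" "finite (t_init W)" "finite (t_final W)" "finite (transitions W)"
      using F(1) finite_A fin(1) by (simp_all add: W_def)
    ultimately show ?thesis by (simp add: weighted_automaton_def free_monoid_def)
  qed
  have tr: "(code g, a, y, r) \<in> transitions W \<longleftrightarrow> a \<in> A \<and> y = hh g a \<and> r = code (nn g a)"
    if "g \<in> F" for g a y r
    using that code by (auto simp: W_def)
  have seq: "sequential W"
    unfolding sequential_def
  proof (intro conjI allI impI)
    show "card (t_init W) = 1" by (simp add: W_def)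
    fix p a x q x' q'
    assume *: "(p, a, x, q) \<in> transitions W \<and> (p, a, x', q') \<in> transitions W"
    then obtain g where "g \<in> F" "p = code g" by (auto simp: W_def)
    with * tr[OF \<open>g \<in> F\<close>] show "x = x'" "q = q'" by simp_all
  qed
  \<comment> \<open>The state coding \<open>g\<close> computes \<open>g\<close>; the initial output
    \<open>h\<close> is added afterwards.\<close>
  have sem: "(\<exists>x q z. run (free_monoid B) W (code g) w x q \<and> (q, z) \<in> t_final W \<and> y = x @ z) \<longleftrightarrow>
      w \<in> lists A \<and> y \<in> g w" if "g \<in> F" for g w y
    using that
  proof (induction w arbitrary: g y)
    case Nil
    have "(code g, z) \<in> t_final W \<longleftrightarrow> z \<in> g []" for z
      using Nil code by (auto simp: W_def)
    moreover have "code g \<in> states W" using Nil by (simp add: W_def)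
    ultimately show ?case by (simp add: run_Nil free_monoid_def)
  next
    case (Cons a w)
    have "(\<exists>x q z. run (free_monoid B) W (code g) (a # w) x q \<and> (q, z) \<in> t_final W \<and> y = x @ z) \<longleftrightarrow>
      a \<in> A \<and> (\<exists>y'. y = hh g a @ y' \<and>
        (\<exists>x q z. run (free_monoid B) W (code (nn g a)) w x q \<and> (q, z) \<in> t_final W \<and> y' = x @ z))"
      (is "?L \<longleftrightarrow> ?R")
    proof
      assume ?L
      then obtain x q z where *: "run (free_monoid B) W (code g) (a # w) x q" "(q, z) \<in> t_final W" "y = x @ z"
        by blast
      from *(1) obtain x' where "a \<in> A" "x = hh g a @ x'" "run (free_monoid B) W (code (nn g a)) w x' q"
        unfolding run_Cons tr[OF Cons.prems] mult_free_monoid by blast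
      moreover from this(2) have "y = hh g a @ (x' @ z)" using *(3) by simp
      ultimately show ?R using *(2) by blast
    next
      assume ?R
      then obtain x q z where *: "a \<in> A" "run (free_monoid B) W (code (nn g a)) w x q"
        "(q, z) \<in> t_final W" "y = hh g a @ (x @ z)"
        by blast
      then have "run (free_monoid B) W (code g) (a # w) (hh g a @ x) q"
        unfolding run_Cons tr[OF Cons.prems] mult_free_monoid by blast
      moreover have "y = (hh g a @ x) @ z" using *(4) by simp
      ultimately show ?L using *(3) by blast
    qed
    also have "\<dots> \<longleftrightarrow> a \<in> A \<and> (\<exists>y'. y = hh g a @ y' \<and> w \<in> lists A \<and> y' \<in> nn g a w)"
    proof (cases "a \<in> A")
      case True
      then have "nn g a \<in> F" using hn Cons.prems by blast
      from Cons.IH[OF this] show ?thesis by (simp only:)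
    qed simp
    also have "\<dots> \<longleftrightarrow> a # w \<in> lists A \<and> y \<in> g (a # w)"
    proof (cases "a \<in> A \<and> w \<in> lists A")
      case True
      then have "g (a # w) = (@) (hh g a) ` nn g a w" using hn Cons.prems by blast
      then show ?thesis using True by auto
    qed auto
    finally show ?case .
  qed
  have "semantics (free_monoid B) W = {(w, y). w \<in> lists A \<and> y \<in> f w}"
  proof -
    have "(w, y) \<in> semantics (free_monoid B) W \<longleftrightarrow> (\<exists>y'. y = h @ y' \<and>
        (\<exists>x q z. run (free_monoid B) W (code g0) w x q \<and> (q, z) \<in> t_final W \<and> y' = x @ z))" for w y
    proof -
      have init: "(p, x) \<in> t_init W \<longleftrightarrow> p = code g0 \<and> x = h" for p x by (simp add: W_def)
      show ?thesis unfolding mem_semantics init append_assoc by blast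
    qed
    then have "(w, y) \<in> semantics (free_monoid B) W \<longleftrightarrow> w \<in> lists A \<and> y \<in> (@) h ` g0 w" for w y
      unfolding sem[OF F(4)] by blast
    then have "(w, y) \<in> semantics (free_monoid B) W \<longleftrightarrow> w \<in> lists A \<and> y \<in> f w" for w y
      using f by (cases "w \<in> lists A") (simp_all del: in_lists_conv_set)
    then show ?thesis by (simp add: set_eq_iff)
  qed
  moreover have "states W \<subseteq> range c" by (auto simp: W_def code_def)
  ultimately show ?thesis using that wf seq by blast
qed

lemma positive_k_sequential_if_multi_seq:
  assumes "multi_seq k (rel (t_init T))"
  shows "positive_k_sequential k A B (semantics (free_monoid B) T)"
proof -
  obtain F where F: "\<forall>i<k. seq_fun (F i)" "\<forall>w\<in>lists A. rel (t_init T) w = (\<Union>i<k. F i w)"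
    using assms unfolding multi_seq_def by blast
  \<comment> \<open>The component number is part of the code, which makes the state sets
    disjoint.\<close>
  define c where "c i n = prod_encode (i, n)" for i n
  have inj: "inj (c i)" for i by (simp add: c_def inj_on_def prod_encode_eq)
  have "\<exists>W :: (nat, 'a, 'b list) wa. weighted_automaton A (free_monoid B) W \<and> sequential W \<and>
    states W \<subseteq> range (c i) \<and> semantics (free_monoid B) W = {(w, y). w \<in> lists A \<and> y \<in> F i w}"
    if "i < k" for i
  proof -
    have "seq_fun (F i)" using F(1) that by blast
    then show ?thesis by (rule seq_fun_automaton[OF _ inj]) blast
  qed
  then have "\<forall>i. \<exists>W :: (nat, 'a, 'b list) wa. i < k \<longrightarrow> weighted_automaton A (free_monoid B) W \<and> sequential W \<and>
    states W \<subseteq> range (c i) \<and> semantics (free_monoid B) W = {(w, y). w \<in> lists A \<and> y \<in> F i w}"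
    by blast
  then obtain V :: "nat \<Rightarrow> (nat, 'a, 'b list) wa" where
    V: "\<forall>i. i < k \<longrightarrow> weighted_automaton A (free_monoid B) (V i) \<and> sequential (V i) \<and>
    states (V i) \<subseteq> range (c i) \<and> semantics (free_monoid B) (V i) = {(w, y). w \<in> lists A \<and> y \<in> F i w}"
    unfolding choice_iff by (elim exE)
  have disj: "states (V i) \<inter> states (V j) = {}" if "i < k" "j < k" "i \<noteq> j" for i j
  proof -
    have "range (c i) \<inter> range (c j) = {}" using that(3) by (auto simp: c_def prod_encode_eq)
    moreover have "states (V i) \<subseteq> range (c i)" "states (V j) \<subseteq> range (c j)" using V that by simp_all
    ultimately show ?thesis by blast
  qed
  define W where "W = \<lparr>states = (\<Union>i<k. states (V i)), t_init = (\<Union>i<k. t_init (V i)),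
    t_final = (\<Union>i<k. t_final (V i)), transitions = (\<Union>i<k. transitions (V i))\<rparr>"
  have "weighted_automaton A (free_monoid B) W"
  proof -
    have fin: "finite (states (V i))" "finite (t_init (V i))" "finite (t_final (V i))" "finite (transitions (V i))"
      and sub: "t_init (V i) \<subseteq> states (V i) \<times> lists B" "t_final (V i) \<subseteq> states (V i) \<times> lists B"
        "transitions (V i) \<subseteq> states (V i) \<times> A \<times> lists B \<times> states (V i)"
      if "i < k" for i
      using V that by (simp_all add: weighted_automaton_def free_monoid_def)
    have "t_init W \<subseteq> states W \<times> lists B" using sub(1) unfolding W_def wa.simps by blast
    moreover have "t_final W \<subseteq> states W \<times> lists B" using sub(2) unfolding W_def wa.simps by blast
    moreover have "transitions W \<subseteq> states W \<times> A \<times> lists B \<times> states W"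
      using sub(3) unfolding W_def wa.simps by blast
    moreover have "finite (states W)" "finite (t_init W)" "finite (t_final W)" "finite (transitions W)"
      using fin by (simp_all add: W_def)
    ultimately show ?thesis by (simp add: weighted_automaton_def free_monoid_def)
  qed
  moreover have "k_sequential k A (free_monoid B) W"
    unfolding k_sequential_def
    by (intro exI[of _ V]) (use V disj in \<open>simp add: W_def\<close>)
  moreover have "semantics (free_monoid B) W = semantics (free_monoid B) T"
  proof -
    have W: "semantics (free_monoid B) W = (\<Union>i<k. semantics (free_monoid B) (V i))"
      by (rule semantics_disjoint_union[where A = A]) (use V disj in \<open>simp_all add: W_def\<close>)
    have "semantics (free_monoid B) (V i) = {(w, y). w \<in> lists A \<and> y \<in> F i w}" if "i < k" for i
      using V that by simp
    then have "(w, y) \<in> semantics (free_monoid B) W \<longleftrightarrow> w \<in> lists A \<and> y \<in> (\<Union>i<k. F i w)" for w y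
      unfolding W by auto
    then have "(w, y) \<in> semantics (free_monoid B) W \<longleftrightarrow> w \<in> lists A \<and> y \<in> rel (t_init T) w" for w y
      using F(2) by (cases "w \<in> lists A") (simp_all del: in_lists_conv_set)
    then have "(w, y) \<in> semantics (free_monoid B) W \<longleftrightarrow> (w, y) \<in> semantics (free_monoid B) T" for w y
      using semantics_lists unfolding rel_t_init by blast
    then show ?thesis by (simp add: set_eq_iff)
  qed
  ultimately show ?thesis unfolding positive_k_sequential_def by blast
qed

text \<open>Among \<open>k + 1\<close> pairs of the relation two come from the same of the
  \<open>k\<close> components, whose Lipschitz bound applies. The sum of the constants bounds each
  of them.\<close>

lemma lipschitz_if_positive_k_sequential:
  assumes "positive_k_sequential k A B (semantics (free_monoid B) T)"
  shows "lipschitz_property k (free_group B) (free_gens B)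
    (map_prod id embed_word ` semantics (free_monoid B) T)"
proof -
  obtain W :: "(nat, 'a, 'b list) wa" where W: "k_sequential k A (free_monoid B) W"
    "semantics (free_monoid B) W = semantics (free_monoid B) T"
    using assms unfolding positive_k_sequential_def by blast
  obtain V :: "nat \<Rightarrow> (nat, 'a, 'b list) wa" where V: "\<And>i. i < k \<Longrightarrow> weighted_automaton A (free_monoid B) (V i)" "\<And>i. i < k \<Longrightarrow> sequential (V i)"
    and sem: "semantics (free_monoid B) W = (\<Union>i<k. semantics (free_monoid B) (V i))"
  proof -
    obtain V where V: "\<forall>i<k. weighted_automaton A (free_monoid B) (V i) \<and> sequential (V i)"
        "\<forall>i<k. \<forall>j<k. i \<noteq> j \<longrightarrow> states (V i) \<inter> states (V j) = {}"
        "states W = (\<Union>i<k. states (V i))" "t_init W = (\<Union>i<k. t_init (V i))"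
        "t_final W = (\<Union>i<k. t_final (V i))" "transitions W = (\<Union>i<k. transitions (V i))"
      using W(1) unfolding k_sequential_def by (elim exE conjE) (rule that)
    have "semantics (free_monoid B) W = (\<Union>i<k. semantics (free_monoid B) (V i))"
      by (rule semantics_disjoint_union) (use V in auto)
    then show ?thesis using V(1) by (intro that[of V]) simp_all
  qed
  have "\<exists>L. \<forall>w y w' y'. (w, y) \<in> semantics (free_monoid B) (V i) \<longrightarrow>
    (w', y') \<in> semantics (free_monoid B) (V i) \<longrightarrow> word_dist y y' \<le> L * (word_dist w w' + 1)"
    if "i < k" for i
  proof -
    interpret V: transducer A B "V i"
      using finite_A finite_B V(1)[OF that] by unfold_locales
    show ?thesis by (rule V.sequential_lipschitz[OF V(2)[OF that]]) blast
  qed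
  then have "\<forall>i. \<exists>L. i < k \<longrightarrow> (\<forall>w y w' y'. (w, y) \<in> semantics (free_monoid B) (V i) \<longrightarrow>
    (w', y') \<in> semantics (free_monoid B) (V i) \<longrightarrow> word_dist y y' \<le> L * (word_dist w w' + 1))"
    by simp
  then obtain L where L': "\<forall>i. i < k \<longrightarrow> (\<forall>w y w' y'. (w, y) \<in> semantics (free_monoid B) (V i) \<longrightarrow>
    (w', y') \<in> semantics (free_monoid B) (V i) \<longrightarrow> word_dist y y' \<le> L i * (word_dist w w' + 1))"
    unfolding choice_iff by (elim exE)
  have L: "word_dist y y' \<le> L i * (word_dist w w' + 1)" if "i < k"
    "(w, y) \<in> semantics (free_monoid B) (V i)" "(w', y') \<in> semantics (free_monoid B) (V i)" for i w y w' y'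
    using L' that by blast
  show ?thesis
    unfolding lipschitz_property_def
  proof (rule exI[of _ "\<Sum>i<k. L i"], intro allI impI)
    fix w :: "nat \<Rightarrow> 'a list" and X
    assume R: "\<forall>i\<le>k. (w i, X i) \<in> map_prod id embed_word ` semantics (free_monoid B) T"
    have "\<forall>i. \<exists>y c. i \<le> k \<longrightarrow> X i = embed_word y \<and> (w i, y) \<in> semantics (free_monoid B) T \<and>
        c < k \<and> (w i, y) \<in> semantics (free_monoid B) (V c)"
    proof
      fix i
      show "\<exists>y c. i \<le> k \<longrightarrow> X i = embed_word y \<and> (w i, y) \<in> semantics (free_monoid B) T \<and>
        c < k \<and> (w i, y) \<in> semantics (free_monoid B) (V c)"
      proof (cases "i \<le> k")
        case True
        then obtain y where "X i = embed_word y" "(w i, y) \<in> semantics (free_monoid B) T"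
          using R by (auto simp: map_prod_def)
        then show ?thesis using sem W(2) by auto
      qed simp
    qed
    then obtain y c where yc: "\<forall>i. i \<le> k \<longrightarrow> X i = embed_word (y i) \<and>
        (w i, y i) \<in> semantics (free_monoid B) T \<and>
        c i < k \<and> (w i, y i) \<in> semantics (free_monoid B) (V (c i))"
      unfolding choice_iff by (elim exE)
    have "\<not> inj_on c {..k}"
    proof
      assume "inj_on c {..k}"
      then have "card {..k} \<le> card {..<k}"
        by (rule card_inj_on_le) (use yc in auto)
      then show False by simp
    qed
    then obtain i j where ij: "i < j" "j \<le> k" "c i = c j"
      unfolding inj_on_def by (metis atMost_iff linorder_neqE_nat)
    have "cayley_dist (free_group B) (free_gens B) (X i) (X j) = word_dist (y i) (y j)"
    proof -
      have "X i = embed_word (y i)" "X j = embed_word (y j)"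
        "(w i, y i) \<in> semantics (free_monoid B) T" "(w j, y j) \<in> semantics (free_monoid B) T"
        using yc ij by simp_all
      moreover from this(3,4) have "y i \<in> lists B" "y j \<in> lists B" using semantics_lists by blast+
      ultimately show ?thesis by (simp only: cayley_dist_embed_word)
    qed
    also have "\<dots> \<le> L (c i) * (word_dist (w i) (w j) + 1)"
    proof (rule L)
      have "i \<le> k" using ij by simp
      then show "c i < k" "(w i, y i) \<in> semantics (free_monoid B) (V (c i))" using yc by simp_all
      show "(w j, y j) \<in> semantics (free_monoid B) (V (c i))" using yc ij(2) unfolding ij(3) by simp
    qed
    also have "\<dots> \<le> (\<Sum>i<k. L i) * (word_dist (w i) (w j) + 1)"
    proof (rule mult_le_mono1)
      have "c i \<in> {..<k}" using yc ij by auto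
      then show "L (c i) \<le> (\<Sum>i<k. L i)" by (simp add: member_le_sum)
    qed
    finally show "\<exists>i j. i < j \<and> j \<le> k \<and> cayley_dist (free_group B) (free_gens B) (X i) (X j) \<le>
        (\<Sum>i<k. L i) * (word_dist (w i) (w j) + 1)"
      using ij by blast
  qed
qed

lemma not_branching_if_lipschitz:
  assumes "trimmed T" and lip: "lipschitz_property k (free_group B) (free_gens B)
    (map_prod id embed_word ` semantics (free_monoid B) T)"
  shows "\<not> branching (Suc k) (t_init T)"
proof
  assume "branching (Suc k) (t_init T)"
  obtain L where L: "\<And>(w :: nat \<Rightarrow> 'a list) X. \<forall>i\<le>k. (w i, X i) \<in> map_prod id embed_word ` semantics (free_monoid B) T \<Longrightarrow>
    \<exists>i j. i < j \<and> j \<le> k \<and> cayley_dist (free_group B) (free_gens B) (X i) (X j) \<le> L * (word_dist (w i) (w j) + 1)"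
    using lip unfolding lipschitz_property_def by blast
  have "t_init T \<subseteq> states T \<times> UNIV" using t_init_subset by auto
  then obtain es where es: "length es = Suc k" "\<forall>e\<in>set es. snd e \<in> rel (t_init T) (fst e)"
    "sorted_wrt (\<lambda>e e'. L * (word_dist (fst e) (fst e') + 1) < word_dist (snd e) (snd e')) es"
    using branching_violates_lipschitz[OF assms(1) \<open>branching _ _\<close>] by blast
  have sem: "(fst (es ! i), snd (es ! i)) \<in> semantics (free_monoid B) T" if "i \<le> k" for i
  proof -
    have "es ! i \<in> set es" using es(1) that by simp
    then show ?thesis using es(2) rel_t_init by blast
  qed
  have "\<forall>i\<le>k. (fst (es ! i), embed_word (snd (es ! i))) \<in> map_prod id embed_word ` semantics (free_monoid B) T"
    using imageI[OF sem, of _ "map_prod id embed_word"] unfolding map_prod_simp id_apply by blast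
  from L[OF this] obtain i j where ij: "i < j" "j \<le> k"
    "cayley_dist (free_group B) (free_gens B) (embed_word (snd (es ! i))) (embed_word (snd (es ! j)))
      \<le> L * (word_dist (fst (es ! i)) (fst (es ! j)) + 1)"
    by blast
  moreover have "snd (es ! i) \<in> lists B" "snd (es ! j) \<in> lists B"
    using semantics_lists[OF sem[of i]] semantics_lists[OF sem[of j]] ij by simp_all
  moreover have "L * (word_dist (fst (es ! i)) (fst (es ! j)) + 1) < word_dist (snd (es ! i)) (snd (es ! j))"
    using es(1,3) ij by (simp add: sorted_wrt_iff_nth_less)
  ultimately show False by (simp add: cayley_dist_embed_word)
qed

end

theorem theorem3:
  fixes A :: "'a set" and B :: "'b set"
    and T :: "('q, 'a, 'b list) wa"
    and k :: nat
  assumes "finite A" and "finite B"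
    and "weighted_automaton A (free_monoid B) T"
    and "trimmed T"
    and "k > 0"
  shows
    "(lipschitz_property k (free_group B) (free_gens B)
        (map_prod id embed_word ` semantics (free_monoid B) T)
      \<longleftrightarrow> branching_twinning_property k (free_group B) (map_weights embed_word T))
     \<and> (branching_twinning_property k (free_group B) (map_weights embed_word T)
        \<longleftrightarrow> positive_k_sequential k A B (semantics (free_monoid B) T))"
proof -
  interpret transducer A B T using assms by unfold_locales
  have "branching_twinning_property k (free_group B) (map_weights embed_word T) \<longleftrightarrow>
      \<not> branching (Suc k) (t_init T)"
    using branching_if_not_twinning not_twinning_if_branching by blast
  moreover have "positive_k_sequential k A B (semantics (free_monoid B) T)"
    if "\<not> branching (Suc k) (t_init T)"
    using multi_seq_rel[OF t_init_subset(2,1) that] by (rule positive_k_sequential_if_multi_seq)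
  ultimately show ?thesis
    using not_branching_if_lipschitz[OF \<open>trimmed T\<close>, of k] lipschitz_if_positive_k_sequential[of k]
    by blast
qed

end
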